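(* Let $A \in \{0,\star\}^{d\times d}$ and $B\in\{0,\star\}^{d\times m}$ be such that $(A,B)$ is structurally controllable, and let each nonzero entry $B_{ij}$ carry a cost $w_{ij}\ge 0$. Suppose that the digraph $G(A)$ is strongly connected and that the bipartite graph $\Gamma(A)$ does not have a perfect matching. Then the matrix $B^{*}$ produced by the matching algorithm (described in the context) is such that $(A,B^{*})$ is structurally controllable, and $B^{*}$ solves the problem $\min_{B'\in\mathcal{K}}\|B'\|_w$. In addition, the complexity of the algorithm is $O((d+m)^3)$.
   Context: A matrix with entries in $\{0,\star\}$ is a sparsity matrix: each entry is either a fixed zero or an independent free parameter $\star$. A numerical realization is obtained by assigning real values to the $\star$ entries (zeros stay zero). The pair $(A,B)$ with $A\in\{0,\star\}^{d\times d}$, $B\in\{0,\star\}^{d\times m}$ is structurally controllable if there is at least one numerical realization $(A',B')$ of $(A,B)$ such that the linear system $\dot x = A'x+B'u$ is controllable. $Z(B)=\{(i,j) : B_{ij}=0\}$, and $\mathcal{K}$ is the set of all $B'\in\{0,\star\}^{d\times m}$ with $Z(B)\subset Z(B')$ and $(A,B')$ structurally controllable. For $B'\in\mathcal{K}$, $\|B'\|_w=\sum_{(i,j): B'_{ij}\ne0} w_{ij}$. $G(A)$ is the digraph with vertex set $\{v_1,\dots,v_d\}$ and a directed edge $(v_j,v_i)$ whenever $A_{ij}\neq 0$; it is strongly connected if for each ordered pair of vertices there is a directed path from the first to the second. $\Gamma(A,B)$ is the undirected bipartite graph with parts $V_A^1\sqcup V_B$ and $V_A^2$, where $V_A^1=\{v_1^1,\dots,v_d^1\}$,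 $V_A^2=\{v_1^2,\dots,v_d^2\}$, $V_B=\{u_1,\dots,u_m\}$, and edge set $\mathcal{E}_A\sqcup\mathcal{E}_B$, where $\mathcal{E}_A=\{(v_j^1,v_i^2): A_{ij}\ne0\}$ and $\mathcal{E}_B=\{(u_j,v_i^2): B_{ij}\neq0\}$. $\Gamma(A)$ is its induced subgraph on $V_A^1\sqcup V_A^2$ (edge set $\mathcal{E}_A$). A matching is perfect if it saturates all vertices. Given a non-negative edge cost function, a minimum cost maximum matching (MCMM) is a matching of maximum cardinality whose total cost is minimal among all maximum cardinality matchings. Matching algorithm. Construct $\Gamma(A,B)$, with cost $c(e)=0$ for $e\in\mathcal{E}_A$ and $c(e)=w_{kj}$ for $e=(u_j,v_k^2)\in\mathcal{E}_B$. Find an MCMM $M^{*}$ in $\Gamma(A,B)$ with cost $c$ (by the Hungarian algorithm). Output $B^{*}\in\{0,\star\}^{d\times m}$ with $B^{*}_{\ell k}=\star$ if $(u_k,v_\ell^2)\in M^{*}\cap\mathcal{E}_B$ and $B^{*}_{\ell k}=0$ otherwise. Complexity counts elementary operations (arithmetic operations and comparisons on costs at unit cost). *)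

theory Defs
  imports
    Complex_Main
    "Jordan_Normal_Form.Matrix"
    "Graph_Theory.Digraph_Component"
begin

section \<open>Structural controllability\<close>

datatype entry = Zero | Star

definition realization :: "entry mat \<Rightarrow> real mat \<Rightarrow> bool" where
  "realization A A' \<longleftrightarrow> A' \<in> carrier_mat (dim_row A) (dim_col A) \<and>
     (\<forall>i < dim_row A. \<forall>j < dim_col A. A $$ (i, j) = Zero \<longrightarrow> A' $$ (i, j) = 0)"

text \<open>
  Controllability of the system \<open>x' = A x + B u\<close> in the sense of trajectories: every state can be
  steered to every other state in finite time by a continuous input. Since vectors of type
  \<open>real vec\<close> carry no topology, continuity and derivatives are taken componentwise.
\<close>

definition controllable :: "real mat \<Rightarrow> real mat \<Rightarrow> bool" where
  "controllable A B \<longleftrightarrow>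
     (\<forall>x0 \<in> carrier_vec (dim_row A). \<forall>x1 \<in> carrier_vec (dim_row A).
        \<exists>(T :: real) x u. T > 0 \<and> x 0 = x0 \<and> x T = x1 \<and>
          (\<forall>t \<in> {0..T}. x t \<in> carrier_vec (dim_row A) \<and> u t \<in> carrier_vec (dim_col B)) \<and>
          (\<forall>j < dim_col B. continuous_on {0..T} (\<lambda>t. u t $ j)) \<and>
          (\<forall>t \<in> {0..T}. \<forall>i < dim_row A.
             ((\<lambda>s. x s $ i) has_real_derivative (A *\<^sub>v x t + B *\<^sub>v u t) $ i) (at t within {0..T})))"

definition structurally_controllable :: "entry mat \<Rightarrow> entry mat \<Rightarrow> bool" where
  "structurally_controllable A B \<longleftrightarrow>
     (\<exists>A' B'. realization A A' \<and> realization B B' \<and> controllable A' B')"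

definition zero_pattern :: "entry mat \<Rightarrow> (nat \<times> nat) set" where
  "zero_pattern B = {(i, j). i < dim_row B \<and> j < dim_col B \<and> B $$ (i, j) = Zero}"

definition feasible :: "entry mat \<Rightarrow> entry mat \<Rightarrow> entry mat set" where
  "feasible A B = {B' \<in> carrier_mat (dim_row B) (dim_col B).
     zero_pattern B \<subseteq> zero_pattern B' \<and> structurally_controllable A B'}"

definition weight :: "real mat \<Rightarrow> entry mat \<Rightarrow> real" where
  "weight w B = (\<Sum>(i, j) \<in> {(i, j). i < dim_row B \<and> j < dim_col B \<and> B $$ (i, j) \<noteq> Zero}. w $$ (i, j))"


section \<open>The digraph \<open>G(A)\<close> and the bipartite graph \<open>\<Gamma>(A, B)\<close>\<close>

definition state_digraph :: "entry mat \<Rightarrow> (nat, nat \<times> nat) pre_digraph" where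
  "state_digraph A =
     \<lparr>verts = {..<dim_row A},
      arcs = {(j, i). i < dim_row A \<and> j < dim_col A \<and> A $$ (i, j) \<noteq> Zero},
      tail = fst, head = snd\<rparr>"

datatype vertex = V1 nat | V2 nat | U nat

text \<open>
  An undirected edge of the bipartite graph is written as a pair whose second component is its
  endpoint in the part \<open>V2\<close>.
\<close>

type_synonym edge = "vertex \<times> vertex"

definition edges_A :: "entry mat \<Rightarrow> edge set" where
  "edges_A A = {(V1 j, V2 i) | i j. i < dim_row A \<and> j < dim_col A \<and> A $$ (i, j) \<noteq> Zero}"

definition edges_B :: "entry mat \<Rightarrow> edge set" where
  "edges_B B = {(U j, V2 i) | i j. i < dim_row B \<and> j < dim_col B \<and> B $$ (i, j) \<noteq> Zero}"

definition vertices_A :: "entry mat \<Rightarrow> vertex set" where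
  "vertices_A A = V1 ` {..<dim_col A} \<union> V2 ` {..<dim_row A}"

definition endpoints :: "edge \<Rightarrow> vertex set" where
  "endpoints e = {fst e, snd e}"

definition matching :: "edge set \<Rightarrow> edge set \<Rightarrow> bool" where
  "matching E M \<longleftrightarrow> M \<subseteq> E \<and> (\<forall>e \<in> M. \<forall>f \<in> M. e \<noteq> f \<longrightarrow> endpoints e \<inter> endpoints f = {})"

definition perfect_matching :: "vertex set \<Rightarrow> edge set \<Rightarrow> edge set \<Rightarrow> bool" where
  "perfect_matching V E M \<longleftrightarrow> matching E M \<and> V \<subseteq> (\<Union>e \<in> M. endpoints e)"

definition max_matching :: "edge set \<Rightarrow> edge set \<Rightarrow> bool" where
  "max_matching E M \<longleftrightarrow> matching E M \<and> (\<forall>N. matching E N \<longrightarrow> card N \<le> card M)"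

definition min_cost_max_matching :: "edge set \<Rightarrow> (edge \<Rightarrow> real) \<Rightarrow> edge set \<Rightarrow> bool" where
  "min_cost_max_matching E c M \<longleftrightarrow>
     max_matching E M \<and> (\<forall>N. max_matching E N \<longrightarrow> sum c M \<le> sum c N)"


section \<open>The matching algorithm\<close>

fun edge_cost :: "real mat \<Rightarrow> edge \<Rightarrow> real" where
  "edge_cost w (U j, V2 k) = w $$ (k, j)"
| "edge_cost w _ = 0"

definition pattern_of_matching :: "nat \<Rightarrow> nat \<Rightarrow> edge set \<Rightarrow> entry mat" where
  "pattern_of_matching d m M = mat d m (\<lambda>(l, k). if (U k, V2 l) \<in> M then Star else Zero)"

text \<open>
  \<open>M\<close> is a matching that the algorithm may select and \<open>Bs\<close> the corresponding output; this is a
  relation because the minimum cost maximum matching need not be unique.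
\<close>

definition matching_algorithm ::
    "nat \<Rightarrow> nat \<Rightarrow> entry mat \<Rightarrow> entry mat \<Rightarrow> real mat \<Rightarrow> edge set \<Rightarrow> entry mat \<Rightarrow> bool" where
  "matching_algorithm d m A B w M Bs \<longleftrightarrow>
     min_cost_max_matching (edges_A A \<union> edges_B B) (edge_cost w) M \<and> Bs = pattern_of_matching d m M"


section \<open>A real RAM language with operation counts\<close>

text \<open>
  Every program variable names a two-dimensional array, either of indices (natural numbers) or
  of costs (reals); scalars and vectors use index \<open>0\<close> in the missing dimensions.
  Every constant, memory access, arithmetic operation, comparison, connective, assignment,
  branch and no-op costs one unit.
\<close>

datatype nexp = NConst nat | NVar string nexp nexp | NAdd nexp nexp

datatype rexp = RConst real | RVar string nexp nexp | RAdd rexp rexp | RSub rexp rexp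

datatype bexp = NEq nexp nexp | NLess nexp nexp | RLess rexp rexp | BNot bexp | Conj bexp bexp | Disj bexp bexp

datatype com =
    Skip
  | NAssign string nexp nexp nexp
  | RAssign string nexp nexp rexp
  | Seq com com  (infixr \<open>;;\<close> 60)
  | Cond bexp com com
  | While bexp com

type_synonym state = "(string \<Rightarrow> nat \<Rightarrow> nat \<Rightarrow> nat) \<times> (string \<Rightarrow> nat \<Rightarrow> nat \<Rightarrow> real)"

fun nval :: "state \<Rightarrow> nexp \<Rightarrow> nat" where
  "nval s (NConst n) = n"
| "nval s (NVar x a b) = fst s x (nval s a) (nval s b)"
| "nval s (NAdd a b) = nval s a + nval s b"

fun rval :: "state \<Rightarrow> rexp \<Rightarrow> real" where
  "rval s (RConst r) = r"
| "rval s (RVar x a b) = snd s x (nval s a) (nval s b)"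
| "rval s (RAdd a b) = rval s a + rval s b"
| "rval s (RSub a b) = rval s a - rval s b"

fun bval :: "state \<Rightarrow> bexp \<Rightarrow> bool" where
  "bval s (NEq a b) \<longleftrightarrow> nval s a = nval s b"
| "bval s (NLess a b) \<longleftrightarrow> nval s a < nval s b"
| "bval s (RLess a b) \<longleftrightarrow> rval s a < rval s b"
| "bval s (BNot b) \<longleftrightarrow> \<not> bval s b"
| "bval s (Conj a b) \<longleftrightarrow> bval s a \<and> bval s b"
| "bval s (Disj a b) \<longleftrightarrow> bval s a \<or> bval s b"

fun ncost :: "nexp \<Rightarrow> nat" where
  "ncost (NConst n) = 1"
| "ncost (NVar x a b) = ncost a + ncost b + 1"
| "ncost (NAdd a b) = ncost a + ncost b + 1"

fun rcost :: "rexp \<Rightarrow> nat" where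
  "rcost (RConst r) = 1"
| "rcost (RVar x a b) = ncost a + ncost b + 1"
| "rcost (RAdd a b) = rcost a + rcost b + 1"
| "rcost (RSub a b) = rcost a + rcost b + 1"

fun bcost :: "bexp \<Rightarrow> nat" where
  "bcost (NEq a b) = ncost a + ncost b + 1"
| "bcost (NLess a b) = ncost a + ncost b + 1"
| "bcost (RLess a b) = rcost a + rcost b + 1"
| "bcost (BNot b) = bcost b + 1"
| "bcost (Conj a b) = bcost a + bcost b + 1"
| "bcost (Disj a b) = bcost a + bcost b + 1"

definition upd_cell :: "(string \<Rightarrow> nat \<Rightarrow> nat \<Rightarrow> 'a) \<Rightarrow> string \<Rightarrow> nat \<Rightarrow> nat \<Rightarrow> 'a \<Rightarrow> string \<Rightarrow> nat \<Rightarrow> nat \<Rightarrow> 'a" where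
  "upd_cell f x i j v = f(x := (f x)(i := (f x i)(j := v)))"

text \<open>\<open>exec c s t s'\<close>: started in \<open>s\<close>, program \<open>c\<close> terminates in \<open>s'\<close> after \<open>t\<close> elementary operations.\<close>

inductive exec :: "com \<Rightarrow> state \<Rightarrow> nat \<Rightarrow> state \<Rightarrow> bool" where
  Skip: "exec Skip s 1 s"
| NAssign: "exec (NAssign x a b e) s (ncost a + ncost b + ncost e + 1)
     (upd_cell (fst s) x (nval s a) (nval s b) (nval s e), snd s)"
| RAssign: "exec (RAssign x a b e) s (ncost a + ncost b + rcost e + 1)
     (fst s, upd_cell (snd s) x (nval s a) (nval s b) (rval s e))"
| Seq: "exec c1 s t1 s' \<Longrightarrow> exec c2 s' t2 s'' \<Longrightarrow> exec (c1 ;; c2) s (t1 + t2) s''"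
| CondTrue: "bval s b \<Longrightarrow> exec c1 s t s' \<Longrightarrow> exec (Cond b c1 c2) s (bcost b + 1 + t) s'"
| CondFalse: "\<not> bval s b \<Longrightarrow> exec c2 s t s' \<Longrightarrow> exec (Cond b c1 c2) s (bcost b + 1 + t) s'"
| WhileFalse: "\<not> bval s b \<Longrightarrow> exec (While b c) s (bcost b + 1) s"
| WhileTrue: "bval s b \<Longrightarrow> exec c s t1 s' \<Longrightarrow> exec (While b c) s' t2 s'' \<Longrightarrow>
     exec (While b c) s (bcost b + 1 + t1 + t2) s''"

abbreviation nsc :: "string \<Rightarrow> nexp" where "nsc x \<equiv> NVar x (NConst 0) (NConst 0)"
abbreviation nvec :: "string \<Rightarrow> nexp \<Rightarrow> nexp" where "nvec x i \<equiv> NVar x (NConst 0) i"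
abbreviation rsc :: "string \<Rightarrow> rexp" where "rsc x \<equiv> RVar x (NConst 0) (NConst 0)"
abbreviation rvec :: "string \<Rightarrow> nexp \<Rightarrow> rexp" where "rvec x i \<equiv> RVar x (NConst 0) i"
abbreviation set_nsc :: "string \<Rightarrow> nexp \<Rightarrow> com" where "set_nsc x e \<equiv> NAssign x (NConst 0) (NConst 0) e"
abbreviation set_nvec :: "string \<Rightarrow> nexp \<Rightarrow> nexp \<Rightarrow> com" where "set_nvec x i e \<equiv> NAssign x (NConst 0) i e"
abbreviation set_rsc :: "string \<Rightarrow> rexp \<Rightarrow> com" where "set_rsc x e \<equiv> RAssign x (NConst 0) (NConst 0) e"
abbreviation set_rvec :: "string \<Rightarrow> nexp \<Rightarrow> rexp \<Rightarrow> com" where "set_rvec x i e \<equiv> RAssign x (NConst 0) i e"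
abbreviation nsuc :: "nexp \<Rightarrow> nexp" where "nsuc e \<equiv> NAdd e (NConst 1)"

text \<open>\<open>For x a b c\<close> runs \<open>c\<close> for \<open>x = a, \<dots>, b - 1\<close>.\<close>

definition For :: "string \<Rightarrow> nexp \<Rightarrow> nexp \<Rightarrow> com \<Rightarrow> com" where
  "For x a b c = (set_nsc x a ;; While (NLess (nsc x) b) (c ;; set_nsc x (nsuc (nsc x))))"


section \<open>Implementation of the matching algorithm\<close>

text \<open>
  Inputs: dimensions \<open>d\<close>, \<open>m\<close>, arrays \<open>A\<close>, \<open>B\<close> (\<open>1\<close> for a free entry, \<open>0\<close> for a zero) and \<open>w\<close>.

  The graph is stored as a cost matrix \<open>c\<close> with rows \<open>1..d\<close> (the vertices \<open>V2\<close>) and columns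
  \<open>1..d+m\<close> (the vertices \<open>V1\<close>, followed by the vertices \<open>U\<close>). Absent edges get the cost
  \<open>W = 1 +\<close> the sum of all edge costs, so an assignment of all rows to distinct columns of minimal
  total cost uses as many edges of the graph as possible, and among those choices is cheapest.
\<close>

definition construct_graph :: com where
  "construct_graph =
    (set_rsc ''W'' (RConst 1) ;;
     For ''i'' (NConst 0) (nsc ''d'') (
       For ''j'' (NConst 0) (nsc ''m'') (
         Cond (NEq (NVar ''B'' (nsc ''i'') (nsc ''j'')) (NConst 1))
           (set_rsc ''W'' (RAdd (rsc ''W'') (RVar ''w'' (nsc ''i'') (nsc ''j''))))
           Skip)) ;;
     For ''i'' (NConst 0) (nsc ''d'') (
       For ''j'' (NConst 0) (nsc ''d'') (
         Cond (NEq (NVar ''A'' (nsc ''i'') (nsc ''j'')) (NConst 1))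
           (RAssign ''c'' (nsuc (nsc ''i'')) (nsuc (nsc ''j'')) (RConst 0))
           (RAssign ''c'' (nsuc (nsc ''i'')) (nsuc (nsc ''j'')) (rsc ''W''))) ;;
       For ''j'' (NConst 0) (nsc ''m'') (
         Cond (NEq (NVar ''B'' (nsc ''i'') (nsc ''j'')) (NConst 1))
           (RAssign ''c'' (nsuc (nsc ''i'')) (nsuc (NAdd (nsc ''d'') (nsc ''j''))) (RVar ''w'' (nsc ''i'') (nsc ''j'')))
           (RAssign ''c'' (nsuc (nsc ''i'')) (nsuc (NAdd (nsc ''d'') (nsc ''j''))) (rsc ''W'')))))"

text \<open>
  The Hungarian algorithm in its shortest augmenting path form. Rows are inserted one at a time;
  \<open>u\<close> and \<open>v\<close> are the row and column potentials, \<open>p[j]\<close> is the row assigned to column \<open>j\<close> (\<open>0\<close> if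
  there is none), and the artificial column \<open>0\<close> holds the row being inserted. \<open>minv[j]\<close> is the
  least reduced cost found so far from the alternating tree (the columns marked in \<open>used\<close>) to
  column \<open>j\<close>, and \<open>way[j]\<close> is the preceding tree column.
\<close>

definition hungarian_scan :: com where
  "hungarian_scan =
    For ''j'' (NConst 1) (nsuc (nsc ''n'')) (
      Cond (NEq (nvec ''used'' (nsc ''j'')) (NConst 0))
        (set_rsc ''cur'' (RSub (RSub (RVar ''c'' (nsc ''i0'') (nsc ''j''))
                                     (rvec ''u'' (nsc ''i0''))) (rvec ''v'' (nsc ''j''))) ;;
         Cond (Disj (NEq (nsc ''j0'') (NConst 0)) (RLess (rsc ''cur'') (rvec ''minv'' (nsc ''j''))))
           (set_rvec ''minv'' (nsc ''j'') (rsc ''cur'') ;;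
            set_nvec ''way'' (nsc ''j'') (nsc ''j0''))
           Skip ;;
         Cond (Disj (NEq (nsc ''j1'') (NConst 0)) (RLess (rvec ''minv'' (nsc ''j'')) (rsc ''delta'')))
           (set_rsc ''delta'' (rvec ''minv'' (nsc ''j'')) ;;
            set_nsc ''j1'' (nsc ''j''))
           Skip)
        Skip)"

definition hungarian_update :: com where
  "hungarian_update =
    For ''j'' (NConst 0) (nsuc (nsc ''n'')) (
      Cond (NEq (nvec ''used'' (nsc ''j'')) (NConst 1))
        (set_rvec ''u'' (nvec ''p'' (nsc ''j''))
           (RAdd (rvec ''u'' (nvec ''p'' (nsc ''j''))) (rsc ''delta'')) ;;
         set_rvec ''v'' (nsc ''j'') (RSub (rvec ''v'' (nsc ''j'')) (rsc ''delta'')))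
        (set_rvec ''minv'' (nsc ''j'') (RSub (rvec ''minv'' (nsc ''j'')) (rsc ''delta''))))"

definition hungarian_insert :: com where
  "hungarian_insert =
    (set_nvec ''p'' (NConst 0) (nsc ''i'') ;;
     set_nsc ''j0'' (NConst 0) ;;
     For ''j'' (NConst 0) (nsuc (nsc ''n'')) (set_nvec ''used'' (nsc ''j'') (NConst 0)) ;;
     While (BNot (NEq (nvec ''p'' (nsc ''j0'')) (NConst 0)))
       (set_nvec ''used'' (nsc ''j0'') (NConst 1) ;;
        set_nsc ''i0'' (nvec ''p'' (nsc ''j0'')) ;;
        set_nsc ''j1'' (NConst 0) ;;
        hungarian_scan ;;
        hungarian_update ;;
        set_nsc ''j0'' (nsc ''j1'')) ;;
     While (BNot (NEq (nsc ''j0'') (NConst 0)))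
       (set_nsc ''j1'' (nvec ''way'' (nsc ''j0'')) ;;
        set_nvec ''p'' (nsc ''j0'') (nvec ''p'' (nsc ''j1'')) ;;
        set_nsc ''j0'' (nsc ''j1'')))"

definition hungarian :: com where
  "hungarian =
    (set_nsc ''n'' (NAdd (nsc ''d'') (nsc ''m'')) ;;
     For ''j'' (NConst 0) (nsuc (nsc ''n''))
       (set_nvec ''p'' (nsc ''j'') (NConst 0) ;; set_rvec ''v'' (nsc ''j'') (RConst 0)) ;;
     For ''i'' (NConst 0) (nsuc (nsc ''d'')) (set_rvec ''u'' (nsc ''i'') (RConst 0)) ;;
     For ''i'' (NConst 1) (nsuc (nsc ''d'')) hungarian_insert)"

text \<open>
  The matching consists of the assigned pairs that are edges of the graph; it is stored in the
  0-1 arrays \<open>MA\<close> and \<open>MB\<close>, from which the output array \<open>Bs\<close> is read off.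
\<close>

definition collect_matching :: com where
  "collect_matching =
    For ''i'' (NConst 0) (nsc ''d'') (
      For ''j'' (NConst 0) (nsc ''d'') (
        Cond (Conj (NEq (NVar ''A'' (nsc ''i'') (nsc ''j'')) (NConst 1))
                 (NEq (nvec ''p'' (nsuc (nsc ''j''))) (nsuc (nsc ''i''))))
          (NAssign ''MA'' (nsc ''i'') (nsc ''j'') (NConst 1))
          (NAssign ''MA'' (nsc ''i'') (nsc ''j'') (NConst 0))) ;;
      For ''j'' (NConst 0) (nsc ''m'') (
        Cond (Conj (NEq (NVar ''B'' (nsc ''i'') (nsc ''j'')) (NConst 1))
                 (NEq (nvec ''p'' (nsuc (NAdd (nsc ''d'') (nsc ''j'')))) (nsuc (nsc ''i''))))
          (NAssign ''MB'' (nsc ''i'') (nsc ''j'') (NConst 1))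
          (NAssign ''MB'' (nsc ''i'') (nsc ''j'') (NConst 0))))"

definition copy_output :: com where
  "copy_output =
    For ''i'' (NConst 0) (nsc ''d'') (
      For ''j'' (NConst 0) (nsc ''m'') (
        NAssign ''Bs'' (nsc ''i'') (nsc ''j'') (NVar ''MB'' (nsc ''i'') (nsc ''j''))))"

definition matching_program :: com where
  "matching_program = (construct_graph ;; hungarian ;; collect_matching ;; copy_output)"

definition input_state :: "nat \<Rightarrow> nat \<Rightarrow> entry mat \<Rightarrow> entry mat \<Rightarrow> real mat \<Rightarrow> state \<Rightarrow> bool" where
  "input_state d m A B w s \<longleftrightarrow>
     fst s ''d'' 0 0 = d \<and> fst s ''m'' 0 0 = m \<and>
     (\<forall>i < d. \<forall>j < d. fst s ''A'' i j = (if A $$ (i, j) = Zero then 0 else 1)) \<and>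
     (\<forall>i < d. \<forall>j < m. fst s ''B'' i j = (if B $$ (i, j) = Zero then 0 else 1)) \<and>
     (\<forall>i < d. \<forall>j < m. snd s ''w'' i j = w $$ (i, j))"

definition output_matching :: "nat \<Rightarrow> nat \<Rightarrow> state \<Rightarrow> edge set" where
  "output_matching d m s =
     {(V1 j, V2 i) | i j. i < d \<and> j < d \<and> fst s ''MA'' i j = 1} \<union>
     {(U j, V2 i) | i j. i < d \<and> j < m \<and> fst s ''MB'' i j = 1}"

definition output_matrix :: "nat \<Rightarrow> nat \<Rightarrow> state \<Rightarrow> entry mat" where
  "output_matrix d m s = mat d m (\<lambda>(i, j). if fst s ''Bs'' i j = 1 then Star else Zero)"

end

theory Submission
  imports
    Defs
    "HOL-Computational_Algebra.Fundamental_Theorem_Algebra"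
    "Jordan_Normal_Form.Determinant"
begin

text \<open>
  A trajectory-controllable system has linearly independent rows \<open>[A' B']\<close>, which yields a matching
  saturating all states; so every feasible pattern costs at least as much as a minimum cost maximum
  matching. Conversely, a saturating matching splits the states into stems (paths starting at an
  input) and cycles. There is a stem because \<open>\<Gamma>(A)\<close> has no perfect matching. Starting from the
  stems and using strong connectivity, the cycles are attached one at a time by single edges. The
  weight of each new cycle is chosen such that the moduli of its eigenvalues avoid those for which
  the Hautus test might fail. The Hautus test gives controllability without matrix exponentials:
  the set of directions \<open>v\<close> such that forcing terms \<open>p v\<close>, with \<open>p\<close> a polynomial vanishing to high
  order at both endpoints, can be compensated by polynomial controls is an \<open>A'\<close>-invariant subspace
  containing the columns of \<open>B'\<close>, and an arbitrary polynomial curve joining the two states that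
  satisfies the free equation to high order at the endpoints can then be corrected.

  For the program, linear programming duality applies: feasible potentials that are tight on the
  assigned pairs certify that the assignment is cheapest. Each of the \<open>d\<close> insertions scans at most
  \<open>n + 1\<close> tree columns with \<open>O(n)\<close> operations each, where \<open>n = d + m\<close>.
\<close>


section \<open>Matchings from linearly independent rows\<close>

text \<open>The obstacle in attaching a cycle is spectral overlap. An edge from the finished part
  into the cycle leaves the left-eigenvector equations of the cycle autonomous, but its component
  \<open>y c\<close> leaks into those of the finished part. A cycle of length L with the same weight
  \<alpha> on all its edges has eigenvalues with \<open>l ^ L = \<alpha> ^ L\<close>, hence all of
  modulus \<alpha>. One real number thus separates it from everything built before, and a finite set
  \<open>R\<close> of excluded moduli replaces an argument about generic parameters. Stems are
  nilpotent, which is why \<open>R\<close> starts as \<open>{0}\<close>.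

  Polynomial controls work on the fixed interval [0,1]: each application of the system matrix to a
  direction costs one derivative of the forcing, hence one order of vanishing at the endpoints, and
  a curve with residual of any prescribed order exists.

  In the program, the penalty \<open>W\<close> merges the two goals of a minimum cost maximum
  matching, cardinality before cost, into a single assignment problem in which every row is covered.
  The constants in the time bounds are generous; only the exponents are sharp enough to
  matter.\<close>

lemma subspace_with_trivial_annihilator:
  fixes V :: "('b \<Rightarrow> 'a::field) set" and x :: "'b \<Rightarrow> 'a"
  assumes I: "finite I"
    and zero: "(\<lambda>i. 0) \<in> V"
    and add: "\<And>v w. v \<in> V \<Longrightarrow> w \<in> V \<Longrightarrow> (\<lambda>i. v i + w i) \<in> V"
    and scale: "\<And>c v. v \<in> V \<Longrightarrow> (\<lambda>i. c * v i) \<in> V"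
    and ann: "\<And>y. (\<And>v. v \<in> V \<Longrightarrow> (\<Sum>i\<in>I. y i * v i) = 0) \<Longrightarrow> \<forall>i\<in>I. y i = 0"
  shows "\<exists>v\<in>V. \<forall>i\<in>I. v i = x i"
proof -
  define full where "full J \<longleftrightarrow> (\<forall>x. \<exists>v\<in>V. \<forall>i\<in>J. v i = x i)" for J
  have sum: "(\<lambda>i. \<Sum>j\<in>J. c j * f j i) \<in> V" if "finite J" "\<And>j. j \<in> J \<Longrightarrow> f j \<in> V" for J and c :: "'b \<Rightarrow> 'a" and f
    using that
  proof (induction J rule: finite_induct)
    case empty then show ?case using zero by simp
  next
    case (insert a F)
    have "(\<lambda>i. c a * f a i) \<in> V" "(\<lambda>i. \<Sum>j\<in>F. c j * f j i) \<in> V"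
      using insert scale by auto
    from add[OF this] show ?case using insert by simp
  qed
  have "full J" if "finite J" "J \<subseteq> I" for J
    using that
  proof (induction J rule: finite_induct)
    case empty then show ?case using zero by (auto simp: full_def)
  next
    case (insert a J)
    then have full: "full J" and J: "finite J" "a \<notin> J" "a \<in> I" "J \<subseteq> I" by auto
    obtain f where f: "\<And>j. j \<in> J \<Longrightarrow> f j \<in> V" "\<And>i j. j \<in> J \<Longrightarrow> i \<in> J \<Longrightarrow> f j i = (if i = j then 1 else 0)"
    proof -
      have "\<exists>g\<in>V. \<forall>i\<in>J. g i = (if i = j then 1 else 0)" for j
        using full unfolding full_def by (rule allE[where x = "\<lambda>i. if i = j then 1 else 0"])
      then show ?thesis using that by metis
    qed
    have nz: "\<exists>v\<in>V. (\<forall>i\<in>J. v i = 0) \<and> v a \<noteq> 0"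
    proof (rule ccontr)
      assume *: "\<not> ?thesis"
      \<comment> \<open>\<open>y\<close> represents the functional
        \<open>v a - (\<Sum>j\<in>J. v j * f j a)\<close>. If every member of \<open>V\<close> that
        vanishes on \<open>J\<close> also vanished at \<open>a\<close>, the values on
        \<open>J\<close> would determine \<open>v a\<close> through the dual basis \<open>f\<close>,
        so \<open>y\<close> would annihilate \<open>V\<close> although
        \<open>y a = 1\<close>.\<close>
      define y where "y i = (if i = a then 1 else if i \<in> J then - f i a else 0)" for i
      have "(\<Sum>i\<in>I. y i * v i) = 0" if v: "v \<in> V" for v
      proof -
        define z where "z i = v i + (-1) * (\<Sum>j\<in>J. v j * f j i)" for i
        have "z \<in> V" unfolding z_def by (rule add[OF v scale[OF sum[OF J(1) f(1)]]])
        moreover have "z i = 0" if "i \<in> J" for i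
        proof -
          have "(\<Sum>j\<in>J. v j * f j i) = (\<Sum>j\<in>J. if i = j then v j else 0)"
            by (rule sum.cong) (use that f(2) in auto)
          then show ?thesis using that J(1) by (simp add: z_def)
        qed
        ultimately have "z a = 0" using * by blast
        have "(\<Sum>i\<in>I. y i * v i) = (\<Sum>i\<in>insert a J. y i * v i)"
          by (rule sum.mono_neutral_right) (use I J in \<open>auto simp: y_def\<close>)
        also have "\<dots> = v a + (\<Sum>i\<in>J. - (f i a * v i))"
          using J by (subst sum.insert) (auto simp: y_def intro!: sum.cong)
        also have "\<dots> = z a" by (simp add: z_def sum_negf mult.commute)
        finally show ?thesis using \<open>z a = 0\<close> by simp
      qed
      then have "y a = 0" using ann J(3) by blast
      then show False by (simp add: y_def)
    qed
    then obtain v where v: "v \<in> V" "\<And>i. i \<in> J \<Longrightarrow> v i = 0" "v a \<noteq> 0" by blast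
    show ?case unfolding full_def
    proof
      fix x
      obtain g where g: "g \<in> V" "\<forall>i\<in>J. g i = x i" using full unfolding full_def by blast
      have "(\<lambda>i. g i + (x a - g a) / v a * v i) \<in> V" using add[OF g(1) scale[OF v(1)]] by blast
      then show "\<exists>v\<in>V. \<forall>i\<in>insert a J. v i = x i"
        by (rule bexI[rotated]) (use g v in auto)
    qed
  qed
  then show ?thesis using I unfolding full_def by blast
qed

text \<open>This is Laplace expansion without determinants, as \<open>J\<close> may be larger than
  \<open>I\<close>. Independence makes the system with the unit vector at \<open>r\<close> as
  right-hand side solvable. A column \<open>c\<close> with \<open>a r c * x c \<noteq> 0\<close> for
  a solution \<open>x\<close> plays the part of a nonzero minor: without row \<open>r\<close> and
  column \<open>c\<close> the remaining rows are still independent, and induction matches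
  them.\<close>

lemma rows_independent_imp_matching:
  fixes a :: "'r \<Rightarrow> 'c \<Rightarrow> 'a::field"
  assumes "finite I" "finite J"
    and "\<And>y. (\<And>j. j \<in> J \<Longrightarrow> (\<Sum>i\<in>I. y i * a i j) = 0) \<Longrightarrow> \<forall>i\<in>I. y i = 0"
  shows "\<exists>f. inj_on f I \<and> (\<forall>i\<in>I. f i \<in> J \<and> a i (f i) \<noteq> 0)"
  using assms
proof (induction I arbitrary: J rule: finite_induct)
  case empty then show ?case by simp
next
  case (insert r I)
  note ind = insert.prems(2) and J = insert.prems(1)
  have "\<exists>v\<in>{v. \<exists>x. \<forall>i. v i = (\<Sum>j\<in>J. a i j * x j)}. \<forall>i\<in>insert r I. v i = (if i = r then 1 else 0)"
  proof (rule subspace_with_trivial_annihilator, goal_cases)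
    case 1 show ?case using insert by simp
  next
    case 2 show ?case by (auto intro!: exI[of _ "\<lambda>_. 0"])
  next
    case (3 v w)
    then obtain x x' where "\<And>i. v i = (\<Sum>j\<in>J. a i j * x j)" "\<And>i. w i = (\<Sum>j\<in>J. a i j * x' j)" by auto
    then show ?case by (auto intro!: exI[of _ "\<lambda>j. x j + x' j"] simp: sum.distrib distrib_left)
  next
    case (4 c v)
    then obtain x where "\<And>i. v i = (\<Sum>j\<in>J. a i j * x j)" by auto
    then show ?case by (auto intro!: exI[of _ "\<lambda>j. c * x j"] simp: sum_distrib_left mult_ac)
  next
    case (5 y)
    have "(\<Sum>i\<in>insert r I. y i * a i j) = 0" if "j \<in> J" for j
      using 5[of "\<lambda>i. a i j"] that J
      by (force intro!: exI[of _ "\<lambda>k. if k = j then 1 else 0"] simp: if_distrib cong: if_cong)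
    then show ?case using ind by blast
  qed
  then obtain v x where "\<forall>i. v i = (\<Sum>j\<in>J. a i j * x j)" "\<forall>i\<in>insert r I. v i = (if i = r then 1 else 0)"
    by blast
  then have x: "(\<Sum>j\<in>J. a i j * x j) = (if i = r then 1 else 0)" if "i \<in> insert r I" for i
    using that by auto
  have "\<exists>j\<in>J. a r j * x j \<noteq> 0"
  proof (rule ccontr)
    assume "\<not> ?thesis"
    then have "(\<Sum>j\<in>J. a r j * x j) = 0" by (intro sum.neutral) auto
    then show False using x[of r] by simp
  qed
  then obtain c where c: "c \<in> J" "a r c \<noteq> 0" "x c \<noteq> 0" by auto
  have "\<forall>i\<in>I. y i = 0" if y: "\<And>j. j \<in> J - {c} \<Longrightarrow> (\<Sum>i\<in>I. y i * a i j) = 0" for y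
  proof -
    define s where "s j = (\<Sum>i\<in>I. y i * a i j)" for j
    \<comment> \<open>The product \<open>y a x\<close> is evaluated in two orders.
      \<open>a x\<close> is supported on row \<open>r\<close>, which \<open>y\<close> does not see,
      so the value is 0; \<open>y a\<close> is supported on column \<open>c\<close>, so the value is
      \<open>s c * x c\<close>. Hence \<open>y\<close> annihilates column \<open>c\<close> too, and
      independence of all rows applies.\<close>
    have "(\<Sum>j\<in>J. s j * x j) = (\<Sum>i\<in>I. y i * (\<Sum>j\<in>J. a i j * x j))"
      unfolding s_def sum_distrib_right sum_distrib_left by (subst sum.swap) (simp add: mult_ac)
    also have "\<dots> = 0" using x insert.hyps by (intro sum.neutral) auto
    also have "(\<Sum>j\<in>J. s j * x j) = (\<Sum>j\<in>{c}. s j * x j)"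
      by (rule sum.mono_neutral_right) (use J c y in \<open>auto simp: s_def\<close>)
    finally have "s c = 0" using c by simp
    then have *: "(\<Sum>i\<in>I. y i * a i j) = 0" if "j \<in> J" for j
      using y that unfolding s_def by (cases "j = c") auto
    define y' where "y' i = (if i = r then 0 else y i)" for i
    have "(\<Sum>i\<in>insert r I. y' i * a i j) = (\<Sum>i\<in>I. y i * a i j)" for j
      using insert.hyps by (auto simp: y'_def intro!: sum.cong)
    then have "\<forall>i\<in>insert r I. y' i = 0" using * ind[of y'] by simp
    then show ?thesis using insert.hyps by (auto simp: y'_def split: if_splits)
  qed
  then obtain f where f: "inj_on f I" "\<forall>i\<in>I. f i \<in> J - {c} \<and> a i (f i) \<noteq> 0"
    using insert.IH[of "J - {c}"] J by blast
  have "inj_on (f(r := c)) (insert r I)"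
    by (rule inj_onI) (use f insert.hyps in \<open>auto simp: inj_on_def split: if_splits\<close>)
  moreover have "\<forall>i\<in>insert r I. (f(r := c)) i \<in> J \<and> a i ((f(r := c)) i) \<noteq> 0"
    using f c insert.hyps by auto
  ultimately show ?case by blast
qed

text \<open>A vector \<open>y\<close> that annihilates both matrices from the left makes its product
  with the state a conserved quantity. Steering from 0 to \<open>y\<close> itself then forces the
  sum of the squares of \<open>y\<close> to be 0.\<close>

lemma controllable_imp_rows_independent:
  assumes A: "A \<in> carrier_mat d d" and B: "B \<in> carrier_mat d m" and ctrl: "controllable A B"
    and yA: "\<And>j. j < d \<Longrightarrow> (\<Sum>i<d. y i * A $$ (i, j)) = 0"
    and yB: "\<And>k. k < m \<Longrightarrow> (\<Sum>i<d. y i * B $$ (i, k)) = 0"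
  shows "\<forall>i<d. y i = 0"
proof -
  have dims: "dim_row A = d" "dim_col B = m" using A B by auto
  have v: "0\<^sub>v d \<in> carrier_vec d" "vec d y \<in> carrier_vec d" by auto
  from bspec[OF bspec[OF ctrl[unfolded controllable_def dims] v(1)] v(2)]
  obtain T :: real and x u where T: "T > 0" and x0: "x 0 = 0\<^sub>v d" and xT: "x T = vec d y"
    and cv: "\<forall>t\<in>{0..T}. x t \<in> carrier_vec d \<and> u t \<in> carrier_vec m"
    and "\<forall>t\<in>{0..T}. \<forall>i<d. ((\<lambda>s. x s $ i) has_real_derivative (A *\<^sub>v x t + B *\<^sub>v u t) $ i) (at t within {0..T})"
    by (elim exE conjE)
  then have der: "((\<lambda>s. x s $ i) has_real_derivative (A *\<^sub>v x t + B *\<^sub>v u t) $ i) (at t within {0..T})"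
    if "t \<in> {0..T}" "i < d" for t i using that by simp
  define g where "g t = (\<Sum>i<d. y i * x t $ i)" for t
  have g: "(g has_real_derivative 0) (at t within {0..T})" if t: "t \<in> {0..T}" for t
  proof -
    have "(\<Sum>i<d. y i * (A *\<^sub>v x t + B *\<^sub>v u t) $ i)
        = (\<Sum>i<d. y i * (\<Sum>j<d. A $$ (i, j) * x t $ j)) + (\<Sum>i<d. y i * (\<Sum>k<m. B $$ (i, k) * u t $ k))"
      unfolding sum.distrib[symmetric]
      by (rule sum.cong) (use A B bspec[OF cv t] in \<open>auto simp: scalar_prod_def lessThan_atLeast0 distrib_left intro!: sum.cong\<close>)
    also have "(\<Sum>i<d. y i * (\<Sum>j<d. A $$ (i, j) * x t $ j)) = (\<Sum>j<d. (\<Sum>i<d. y i * A $$ (i, j)) * x t $ j)"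
      unfolding sum_distrib_left sum_distrib_right by (subst sum.swap) (simp add: mult_ac)
    also have "\<dots> = 0" using yA by simp
    also have "(\<Sum>i<d. y i * (\<Sum>k<m. B $$ (i, k) * u t $ k)) = (\<Sum>k<m. (\<Sum>i<d. y i * B $$ (i, k)) * u t $ k)"
      unfolding sum_distrib_left sum_distrib_right by (subst sum.swap) (simp add: mult_ac)
    also have "\<dots> = 0" using yB by simp
    finally have e: "(\<Sum>i<d. y i * (A *\<^sub>v x t + B *\<^sub>v u t) $ i) = 0" by simp
    show ?thesis unfolding g_def
      by (rule DERIV_cong[OF DERIV_sum[OF DERIV_cmult[OF der[OF t]]]]) (use e in \<open>auto simp: mult.commute\<close>)
  qed
  have "g T = g 0"
  proof (rule DERIV_isconst_end[OF T])
    show "continuous_on {0..T} g" by (rule DERIV_continuous_on) (rule g)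
    show "(g has_real_derivative 0) (at t)" if "0 < t" "t < T" for t
      using g[of t] that by (simp add: at_within_Icc_at)
  qed
  then have "(\<Sum>i<d. y i * y i) = 0" by (simp add: g_def x0 xT)
  then show ?thesis by (subst (asm) sum_nonneg_eq_0_iff) auto
qed

section \<open>The Hautus test and controllability\<close>

definition endpoint_poly :: "real poly" where
  "endpoint_poly = [:0, 1:] * [:-1, 1:]"

lemma endpoint_poly_dvd_iff: "endpoint_poly dvd p \<longleftrightarrow> poly p 0 = 0 \<and> poly p 1 = 0"
proof
  assume p: "poly p 0 = 0 \<and> poly p 1 = 0"
  then obtain q where q: "p = [:0, 1:] * q" using poly_eq_0_iff_dvd[of p 0] by (auto elim: dvdE)
  then have "[:-1, 1:] dvd q" using p poly_eq_0_iff_dvd[of q 1] by auto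
  then show "endpoint_poly dvd p" unfolding q endpoint_poly_def by (rule mult_dvd_mono[OF dvd_refl])
qed (auto simp: endpoint_poly_def elim!: dvdE)

lemma power_dvd_pderiv:
  fixes h p :: "'a::idom poly"
  assumes "h ^ Suc n dvd p"
  shows "h ^ n dvd pderiv p"
proof -
  obtain q where "p = h ^ Suc n * q" using assms by (elim dvdE)
  then have "pderiv p = h ^ Suc n * pderiv q + q * (smult (of_nat (Suc n)) (h ^ n) * pderiv h)"
    by (simp only: pderiv_mult pderiv_power_Suc)
  also have "\<dots> = h ^ n * (h * pderiv q + smult (of_nat (Suc n)) (pderiv h) * q)"
    by (simp add: algebra_simps del: of_nat_Suc)
  finally have "pderiv p = h ^ n * (h * pderiv q + smult (of_nat (Suc n)) (pderiv h) * q)" .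
  then show ?thesis by simp
qed

text \<open>The equation is the forced system \<open>X' = a X + b U + p v\<close> on [0,1], and
  divisibility by \<open>endpoint_poly\<close> says that \<open>X\<close> vanishes at both ends.
  Since \<open>p\<close> is universally quantified, the property can also be applied to
  \<open>pderiv p\<close>; \<open>N\<close> has to vary because each such application uses up one
  order of vanishing.\<close>

definition absorbs :: "nat \<Rightarrow> nat \<Rightarrow> (nat \<Rightarrow> nat \<Rightarrow> real) \<Rightarrow> (nat \<Rightarrow> nat \<Rightarrow> real) \<Rightarrow> nat \<Rightarrow> (nat \<Rightarrow> real) \<Rightarrow> bool" where
  "absorbs d m a b N v \<longleftrightarrow> (\<forall>p. endpoint_poly ^ N dvd p \<longrightarrow>
     (\<exists>X U. \<forall>i<d. endpoint_poly dvd X i \<and>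
        pderiv (X i) = (\<Sum>j<d. smult (a i j) (X j)) + (\<Sum>k<m. smult (b i k) (U k)) + smult (v i) p))"

lemma absorbs_mono: "absorbs d m a b N v \<Longrightarrow> N \<le> M \<Longrightarrow> absorbs d m a b M v"
  unfolding absorbs_def by (meson dvd_trans le_imp_power_dvd)

lemma absorbs_zero: "absorbs d m a b N (\<lambda>i. 0)"
  unfolding absorbs_def by (auto intro!: exI[of _ "\<lambda>i. 0"])

lemma absorbs_add:
  assumes "absorbs d m a b N v" "absorbs d m a b M w"
  shows "absorbs d m a b (max N M) (\<lambda>i. v i + w i)"
  unfolding absorbs_def
proof (intro allI impI)
  fix p assume p: "endpoint_poly ^ max N M dvd p"
  have "absorbs d m a b (max N M) v" "absorbs d m a b (max N M) w"
    using assms by (auto intro: absorbs_mono)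
  then obtain X U X' U' where
    1: "\<forall>i<d. endpoint_poly dvd X i \<and>
        pderiv (X i) = (\<Sum>j<d. smult (a i j) (X j)) + (\<Sum>k<m. smult (b i k) (U k)) + smult (v i) p" and
    2: "\<forall>i<d. endpoint_poly dvd X' i \<and>
        pderiv (X' i) = (\<Sum>j<d. smult (a i j) (X' j)) + (\<Sum>k<m. smult (b i k) (U' k)) + smult (w i) p"
    using p unfolding absorbs_def by meson
  show "\<exists>X U. \<forall>i<d. endpoint_poly dvd X i \<and>
        pderiv (X i) = (\<Sum>j<d. smult (a i j) (X j)) + (\<Sum>k<m. smult (b i k) (U k)) + smult (v i + w i) p"
    by (rule exI[of _ "\<lambda>i. X i + X' i"], rule exI[of _ "\<lambda>i. U i + U' i"])
      (use 1 2 in \<open>simp add: pderiv_add smult_add_right smult_add_left sum.distrib\<close>)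
qed

lemma absorbs_scale:
  assumes "absorbs d m a b N v"
  shows "absorbs d m a b N (\<lambda>i. c * v i)"
  unfolding absorbs_def
proof (intro allI impI)
  fix p assume "endpoint_poly ^ N dvd p"
  then have "endpoint_poly ^ N dvd smult c p" by (rule dvd_smult)
  with assms obtain X U where "\<forall>i<d. endpoint_poly dvd X i \<and>
        pderiv (X i) = (\<Sum>j<d. smult (a i j) (X j)) + (\<Sum>k<m. smult (b i k) (U k)) + smult (v i) (smult c p)"
    unfolding absorbs_def by meson
  then show "\<exists>X U. \<forall>i<d. endpoint_poly dvd X i \<and>
        pderiv (X i) = (\<Sum>j<d. smult (a i j) (X j)) + (\<Sum>k<m. smult (b i k) (U k)) + smult (c * v i) p"
    by (intro exI[of _ X] exI[of _ U]) (simp add: mult.commute)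
qed

text \<open>The input \<open>- p\<close> on channel \<open>k\<close> cancels the forcing pointwise
  while the state stays at 0, so \<open>p\<close> need not vanish anywhere.\<close>

lemma absorbs_input:
  assumes "k < m"
  shows "absorbs d m a b 0 (\<lambda>i. b i k)"
  unfolding absorbs_def
proof (intro allI impI)
  fix p :: "real poly"
  have "(\<Sum>l<m. smult (b i l) (if l = k then - p else 0)) = (\<Sum>l<m. if l = k then - smult (b i l) p else 0)" for i
    by (rule sum.cong) auto
  then show "\<exists>X U. \<forall>i<d. endpoint_poly dvd X i \<and>
        pderiv (X i) = (\<Sum>j<d. smult (a i j) (X j)) + (\<Sum>k<m. smult (b i k) (U k)) + smult (b i k) p"
    by (intro exI[of _ "\<lambda>i. 0"] exI[of _ "\<lambda>l. if l = k then - p else 0"]) (use assms in simp)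
qed

text \<open>Integration by parts: the derivative of \<open>p v\<close> is absorbed, at the price of one order of vanishing.\<close>

lemma absorbs_state:
  assumes "absorbs d m a b N v"
  shows "absorbs d m a b (Suc N) (\<lambda>i. \<Sum>j<d. a i j * v j)"
  unfolding absorbs_def
proof (intro allI impI)
  fix p :: "real poly" assume p: "endpoint_poly ^ Suc N dvd p"
  then obtain X U where XU: "\<forall>i<d. endpoint_poly dvd X i \<and>
        pderiv (X i) = (\<Sum>j<d. smult (a i j) (X j)) + (\<Sum>k<m. smult (b i k) (U k)) + smult (v i) (pderiv p)"
    using assms power_dvd_pderiv[OF p] unfolding absorbs_def by meson
  have "endpoint_poly dvd p" using p by (rule dvd_trans[rotated]) simp
  then have "\<forall>i<d. endpoint_poly dvd X i - smult (v i) p \<and>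
        pderiv (X i - smult (v i) p) = (\<Sum>j<d. smult (a i j) (X j - smult (v j) p)) +
           (\<Sum>k<m. smult (b i k) (U k)) + smult (\<Sum>j<d. a i j * v j) p"
    using XU by (auto simp: pderiv_diff pderiv_smult smult_diff_right sum_subtractf smult_sum
        intro!: dvd_diff dvd_smult)
  then show "\<exists>X U. \<forall>i<d. endpoint_poly dvd X i \<and>
        pderiv (X i) = (\<Sum>j<d. smult (a i j) (X j)) + (\<Sum>k<m. smult (b i k) (U k)) +
        smult (\<Sum>j<d. a i j * v j) p"
    by (intro exI[of _ "\<lambda>i. X i - smult (v i) p"] exI[of _ U])
qed

text \<open>A straight line meets the boundary values, and each induction step removes the
  lowest-order term of the residual at both endpoints. The correction \<open>q\<close> is a multiple
  of \<open>endpoint_poly ^ Suc N\<close>: it keeps the boundary values, and at order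
  \<open>N\<close> it enters the residual only through its derivative.\<close>

lemma hermite_curve:
  fixes x0 x1 :: "nat \<Rightarrow> real"
  shows "\<exists>z. (\<forall>i. poly (z i) 0 = x0 i \<and> poly (z i) 1 = x1 i) \<and>
    (\<forall>i. endpoint_poly ^ N dvd pderiv (z i) - (\<Sum>j<d. smult (a i j) (z j)))"
proof (induction N)
  case 0
  show ?case by (rule exI[of _ "\<lambda>i. [:x0 i, x1 i - x0 i:]"]) simp
next
  case (Suc N)
  then obtain z where z: "\<And>i. poly (z i) 0 = x0 i \<and> poly (z i) 1 = x1 i"
    and "\<And>i. endpoint_poly ^ N dvd pderiv (z i) - (\<Sum>j<d. smult (a i j) (z j))" by blast
  then obtain r where r: "\<And>i. pderiv (z i) - (\<Sum>j<d. smult (a i j) (z j)) = endpoint_poly ^ N * r i"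
    unfolding dvd_def by metis
  \<comment> \<open>The derivative of \<open>endpoint_poly\<close> is -1 at 0 and 1 at 1, so this
    linear polynomial makes \<open>pderiv endpoint_poly * c i\<close> agree with \<open>r i\<close>
    at both endpoints. The factor \<open>1 / real (Suc N)\<close> in \<open>q\<close> cancels the
    exponent that differentiation brings down.\<close>
  define c where "c i = [:- poly (r i) 0, poly (r i) 0 + poly (r i) 1:]" for i
  define q where "q i = smult (1 / real (Suc N)) (endpoint_poly ^ Suc N * c i)" for i
  have "endpoint_poly ^ Suc N dvd
      pderiv (z i - q i) - (\<Sum>j<d. smult (a i j) (z j - q j))" for i
  proof -
    have dvd: "endpoint_poly dvd r i - pderiv endpoint_poly * c i"
      by (simp only: endpoint_poly_dvd_iff) (simp add: endpoint_poly_def c_def pderiv_mult pderiv_pCons)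
    then have pow1: "endpoint_poly ^ Suc N dvd endpoint_poly ^ N * (r i - pderiv endpoint_poly * c i)"
      unfolding power_Suc2 by (rule mult_dvd_mono[OF dvd_refl])
    have pow2: "endpoint_poly ^ Suc N dvd endpoint_poly ^ Suc N * x" for x by (rule dvd_triv_left)
    have "pderiv (q i) = endpoint_poly ^ N * pderiv endpoint_poly * c i
        + endpoint_poly ^ Suc N * smult (1 / real (Suc N)) (pderiv (c i))"
      unfolding q_def pderiv_smult pderiv_mult[of "endpoint_poly ^ Suc N"] pderiv_power_Suc
      by (simp add: smult_add_right mult_ac del: of_nat_Suc power_Suc)
    then have "pderiv (z i - q i) - (\<Sum>j<d. smult (a i j) (z j - q j))
        = (pderiv (z i) - (\<Sum>j<d. smult (a i j) (z j))) - endpoint_poly ^ N * (pderiv endpoint_poly * c i)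
          - endpoint_poly ^ Suc N * smult (1 / real (Suc N)) (pderiv (c i)) + (\<Sum>j<d. smult (a i j) (q j))"
      by (simp add: pderiv_diff smult_diff_right sum_subtractf mult.assoc del: power_Suc)
    also have "\<dots> = endpoint_poly ^ N * (r i - pderiv endpoint_poly * c i)
          - endpoint_poly ^ Suc N * smult (1 / real (Suc N)) (pderiv (c i)) + (\<Sum>j<d. smult (a i j) (q j))"
      unfolding r by (simp only: right_diff_distrib)
    finally show ?thesis
      unfolding q_def by (simp only:) (intro dvd_add dvd_diff dvd_sum dvd_smult pow1 pow2)
  qed
  moreover have "poly (q i) 0 = 0 \<and> poly (q i) 1 = 0" for i by (simp add: q_def endpoint_poly_def)
  ultimately show ?case using z by (intro exI[of _ "\<lambda>i. z i - q i"]) simp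
qed

section \<open>Left eigenvectors in invariant subspaces\<close>

lemma krylov_dependence:
  fixes K :: "nat \<Rightarrow> nat \<Rightarrow> 'a::field"
  shows "\<exists>q. q \<noteq> 0 \<and> (\<forall>j<d. (\<Sum>k\<le>degree q. coeff q k * K k j) = 0)"
proof -
  \<comment> \<open>The columns are \<open>d + 1\<close> vectors with \<open>d\<close> coordinates,
    padded by a zero row to a square matrix. Its determinant vanishes, so a kernel vector exists;
    its entries become the coefficients of a polynomial, from which a linear factor can later be
    split off.\<close>
  define N where "N = mat (Suc d) (Suc d) (\<lambda>(i, k). if i < d then K k i else 0)"
  have N: "N \<in> carrier_mat (Suc d) (Suc d)" by (simp add: N_def)
  have "det N = (\<Sum>k<Suc d. N $$ (d, k) * cofactor N d k)"
    by (rule laplace_expansion_row[OF N]) simp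
  also have "\<dots> = 0" by (rule sum.neutral) (simp add: N_def)
  finally have "det N = 0" .
  then obtain v where v: "v \<in> carrier_vec (Suc d)" "v \<noteq> 0\<^sub>v (Suc d)" "N *\<^sub>v v = 0\<^sub>v (Suc d)"
    using det_0_iff_vec_prod_zero[OF N] by auto
  define q where "q = (\<Sum>k\<le>d. monom (v $ k) k)"
  have coeff: "coeff q k = (if k \<le> d then v $ k else 0)" for k
    by (simp add: q_def coeff_sum)
  have "q \<noteq> 0"
  proof
    assume "q = 0"
    then have "v $ k = 0" if "k < Suc d" for k using coeff[of k] that by simp
    then have "v = 0\<^sub>v (Suc d)" using v(1) by (intro eq_vecI) auto
    then show False using v(2) by simp
  qed
  moreover have "(\<Sum>k\<le>degree q. coeff q k * K k j) = 0" if j: "j < d" for j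
  proof -
    have "degree q \<le> d" by (rule degree_le) (simp add: coeff)
    then have "(\<Sum>k\<le>degree q. coeff q k * K k j) = (\<Sum>k\<le>d. coeff q k * K k j)"
      by (intro sum.mono_neutral_left) (auto simp: coeff_eq_0)
    also have "\<dots> = (\<Sum>k<Suc d. K k j * v $ k)"
      by (rule sum.cong) (auto simp: coeff)
    also have "\<dots> = (N *\<^sub>v v) $ j"
      using j v(1) by (simp add: N_def scalar_prod_def lessThan_atLeast0)
    finally show ?thesis using v(3) j by simp
  qed
  ultimately show ?thesis by blast
qed

text \<open>With \<open>T\<close> for the map \<open>y \<mapsto> y a\<close>, \<open>P q\<close> is
  \<open>q(T) y0\<close>. A nonzero polynomial of least degree with \<open>q(T) y0 = 0\<close> has a
  complex root \<open>l\<close>. For the cofactor \<open>r\<close>, minimality gives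
  \<open>r(T) y0 \<noteq> 0\<close>, and \<open>(T - l) r(T) y0 = 0\<close> makes this vector an
  eigenvector inside \<open>Y\<close>. All equations concern only the coordinates below
  \<open>d\<close>.\<close>

lemma invariant_subspace_eigenvector:
  fixes Y :: "(nat \<Rightarrow> complex) set" and a :: "nat \<Rightarrow> nat \<Rightarrow> complex"
  assumes zero: "(\<lambda>i. 0) \<in> Y"
    and add: "\<And>v w. v \<in> Y \<Longrightarrow> w \<in> Y \<Longrightarrow> (\<lambda>i. v i + w i) \<in> Y"
    and scale: "\<And>c v. v \<in> Y \<Longrightarrow> (\<lambda>i. c * v i) \<in> Y"
    and inv: "\<And>y. y \<in> Y \<Longrightarrow> (\<lambda>j. \<Sum>i<d. y i * a i j) \<in> Y"
    and y0: "y0 \<in> Y" "i0 < d" "y0 i0 \<noteq> 0"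
  shows "\<exists>y\<in>Y. \<exists>l. (\<exists>i<d. y i \<noteq> 0) \<and> (\<forall>j<d. (\<Sum>i<d. y i * a i j) = l * y j)"
proof -
  define K where "K k = ((\<lambda>y j. \<Sum>i<d. y i * a i j) ^^ k) y0" for k
  define P where "P q j = (\<Sum>k\<le>degree q. coeff q k * K k j)" for q j
  have K: "K k \<in> Y" for k by (induction k) (auto simp: K_def y0 inv)
  have P: "P q \<in> Y" for q
  proof -
    have "(\<lambda>j. \<Sum>k\<le>n. coeff q k * K k j) \<in> Y" for n
      by (induction n) (auto intro!: add scale K)
    then show ?thesis by (simp add: P_def[abs_def])
  qed
  define good where "good q \<longleftrightarrow> q \<noteq> 0 \<and> (\<forall>j<d. P q j = 0)" for q
  have "\<exists>q. good q" unfolding good_def P_def by (rule krylov_dependence)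
  then obtain q where q: "good q" and min: "\<And>r. good r \<Longrightarrow> degree q \<le> degree r"
    using ex_has_least_nat[of good _ degree] by blast
  have "degree q \<noteq> 0"
  proof
    assume deg: "degree q = 0"
    then have "coeff q 0 \<noteq> 0" using q leading_coeff_neq_0[of q] by (auto simp: good_def)
    moreover have "P q i0 = coeff q 0 * y0 i0" by (simp add: P_def deg K_def)
    ultimately show False using q y0 by (auto simp: good_def)
  qed
  then have "\<not> constant (poly q)" by (simp add: constant_degree)
  then obtain l where "poly q l = 0" using fundamental_theorem_of_algebra by blast
  then obtain r where qr: "q = [:- l, 1:] * r" by (auto simp: poly_eq_0_iff_dvd elim: dvdE)
  have r0: "r \<noteq> 0" using q qr by (auto simp: good_def)
  have deg: "degree q = Suc (degree r)" unfolding qr using r0 by (subst degree_mult_eq) auto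
  then have "\<not> good r" using min[of r] by auto
  then have nz: "\<exists>i<d. P r i \<noteq> 0" using r0 by (auto simp: good_def)
  have "(\<Sum>i<d. P r i * a i j) = l * P r j" if j: "j < d" for j
  proof -
    have cq: "coeff q 0 = - l * coeff r 0" "coeff q (Suc k) = coeff r k - l * coeff r (Suc k)" for k
      by (simp_all add: qr)
    have "0 = P q j" using q j by (simp add: good_def)
    also have "\<dots> = (\<Sum>k\<le>Suc (degree r). coeff q k * K k j)" by (simp only: P_def deg)
    also have "\<dots> = - l * coeff r 0 * K 0 j + (\<Sum>k\<le>degree r. (coeff r k - l * coeff r (Suc k)) * K (Suc k) j)"
      by (subst sum.atMost_Suc_shift) (simp add: cq)
    also have "\<dots> = (\<Sum>k\<le>degree r. coeff r k * K (Suc k) j)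
        - l * (coeff r 0 * K 0 j + (\<Sum>k\<le>degree r. coeff r (Suc k) * K (Suc k) j))"
      by (simp add: left_diff_distrib sum_subtractf sum_distrib_left algebra_simps)
    also have "coeff r 0 * K 0 j + (\<Sum>k\<le>degree r. coeff r (Suc k) * K (Suc k) j) = (\<Sum>k\<le>Suc (degree r). coeff r k * K k j)"
      by (subst sum.atMost_Suc_shift) simp
    also have "\<dots> = P r j" by (simp add: P_def coeff_eq_0)
    also have "(\<Sum>k\<le>degree r. coeff r k * K (Suc k) j) = (\<Sum>i<d. P r i * a i j)"
      unfolding P_def sum_distrib_right
      by (subst sum.swap) (simp add: K_def sum_distrib_left mult.assoc)
    finally show ?thesis by simp
  qed
  then show ?thesis using P nz by blast
qed

text \<open>If \<open>V\<close> missed a direction, a nonzero vector would annihilate it. The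
  annihilator is closed under \<open>y \<mapsto> y a\<close> because \<open>V\<close> is closed
  under \<open>a\<close>, so it contains an eigenvector. This eigenvector also annihilates the
  columns of \<open>b\<close>, which the Hautus condition forbids. Eigenvectors may be complex,
  hence \<open>Y\<close> is the complex annihilator of the real space \<open>V\<close>.\<close>

lemma Hautus_imp_reachable_directions:
  fixes a b :: "nat \<Rightarrow> nat \<Rightarrow> real" and x :: "nat \<Rightarrow> real"
  assumes hautus: "\<And>y (l :: complex). (\<And>j. j < d \<Longrightarrow> (\<Sum>i<d. y i * of_real (a i j)) = l * y j) \<Longrightarrow>
      (\<And>k. k < m \<Longrightarrow> (\<Sum>i<d. y i * of_real (b i k)) = 0) \<Longrightarrow> \<forall>i<d. y i = 0"
    and zero: "(\<lambda>i. 0) \<in> V"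
    and add: "\<And>v w. v \<in> V \<Longrightarrow> w \<in> V \<Longrightarrow> (\<lambda>i. v i + w i) \<in> V"
    and scale: "\<And>c v. v \<in> V \<Longrightarrow> (\<lambda>i. c * v i) \<in> V"
    and input: "\<And>k. k < m \<Longrightarrow> (\<lambda>i. b i k) \<in> V"
    and state: "\<And>v. v \<in> V \<Longrightarrow> (\<lambda>i. \<Sum>j<d. a i j * v j) \<in> V"
  shows "\<exists>v\<in>V. \<forall>i<d. v i = x i"
proof -
  have "\<exists>v\<in>V. \<forall>i\<in>{..<d}. v i = x i"
  proof (rule subspace_with_trivial_annihilator)
    fix y :: "nat \<Rightarrow> real"
    assume y: "\<And>v. v \<in> V \<Longrightarrow> (\<Sum>i\<in>{..<d}. y i * v i) = 0"
    define Y where "Y = {y :: nat \<Rightarrow> complex. \<forall>v\<in>V. (\<Sum>i<d. y i * of_real (v i)) = 0}"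
    show "\<forall>i\<in>{..<d}. y i = 0"
    proof (rule ccontr)
      assume "\<not> ?thesis"
      then obtain i0 where i0: "i0 < d" "y i0 \<noteq> 0" by auto
      have "\<exists>z\<in>Y. \<exists>l. (\<exists>i<d. z i \<noteq> 0) \<and> (\<forall>j<d. (\<Sum>i<d. z i * of_real (a i j)) = l * z j)"
      proof (rule invariant_subspace_eigenvector)
        show "(\<lambda>i. 0) \<in> Y" by (simp add: Y_def)
        show "(\<lambda>i. v i + w i) \<in> Y" if "v \<in> Y" "w \<in> Y" for v w
          using that by (simp add: Y_def distrib_right sum.distrib)
        show "(\<lambda>i. c * v i) \<in> Y" if "v \<in> Y" for c v
          using that by (simp add: Y_def mult.assoc flip: sum_distrib_left)
        show "(\<lambda>j. \<Sum>i<d. z i * of_real (a i j)) \<in> Y" if "z \<in> Y" for z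
        proof -
          have "(\<Sum>j<d. (\<Sum>i<d. z i * of_real (a i j)) * of_real (v j)) = 0" if "v \<in> V" for v
          proof -
            have "(\<Sum>j<d. (\<Sum>i<d. z i * of_real (a i j)) * of_real (v j))
                = (\<Sum>i<d. z i * of_real (\<Sum>j<d. a i j * v j))"
              unfolding sum_distrib_right of_real_sum sum_distrib_left by (subst sum.swap) (simp add: mult.assoc)
            also have "\<dots> = 0"
              using \<open>z \<in> Y\<close> state[OF that] unfolding Y_def by (auto dest: bspec[of V _ "\<lambda>i. \<Sum>j<d. a i j * v j"])
            finally show ?thesis .
          qed
          then show ?thesis by (simp add: Y_def)
        qed
        have "(\<Sum>i<d. complex_of_real (y i) * of_real (v i)) = of_real (\<Sum>i<d. y i * v i)" for v by simp
        then show "(\<lambda>i. of_real (y i)) \<in> Y" using y by (simp add: Y_def del: of_real_sum)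
        show "i0 < d" "complex_of_real (y i0) \<noteq> 0" using i0 by simp_all
      qed
      then obtain z l where z: "z \<in> Y" "\<exists>i<d. z i \<noteq> 0" "\<forall>j<d. (\<Sum>i<d. z i * of_real (a i j)) = l * z j"
        by blast
      have "\<forall>i<d. z i = 0" by (rule hautus[of z l]) (use z input in \<open>auto simp: Y_def\<close>)
      then show False using z(2) by blast
    qed
  qed (use zero add scale in auto)
  then show ?thesis by auto
qed

lemma smult_sum_right: "smult c (\<Sum>i\<in>S. f i) = (\<Sum>i\<in>S. smult c (f i))"
  by (induction S rule: infinite_finite_induct) (auto simp: smult_add_right)

lemma Hautus_imp_controllable:
  fixes A B :: "real mat"
  assumes A: "A \<in> carrier_mat d d" and B: "B \<in> carrier_mat d m"
    and hautus: "\<And>y (l :: complex). (\<And>j. j < d \<Longrightarrow> (\<Sum>i<d. y i * of_real (A $$ (i, j))) = l * y j) \<Longrightarrow>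
      (\<And>k. k < m \<Longrightarrow> (\<Sum>i<d. y i * of_real (B $$ (i, k))) = 0) \<Longrightarrow> \<forall>i<d. y i = 0"
  shows "controllable A B"
proof -
  have dims: "dim_row A = d" "dim_col B = m" using A B by auto
  define a where "a i j = A $$ (i, j)" for i j
  define b where "b i j = B $$ (i, j)" for i j
  define V where "V = {v. \<exists>N. absorbs d m a b N v}"
  have V: "\<exists>v\<in>V. \<forall>i<d. v i = x i" for x
  proof (rule Hautus_imp_reachable_directions[of d a m b])
    show "\<forall>i<d. y i = 0" if "\<And>j. j < d \<Longrightarrow> (\<Sum>i<d. y i * of_real (a i j)) = l * y j"
      "\<And>k. k < m \<Longrightarrow> (\<Sum>i<d. y i * of_real (b i k)) = 0" for y :: "nat \<Rightarrow> complex" and l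
      using hautus[OF that[unfolded a_def b_def]] .
    show "(\<lambda>i. b i k) \<in> V" if "k < m" for k unfolding V_def using absorbs_input[OF that] by blast
    show "(\<lambda>i. 0) \<in> V" unfolding V_def using absorbs_zero by blast
    show "(\<lambda>i. v i + w i) \<in> V" if "v \<in> V" "w \<in> V" for v w
      using that absorbs_add[of d m a b _ v _ w] unfolding V_def by blast
    show "(\<lambda>i. c * v i) \<in> V" if "v \<in> V" for c v
      using that absorbs_scale[of d m a b _ v c] unfolding V_def by blast
    show "(\<lambda>i. \<Sum>j<d. a i j * v j) \<in> V" if "v \<in> V" for v
      using that absorbs_state[of d m a b _ v] unfolding V_def by blast
  qed
  have "\<exists>N. absorbs d m a b N (\<lambda>i. if i = l then 1 else 0)" for l
  proof -
    obtain v N where "absorbs d m a b N v" "\<forall>i<d. v i = (if i = l then 1 else 0)"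
      using V[of "\<lambda>i. if i = l then 1 else 0"] by (auto simp: V_def)
    then show ?thesis unfolding absorbs_def by (intro exI[of _ N]) simp
  qed
  then obtain f where f: "\<And>l. absorbs d m a b (f l) (\<lambda>i. if i = l then 1 else 0)" by metis
  define N where "N = Max (f ` {..<d})"
  have N: "absorbs d m a b N (\<lambda>i. if i = l then 1 else 0)" if "l < d" for l
    using that by (intro absorbs_mono[OF f]) (auto simp: N_def)
  have "\<exists>(T :: real) x u. T > 0 \<and> x 0 = x0 \<and> x T = x1 \<and>
          (\<forall>t \<in> {0..T}. x t \<in> carrier_vec d \<and> u t \<in> carrier_vec m) \<and>
          (\<forall>j < m. continuous_on {0..T} (\<lambda>t. u t $ j)) \<and>
          (\<forall>t \<in> {0..T}. \<forall>i < d.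
             ((\<lambda>s. x s $ i) has_real_derivative (A *\<^sub>v x t + B *\<^sub>v u t) $ i) (at t within {0..T}))"
    if x01: "x0 \<in> carrier_vec d" "x1 \<in> carrier_vec d" for x0 x1
  proof -
    obtain z where z: "\<And>i. poly (z i) 0 = x0 $ i \<and> poly (z i) 1 = x1 $ i"
      and zN: "\<And>i. endpoint_poly ^ N dvd pderiv (z i) - (\<Sum>j<d. smult (a i j) (z j))"
      using hermite_curve[of "\<lambda>i. x0 $ i" "\<lambda>i. x1 $ i" N a d] by blast
    define g where "g l = pderiv (z l) - (\<Sum>j<d. smult (a l j) (z j))" for l
    define absorbed where "absorbed l X U \<longleftrightarrow> (\<forall>i<d. endpoint_poly dvd X i \<and>
        pderiv (X i) = (\<Sum>j<d. smult (a i j) (X j)) + (\<Sum>k<m. smult (b i k) (U k))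
          + smult (if i = l then 1 else 0) (g l))" for l X U
    have "\<exists>X U. absorbed l X U" if "l < d" for l
      using N[OF that] zN[of l] unfolding absorbs_def g_def absorbed_def by blast
    then obtain X U where "\<And>l. l < d \<Longrightarrow> absorbed l (X l) (U l)"
      by metis
    then have XU: "endpoint_poly dvd X l i \<and>
        pderiv (X l i) = (\<Sum>j<d. smult (a i j) (X l j)) + (\<Sum>k<m. smult (b i k) (U l k))
          + smult (if i = l then 1 else 0) (g l)" if "l < d" "i < d" for l i
      using that unfolding absorbed_def by blast
    \<comment> \<open>Each \<open>X l\<close> solves the system with forcing \<open>g l\<close> in
      direction \<open>l\<close>, so subtracting all of them cancels the residual \<open>g\<close>
      of the curve \<open>z\<close>; the inputs change sign accordingly. The \<open>X l\<close>
      vanish at both endpoints, so the boundary values of \<open>z\<close> survive.\<close>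
    define x where "x i = z i - (\<Sum>l<d. X l i)" for i
    define u where "u k = - (\<Sum>l<d. U l k)" for k
    have ends: "poly (x i) 0 = x0 $ i" "poly (x i) 1 = x1 $ i" if "i < d" for i
    proof -
      have "endpoint_poly dvd (\<Sum>l<d. X l i)" by (rule dvd_sum) (use XU that in auto)
      then show "poly (x i) 0 = x0 $ i" "poly (x i) 1 = x1 $ i"
        using z[of i] by (auto simp: x_def endpoint_poly_dvd_iff)
    qed
    have ode: "pderiv (x i) = (\<Sum>j<d. smult (a i j) (x j)) + (\<Sum>k<m. smult (b i k) (u k))" if i: "i < d" for i
    proof -
      have "pderiv (\<Sum>l<d. X l i) = (\<Sum>l<d. (\<Sum>j<d. smult (a i j) (X l j)) + (\<Sum>k<m. smult (b i k) (U l k))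
          + smult (if i = l then 1 else 0) (g l))"
        unfolding higher_pderiv_sum[of 1, simplified] by (rule sum.cong) (use XU i in auto)
      also have "\<dots> = (\<Sum>j<d. smult (a i j) (\<Sum>l<d. X l j)) + (\<Sum>k<m. smult (b i k) (\<Sum>l<d. U l k))
          + (\<Sum>l<d. smult (if i = l then 1 else 0) (g l))"
        unfolding sum.distrib smult_sum_right
        by (intro arg_cong2[where f = "(+)"] sum.swap refl)
      also have "(\<Sum>l<d. smult (if i = l then 1 else 0) (g l)) = (\<Sum>l<d. if i = l then g l else 0)"
        by (rule sum.cong) auto
      also have "\<dots> = g i" using i by simp
      finally show ?thesis
        by (simp add: x_def u_def pderiv_diff g_def smult_diff_right sum_subtractf sum_negf)
    qed
    show ?thesis
    proof (rule exI[of _ 1], rule exI[of _ "\<lambda>t. vec d (\<lambda>i. poly (x i) t)"],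
        rule exI[of _ "\<lambda>t. vec m (\<lambda>k. poly (u k) t)"], intro conjI ballI allI impI)
      show "vec d (\<lambda>i. poly (x i) 0) = x0" "vec d (\<lambda>i. poly (x i) 1) = x1"
        using x01 ends by auto
      fix t :: real and i assume i: "i < d"
      have "(A *\<^sub>v vec d (\<lambda>i. poly (x i) t) + B *\<^sub>v vec m (\<lambda>k. poly (u k) t)) $ i
        = poly (pderiv (x i)) t"
        unfolding ode[OF i] using A B i
        by (simp add: scalar_prod_def lessThan_atLeast0 poly_sum a_def b_def)
      then show "((\<lambda>s. vec d (\<lambda>i. poly (x i) s) $ i) has_real_derivative
          (A *\<^sub>v vec d (\<lambda>i. poly (x i) t) + B *\<^sub>v vec m (\<lambda>k. poly (u k) t)) $ i) (at t within {0..1})"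
        using i by (simp add: poly_DERIV has_field_derivative_at_within)
    qed (auto intro!: continuous_intros)
  qed
  then show ?thesis unfolding controllable_def dims by blast
qed

section \<open>A realization supported on stems and cycles\<close>

text \<open>
  Invariant of the construction: the states in \<open>S\<close> are spanned by stems and cycles of the matching,
  and \<open>a\<close> is a realization on \<open>S\<close> that passes the Hautus test. The last condition says that, away from
  finitely many moduli of \<open>l\<close>, a disturbance entering at \<open>p\<close> remains visible, so that another cycle
  can be attached at \<open>p\<close>.
\<close>

definition cactus :: "nat \<Rightarrow> (nat \<Rightarrow> vertex) \<Rightarrow> (nat \<times> nat) set \<Rightarrow> nat set \<Rightarrow> (nat \<Rightarrow> nat \<Rightarrow> real) \<Rightarrow> real set \<Rightarrow> bool" where
  "cactus d src E S a R \<longleftrightarrow> S \<subseteq> {..<d} \<and> finite R \<and> 0 \<in> R \<and>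
     (\<forall>i<d. src i \<notin> range V1 \<longrightarrow> i \<in> S) \<and>
     (\<forall>i<d. \<forall>j. src i = V1 j \<longrightarrow> (i \<in> S \<longleftrightarrow> j \<in> S)) \<and>
     (\<forall>i j. a i j \<noteq> 0 \<longrightarrow> (j, i) \<in> E \<and> i \<in> S \<and> j \<in> S) \<and>
     (\<forall>y (l :: complex). (\<forall>i\<in>S. src i \<notin> range V1 \<longrightarrow> y i = 0) \<longrightarrow>
        (\<forall>j\<in>S. (\<Sum>i\<in>S. y i * of_real (a i j)) = l * y j) \<longrightarrow> (\<forall>i\<in>S. y i = 0)) \<and>
     (\<forall>y (l :: complex) t. \<forall>p\<in>S. norm l \<notin> R \<longrightarrow> (\<forall>i\<in>S. src i \<notin> range V1 \<longrightarrow> y i = 0) \<longrightarrow>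
        (\<forall>j\<in>S. (\<Sum>i\<in>S. y i * of_real (a i j)) + (if j = p then t else 0) = l * y j) \<longrightarrow> t = 0)"

text \<open>\<open>src i\<close> is the partner of state \<open>i\<close> in the matching:
  \<open>V1 j\<close> if the state \<open>j\<close> precedes it, anything else if it is driven by an
  input. The index is the depth below the input-driven head; states on cycles have none.\<close>

inductive stem :: "nat \<Rightarrow> (nat \<Rightarrow> vertex) \<Rightarrow> nat \<Rightarrow> nat \<Rightarrow> bool" for d src where
  stem_head: "i < d \<Longrightarrow> src i \<notin> range V1 \<Longrightarrow> stem d src i 0"
| stem_step: "stem d src j n \<Longrightarrow> i < d \<Longrightarrow> src i = V1 j \<Longrightarrow> stem d src i (Suc n)"

lemma stem_unique: "stem d src i n \<Longrightarrow> stem d src i k \<Longrightarrow> n = k"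
proof (induction arbitrary: k rule: stem.induct)
  case (stem_head i)
  from stem_head(3,1,2) show ?case by cases auto
next
  case (stem_step j n i)
  from stem_step(5,3,4) show ?case by cases (use stem_step.IH in auto)
qed

text \<open>All stem edges get weight 1. An eigenvector that vanishes at a head vanishes along the
  whole stem, since the value at the next state is \<open>l\<close> times the current one. The
  matrix is nilpotent, so 0 is the only modulus to exclude in the visibility condition.\<close>

lemma cactus_stems:
  assumes inj: "inj_on src {..<d}"
    and E: "\<And>i j. i < d \<Longrightarrow> src i = V1 j \<Longrightarrow> (j, i) \<in> E"
  shows "\<exists>S a R. cactus d src E S a R"
proof -
  define S where "S = {i. \<exists>n. stem d src i n}"
  define a :: "nat \<Rightarrow> nat \<Rightarrow> real" where "a i j = (if i \<in> S \<and> src i = V1 j then 1 else 0)" for i j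
  have less: "i < d" if "i \<in> S" for i using that unfolding S_def by (auto elim: stem.cases)
  then have fin: "finite S" "S \<subseteq> {..<d}" by (auto intro: finite_subset[of _ "{..<d}"])
  have heads: "i \<in> S" if "i < d" "src i \<notin> range V1" for i
    using stem_head[of i d src] that by (auto simp: S_def)
  define f where "f i = (SOME n. stem d src i n)" for i
  have f: "stem d src i (f i)" if "i \<in> S" for i
    using that someI_ex[of "stem d src i"] by (simp add: S_def f_def)
  have pred: "(i \<in> S \<longleftrightarrow> j \<in> S) \<and> (j \<in> S \<longrightarrow> f i = Suc (f j))" if i: "i < d" "src i = V1 j" for i j
  proof -
    have "\<exists>n. stem d src j n" if "stem d src i n" for n
      using that by cases (use i in auto)
    then have "i \<in> S \<Longrightarrow> j \<in> S" by (auto simp: S_def)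
    moreover have "j \<in> S \<Longrightarrow> i \<in> S \<and> f i = Suc (f j)"
      using stem_step[OF f i] f[of i] by (auto simp: S_def intro: stem_unique)
    ultimately show ?thesis by blast
  qed
  have succ: "(\<Sum>i\<in>S. y i * complex_of_real (a i j)) = y k" if "k \<in> S" "src k = V1 j" for y j k
  proof -
    have "(\<Sum>i\<in>S. y i * complex_of_real (a i j)) = (\<Sum>i\<in>S. if i = k then y i else 0)"
      by (rule sum.cong) (use that inj less in \<open>auto simp: a_def inj_on_def\<close>)
    then show ?thesis using that fin by simp
  qed
  have tip: "(\<Sum>i\<in>S. y i * complex_of_real (a i j)) = 0" if "\<And>k. k \<in> S \<Longrightarrow> src k \<noteq> V1 j" for y j
    by (rule sum.neutral) (use that in \<open>auto simp: a_def\<close>)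
  have hautus: "\<forall>i\<in>S. y i = 0"
    if h: "\<forall>i\<in>S. src i \<notin> range V1 \<longrightarrow> y i = 0" and eq: "\<forall>j\<in>S. (\<Sum>i\<in>S. y i * of_real (a i j)) = l * y j"
    for y and l :: complex
  proof -
    have "y i = 0" if "stem d src i n" for i n
      using that
    proof (induction rule: stem.induct)
      case (stem_head i) then show ?case using h heads by blast
    next
      case (stem_step j n i)
      then have "j \<in> S" "i \<in> S" using pred by (auto simp: S_def)
      then show ?case using eq succ[of i j y] stem_step by simp
    qed
    then show ?thesis by (auto simp: S_def)
  qed
  have visible: "t = 0"
    if p: "p \<in> S" and l: "norm l \<notin> {0}" and h: "\<forall>i\<in>S. src i \<notin> range V1 \<longrightarrow> y i = 0"
      and eq: "\<forall>j\<in>S. (\<Sum>i\<in>S. y i * of_real (a i j)) + (if j = p then t else 0) = l * y j"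
    for y and l t :: complex and p
  proof -
    \<comment> \<open>At an entry of \<open>D\<close> of greatest depth, \<open>l * y i\<close> is
      nonzero and no deeper entry balances it, so the disturbance does and the entry is
      \<open>p\<close>. An entry of least depth has a predecessor where \<open>y\<close> vanishes;
      the equation there is balanced only by the disturbance as well, so this predecessor is
      \<open>p\<close>. Then \<open>y p\<close> would be both nonzero and zero.\<close>
    define D where "D = {i\<in>S. y i \<noteq> 0}"
    have "D = {}"
    proof (rule ccontr)
      assume "D \<noteq> {}"
      have "finite D" using fin by (simp add: D_def)
      then have "Max (f ` D) \<in> f ` D" using \<open>D \<noteq> {}\<close> by (intro Max_in) auto
      then obtain i where "i \<in> D" "f i = Max (f ` D)" by force
      then have i: "i \<in> D" and imax: "\<And>k. k \<in> D \<Longrightarrow> f k \<le> f i"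
        using \<open>finite D\<close> by auto
      obtain k where k: "k \<in> D" "\<And>i. i \<in> D \<Longrightarrow> f k \<le> f i"
        using \<open>D \<noteq> {}\<close> ex_has_least_nat[of "\<lambda>i. i \<in> D" _ f] by blast
      have "i = p"
      proof (rule ccontr)
        assume "i \<noteq> p"
        then have *: "(\<Sum>k\<in>S. y k * of_real (a k i)) = l * y i" using eq i by (auto simp: D_def)
        then have "\<exists>k\<in>S. src k = V1 i" using tip[of i y] i l by (auto simp: D_def)
        then obtain k where k: "k \<in> S" "src k = V1 i" by blast
        then have "y k \<noteq> 0" using * succ[OF k, of y] i l by (auto simp: D_def)
        then show False using pred[of k i] k less imax[of k] i by (auto simp: D_def)
      qed
      obtain j where j: "src k = V1 j" using k h by (auto simp: D_def)
      then have jS: "j \<in> S" "f k = Suc (f j)" using pred[of k j] k less by (auto simp: D_def)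
      then have "y j = 0" using k(2)[of j] by (auto simp: D_def)
      have "y k + (if j = p then t else 0) = l * y j" using bspec[OF eq jS(1)] succ[of k j y] k j by (simp add: D_def)
      then have "y k + (if j = p then t else 0) = 0" using \<open>y j = 0\<close> by simp
      then have "j = p" using k by (auto simp: D_def split: if_splits)
      then show False using \<open>i = p\<close> i \<open>y j = 0\<close> by (simp add: D_def)
    qed
    then have y0: "\<forall>i\<in>S. y i = 0" by (auto simp: D_def)
    then have "(\<Sum>i\<in>S. y i * of_real (a i p)) = 0" by (intro sum.neutral) auto
    then show ?thesis using bspec[OF eq p] p y0 by simp
  qed
  have "cactus d src E S a {0}"
    unfolding cactus_def
  proof (intro conjI)
    show "\<forall>i<d. src i \<notin> range V1 \<longrightarrow> i \<in> S" using heads by blast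
    show "\<forall>i<d. \<forall>j. src i = V1 j \<longrightarrow> (i \<in> S \<longleftrightarrow> j \<in> S)" using pred by blast
    show "\<forall>i j. a i j \<noteq> 0 \<longrightarrow> (j, i) \<in> E \<and> i \<in> S \<and> j \<in> S"
    proof (intro allI impI)
      fix i j assume "a i j \<noteq> 0"
      then have "i \<in> S" "src i = V1 j" by (auto simp: a_def split: if_splits)
      then show "(j, i) \<in> E \<and> i \<in> S \<and> j \<in> S" using E[of i j] pred[of i j] less[of i] by simp
    qed
    show "\<forall>y (l :: complex). (\<forall>i\<in>S. src i \<notin> range V1 \<longrightarrow> y i = 0) \<longrightarrow>
        (\<forall>j\<in>S. (\<Sum>i\<in>S. y i * of_real (a i j)) = l * y j) \<longrightarrow> (\<forall>i\<in>S. y i = 0)"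
      by (intro allI impI) (rule hautus)
    show "\<forall>y (l :: complex) t. \<forall>p\<in>S. norm l \<notin> {0} \<longrightarrow> (\<forall>i\<in>S. src i \<notin> range V1 \<longrightarrow> y i = 0) \<longrightarrow>
        (\<forall>j\<in>S. (\<Sum>i\<in>S. y i * of_real (a i j)) + (if j = p then t else 0) = l * y j) \<longrightarrow> t = 0"
      by (intro allI ballI impI) (rule visible)
  qed (use fin in auto)
  then show ?thesis by blast
qed

section \<open>Attaching a cycle to a cactus\<close>

lemma cycle_through:
  assumes "finite W" "inj_on f W" "f ` W \<subseteq> W" "c \<in> W"
  obtains L where "L > 0" "(f ^^ L) c = c" "inj_on (\<lambda>n. (f ^^ n) c) {..<L}" "\<And>n. (f ^^ n) c \<in> W"
proof -
  have W: "(f ^^ n) x \<in> W" if "x \<in> W" for x n using that assms(3) by (induction n) auto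
  have cancel: "x = y" if "(f ^^ n) x = (f ^^ n) y" "x \<in> W" "y \<in> W" for n x y
    using that
  proof (induction n)
    case (Suc n)
    then have "(f ^^ n) x = (f ^^ n) y" using W assms(2) by (auto dest: inj_onD)
    then show ?case using Suc by blast
  qed simp
  have period: "(f ^^ (n - k)) c = c" if "(f ^^ k) c = (f ^^ n) c" "k < n" for k n
  proof -
    have "(f ^^ k) ((f ^^ (n - k)) c) = (f ^^ n) c"
      using that(2) by (metis funpow_add comp_apply le_add_diff_inverse less_imp_le)
    then have "(f ^^ k) ((f ^^ (n - k)) c) = (f ^^ k) c" using that(1) by simp
    then show ?thesis by (rule cancel) (use W assms(4) in auto)
  qed
  have "\<not> inj (\<lambda>n. (f ^^ n) c)"
  proof
    assume "inj (\<lambda>n. (f ^^ n) c)"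
    moreover have "range (\<lambda>n. (f ^^ n) c) \<subseteq> W" using W assms(4) by auto
    ultimately have "finite (UNIV :: nat set)" using assms(1) by (metis finite_imageD finite_subset)
    then show False by simp
  qed
  then obtain k n where "k < n" "(f ^^ k) c = (f ^^ n) c"
    by (auto simp: inj_def) (metis linorder_neqE_nat)
  then have ex: "\<exists>L>0. (f ^^ L) c = c" using period by (metis zero_less_diff)
  \<comment> \<open>With the least period, a repetition among the first \<open>L\<close> iterates is
    impossible: cancelling the common steps by injectivity would leave a shorter period.\<close>
  define L where "L = (LEAST L. L > 0 \<and> (f ^^ L) c = c)"
  have L: "L > 0" "(f ^^ L) c = c" using LeastI_ex[OF ex] by (auto simp: L_def)
  have min: "L \<le> n" if "n > 0" "(f ^^ n) c = c" for n
    using that Least_le[of "\<lambda>L. L > 0 \<and> (f ^^ L) c = c" n] by (simp add: L_def)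
  have "inj_on (\<lambda>n. (f ^^ n) c) {..<L}"
  proof (rule linorder_inj_onI)
    fix k n assume "k < n" "k \<in> {..<L}" "n \<in> {..<L}"
    then show "(f ^^ k) c \<noteq> (f ^^ n) c" using period[of k n] min[of "n - k"] by force
  qed auto
  then show ?thesis using that[OF L] W[OF assms(4)] by simp
qed

text \<open>The disturbance enters at a single position \<open>k\<close> of the turn. Forward from
  \<open>x 0 = 0\<close>, dividing by \<open>l\<close>, the values vanish before \<open>k\<close>;
  backward from \<open>x L = 0\<close>, dividing by \<alpha>, they vanish from \<open>k\<close> on.
  Only \<open>t\<close> is left in the equation at \<open>k\<close>.\<close>

lemma disturbed_cycle:
  fixes x :: "nat \<Rightarrow> 'a::field"
  assumes "x 0 = 0" "x L = 0" "\<alpha> \<noteq> 0" "l \<noteq> 0" "0 < k" "k \<le> L"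
    and rec: "\<And>n. n < L \<Longrightarrow> l * x (Suc n) = \<alpha> * x n + (if Suc n = k then t else 0)"
  shows "t = 0"
proof -
  have "x n = 0" if "n < k" for n
    using that
  proof (induction n)
    case (Suc n)
    then have "l * x (Suc n) = 0" using rec[of n] assms by simp
    then show ?case using assms by simp
  qed (use assms in auto)
  moreover have "x k = 0"
    using \<open>k \<le> L\<close>
  proof (induction rule: inc_induct)
    case (step n)
    then have "\<alpha> * x n = 0" using rec[of n] by simp
    then show ?case using assms by simp
  qed (use assms in auto)
  ultimately show ?thesis using rec[of "k - 1"] assms by auto
qed

text \<open>The columns of the cycle involve only the cycle, and column \<open>p\<close> receives
  the extra term \<open>y c\<close>. One turn around the cycle gives
  \<open>\<alpha> ^ L * y c = l ^ L * y c\<close>, so \<open>y c = 0\<close> unless \<open>l\<close>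
  has modulus \<alpha>. In that case the modulus is outside \<open>R\<close>, and \<open>y c\<close>
  is a disturbance of the old part at \<open>p\<close>, which must vanish by visibility. Either way
  \<open>y c = 0\<close>, and the two parts decouple.\<close>

lemma cactus_extend:
  assumes inj: "inj_on src {..<d}"
    and E: "\<And>i j. i < d \<Longrightarrow> src i = V1 j \<Longrightarrow> (j, i) \<in> E \<and> j < d"
    and cactus: "cactus d src E S a R"
    and pc: "(p, c) \<in> E" "p \<in> S" "c < d" "c \<notin> S"
  shows "\<exists>S' a' R'. cactus d src E S' a' R' \<and> S \<subset> S'"
proof -
  have S: "S \<subseteq> {..<d}" and R: "finite R" "0 \<in> R"
    using cactus unfolding cactus_def by blast+
  have heads: "i \<in> S" if "i < d" "src i \<notin> range V1" for i
    using cactus that unfolding cactus_def by (elim conjE) blast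
  have closed: "i \<in> S \<longleftrightarrow> j \<in> S" if "i < d" "src i = V1 j" for i j
    using cactus that unfolding cactus_def by (elim conjE) blast
  have a: "(j, i) \<in> E \<and> i \<in> S \<and> j \<in> S" if "a i j \<noteq> 0" for i j
    using cactus that unfolding cactus_def by (elim conjE) blast
  have H: "\<forall>y (l :: complex). (\<forall>i\<in>S. src i \<notin> range V1 \<longrightarrow> y i = 0) \<longrightarrow>
        (\<forall>j\<in>S. (\<Sum>i\<in>S. y i * of_real (a i j)) = l * y j) \<longrightarrow> (\<forall>i\<in>S. y i = 0)"
    using cactus unfolding cactus_def by (elim conjE)
  have V: "\<forall>y (l :: complex) t. \<forall>p\<in>S. norm l \<notin> R \<longrightarrow> (\<forall>i\<in>S. src i \<notin> range V1 \<longrightarrow> y i = 0) \<longrightarrow>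
        (\<forall>j\<in>S. (\<Sum>i\<in>S. y i * of_real (a i j)) + (if j = p then t else 0) = l * y j) \<longrightarrow> t = 0"
    using cactus unfolding cactus_def by (elim conjE)
  have hautus: "\<forall>i\<in>S. y i = 0"
    if "\<forall>i\<in>S. src i \<notin> range V1 \<longrightarrow> y i = 0" "\<forall>j\<in>S. (\<Sum>i\<in>S. y i * of_real (a i j)) = l * y j"
    for y and l :: complex
    by (rule H[THEN spec, THEN spec, THEN mp, THEN mp, OF that])
  have visible: "t = 0"
    if "p \<in> S" "norm l \<notin> R" "\<forall>i\<in>S. src i \<notin> range V1 \<longrightarrow> y i = 0"
      "\<forall>j\<in>S. (\<Sum>i\<in>S. y i * of_real (a i j)) + (if j = p then t else 0) = l * y j"
    for y and l t :: complex and p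
    by (rule V[THEN spec, THEN spec, THEN spec, THEN bspec, THEN mp, THEN mp, THEN mp, OF that])
  have finS: "finite S" using S finite_subset by blast
  define W where "W = {..<d} - S"
  have "\<forall>i\<in>W. \<exists>j. src i = V1 j" using heads by (auto simp: W_def)
  then obtain f where f: "\<And>i. i \<in> W \<Longrightarrow> src i = V1 (f i)" by metis
  have "finite W" by (simp add: W_def)
  moreover have "inj_on f W"
    by (rule inj_onI) (metis f inj inj_onD W_def DiffD1)
  moreover have "f ` W \<subseteq> W"
    using f E closed by (fastforce simp: W_def)
  moreover have "c \<in> W" using pc by (auto simp: W_def)
  ultimately obtain L where L: "L > 0" "(f ^^ L) c = c" "inj_on (\<lambda>n. (f ^^ n) c) {..<L}" "\<And>n. (f ^^ n) c \<in> W"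
    by (rule cycle_through) (rule that, assumption+)
  \<comment> \<open>\<open>g\<close> runs against the edges: the matched predecessor of
    \<open>g n\<close> is \<open>g (Suc n)\<close>.\<close>
  define g where "g n = (f ^^ n) c" for n
  define C where "C = g ` {..<L}"
  have g: "g n \<in> W" "src (g n) = V1 (g (Suc n))" for n
    using L(4)[of n] f[OF L(4)[of n]] by (simp_all add: g_def)
  have gL: "g L = c" "g 0 = c" using L by (simp_all add: g_def)
  have C: "C \<subseteq> W" "finite C" "c \<in> C" using g gL L by (auto simp: C_def intro!: image_eqI[of _ _ 0])
  have SC: "S \<inter> C = {}" using C by (auto simp: W_def)
  have C': "\<exists>n<L. i = g (Suc n)" if "i \<in> C" for i
  proof -
    obtain n where n: "n < L" "i = g n" using \<open>i \<in> C\<close> by (auto simp: C_def)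
    show ?thesis
    proof (cases n)
      case 0
      then show ?thesis using n gL L by (intro exI[of _ "L - 1"]) simp
    next
      case (Suc k)
      then show ?thesis using n by (intro exI[of _ k]) simp
    qed
  qed
  have gSuc: "g (Suc n) \<in> C" if "n < L" for n
  proof (cases "Suc n = L")
    case True then show ?thesis using gL C by simp
  qed (use that in \<open>auto simp: C_def\<close>)
  have src_cycle: "i = g n" if "i < d" "src i = V1 (g (Suc n))" for i n
    using that g[of n] inj by (auto simp: W_def inj_on_def)
  \<comment> \<open>\<open>Max R + 1\<close> exceeds every excluded modulus, and it is positive
    because \<open>0 \<in> R\<close>.\<close>
  obtain \<alpha> where \<alpha>: "\<alpha> > 0" "\<alpha> \<notin> R"
  proof
    have "0 \<le> Max R" using R by (intro Max_ge)
    then show "Max R + 1 > 0" by simp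
    show "Max R + 1 \<notin> R" using R Max_ge[of R "Max R + 1"] by auto
  qed
  \<comment> \<open>The new entries cannot collide: the matched predecessor of \<open>c\<close> lies
    outside \<open>S\<close>, whereas \<open>p\<close> lies in \<open>S\<close>. Of the connecting
    entry only nonvanishing matters, so it is 1.\<close>
  define a' where "a' i j = (if i \<in> S then a i j else if i \<in> C \<and> src i = V1 j then \<alpha>
      else if i = c \<and> j = p then 1 else 0)" for i j
  have sumS: "(\<Sum>i\<in>S \<union> C. y i * complex_of_real (a' i j)) = (\<Sum>i\<in>S. y i * of_real (a i j)) + (if j = p then y c else 0)"
    if "j \<in> S" for y j
  proof -
    have "(\<Sum>i\<in>C. y i * complex_of_real (a' i j)) = (\<Sum>i\<in>C. if i = c then if j = p then y c else 0 else 0)"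
    proof (rule sum.cong)
      fix i assume i: "i \<in> C"
      then have "i \<in> W" "i \<notin> S" using C by (auto simp: W_def)
      then have "src i \<noteq> V1 j" using closed[of i j] that by (auto simp: W_def)
      then show "y i * complex_of_real (a' i j) = (if i = c then if j = p then y c else 0 else 0)"
        using \<open>i \<notin> S\<close> by (simp add: a'_def)
    qed simp
    also have "\<dots> = (if j = p then y c else 0)" using C by simp
    finally show ?thesis using finS C SC by (simp add: sum.union_disjoint a'_def)
  qed
  have sumC: "(\<Sum>i\<in>S \<union> C. y i * complex_of_real (a' i (g (Suc n)))) = of_real \<alpha> * y (g n)" if n: "n < L" for y n
  proof -
    have nS: "g (Suc n) \<notin> S" using g[of "Suc n"] by (simp add: W_def)
    have "(\<Sum>i\<in>S \<union> C. y i * complex_of_real (a' i (g (Suc n)))) = (\<Sum>i\<in>S \<union> C. if i = g n then of_real \<alpha> * y (g n) else 0)"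
    proof (rule sum.cong)
      fix i assume i: "i \<in> S \<union> C"
      show "y i * complex_of_real (a' i (g (Suc n))) = (if i = g n then of_real \<alpha> * y (g n) else 0)"
      proof (cases "i \<in> S")
        case True
        then show ?thesis using a[of i "g (Suc n)"] nS g[of n] by (auto simp: a'_def W_def)
      next
        case False
        then have "i < d" "i \<in> C" using i C by (auto simp: W_def)
        then have "src i = V1 (g (Suc n)) \<longleftrightarrow> i = g n" using src_cycle[of i n] g(2)[of n] by metis
        moreover have "g (Suc n) \<noteq> p" using nS pc by metis
        ultimately show ?thesis using False \<open>i \<in> C\<close> by (simp add: a'_def)
      qed
    qed simp
    also have "\<dots> = of_real \<alpha> * y (g n)" using finS C n by (auto simp: C_def)
    finally show ?thesis .
  qed
  have cycle_zero: "\<forall>i\<in>C. y i = 0"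
    if "y c = 0" and eq: "\<And>n. n < L \<Longrightarrow> of_real \<alpha> * y (g n) = l * y (g (Suc n))" for y and l :: complex
  proof -
    have "y (g n) = 0" if "n \<le> L" for n
      using that
    proof (induction rule: inc_induct)
      case (step n)
      then have "of_real \<alpha> * y (g n) = 0" using eq[of n] by simp
      then show ?case using \<alpha> by simp
    qed (use \<open>y c = 0\<close> gL in simp)
    then show ?thesis by (auto simp: C_def)
  qed
  have cycle_zero': "y c = 0"
    if "norm l \<noteq> \<alpha>" and eq: "\<And>n. n < L \<Longrightarrow> of_real \<alpha> * y (g n) = l * y (g (Suc n))" for y and l :: complex
  proof -
    have "of_real \<alpha> ^ n * y c = l ^ n * y (g n)" if "n \<le> L" for n
      using that
    proof (induction n)
      case (Suc n)
      then have "of_real \<alpha> ^ Suc n * y c = l ^ n * (of_real \<alpha> * y (g n))" by (simp add: algebra_simps)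
      then show ?case using eq[of n] Suc.prems by simp
    qed (simp add: gL)
    from this[of L] have "(of_real \<alpha> ^ L - l ^ L) * y c = 0" using gL by (simp add: algebra_simps)
    moreover have "of_real \<alpha> ^ L \<noteq> l ^ L"
    proof
      assume "of_real \<alpha> ^ L = l ^ L"
      then have "norm (of_real \<alpha> :: complex) ^ L = norm l ^ L" by (metis norm_power)
      then show False using \<alpha> that(1) L(1) by (simp add: power_eq_iff_eq_base)
    qed
    ultimately show ?thesis by simp
  qed
  have "cactus d src E (S \<union> C) a' (insert \<alpha> R)"
    unfolding cactus_def
  proof (intro conjI)
    show "S \<union> C \<subseteq> {..<d}" using S C by (auto simp: W_def)
    show "finite (insert \<alpha> R)" "0 \<in> insert \<alpha> R" using R by auto
    show "\<forall>i<d. src i \<notin> range V1 \<longrightarrow> i \<in> S \<union> C" using heads by blast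
    show "\<forall>i<d. \<forall>j. src i = V1 j \<longrightarrow> (i \<in> S \<union> C \<longleftrightarrow> j \<in> S \<union> C)"
    proof (intro allI impI)
      fix i j assume i: "i < d" "src i = V1 j"
      have "j \<in> C" if "i \<in> C"
      proof -
        obtain n where "n < L" "i = g n" using \<open>i \<in> C\<close> by (auto simp: C_def)
        then show ?thesis using g(2)[of n] i gSuc[of n] by simp
      qed
      moreover have "i \<in> C" if "j \<in> C"
      proof -
        obtain n where n: "n < L" "j = g (Suc n)" using C' \<open>j \<in> C\<close> by blast
        then show ?thesis using src_cycle[of i n] i n by (auto simp: C_def)
      qed
      ultimately show "i \<in> S \<union> C \<longleftrightarrow> j \<in> S \<union> C" using closed[OF i] by blast
    qed
    show "\<forall>i j. a' i j \<noteq> 0 \<longrightarrow> (j, i) \<in> E \<and> i \<in> S \<union> C \<and> j \<in> S \<union> C"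
    proof (intro allI impI)
      fix i j assume nz: "a' i j \<noteq> 0"
      consider "i \<in> S" | "i \<notin> S" "i \<in> C" "src i = V1 j" | "i = c" "j = p"
        using nz by (auto simp: a'_def split: if_splits)
      then show "(j, i) \<in> E \<and> i \<in> S \<union> C \<and> j \<in> S \<union> C"
      proof cases
        case 1
        then show ?thesis using nz a[of i j] by (auto simp: a'_def)
      next
        case 2
        then obtain n where "n < L" "i = g n" by (auto simp: C_def)
        then have "j \<in> C" using 2 g(2)[of n] gSuc[of n] by simp
        then show ?thesis using 2 E[of i j] C by (auto simp: W_def)
      next
        case 3
        then show ?thesis using pc C by auto
      qed
    qed
    show "\<forall>y (l :: complex). (\<forall>i\<in>S \<union> C. src i \<notin> range V1 \<longrightarrow> y i = 0) \<longrightarrow>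
        (\<forall>j\<in>S \<union> C. (\<Sum>i\<in>S \<union> C. y i * of_real (a' i j)) = l * y j) \<longrightarrow> (\<forall>i\<in>S \<union> C. y i = 0)"
    proof (intro allI impI)
      fix y and l :: complex
      assume h: "\<forall>i\<in>S \<union> C. src i \<notin> range V1 \<longrightarrow> y i = 0"
        and eq: "\<forall>j\<in>S \<union> C. (\<Sum>i\<in>S \<union> C. y i * of_real (a' i j)) = l * y j"
      have eqS: "\<forall>j\<in>S. (\<Sum>i\<in>S. y i * of_real (a i j)) + (if j = p then y c else 0) = l * y j"
      proof
        fix j assume "j \<in> S"
        then show "(\<Sum>i\<in>S. y i * of_real (a i j)) + (if j = p then y c else 0) = l * y j"
          using bspec[OF eq, of j] sumS[of j y] by (simp only: Un_iff simp_thms)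
      qed
      have eqC: "of_real \<alpha> * y (g n) = l * y (g (Suc n))" if "n < L" for n
        using bspec[OF eq UnI2[OF gSuc[OF that]]] sumC[OF that, of y] by simp
      have "y c = 0"
      proof (cases "norm l = \<alpha>")
        case True
        then show ?thesis using visible[OF pc(2) _ _ eqS] h \<alpha> by blast
      next
        case False
        then show ?thesis using cycle_zero'[of l y] eqC by blast
      qed
      then have "\<forall>i\<in>C. y i = 0" using cycle_zero[of y l] eqC by blast
      moreover have "\<forall>i\<in>S. y i = 0"
      proof (rule hautus[of y l])
        show "\<forall>j\<in>S. (\<Sum>i\<in>S. y i * of_real (a i j)) = l * y j" using eqS by (simp add: \<open>y c = 0\<close> cong: if_cong)
      qed (use h in blast)
      ultimately show "\<forall>i\<in>S \<union> C. y i = 0" by blast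
    qed
    show "\<forall>y (l :: complex) t. \<forall>q\<in>S \<union> C. norm l \<notin> insert \<alpha> R \<longrightarrow> (\<forall>i\<in>S \<union> C. src i \<notin> range V1 \<longrightarrow> y i = 0) \<longrightarrow>
        (\<forall>j\<in>S \<union> C. (\<Sum>i\<in>S \<union> C. y i * of_real (a' i j)) + (if j = q then t else 0) = l * y j) \<longrightarrow> t = 0"
    proof (intro allI ballI impI)
      fix y and l t :: complex and q
      assume q: "q \<in> S \<union> C" and l: "norm l \<notin> insert \<alpha> R"
        and h: "\<forall>i\<in>S \<union> C. src i \<notin> range V1 \<longrightarrow> y i = 0"
        and eq: "\<forall>j\<in>S \<union> C. (\<Sum>i\<in>S \<union> C. y i * of_real (a' i j)) + (if j = q then t else 0) = l * y j"
      have eqC: "of_real \<alpha> * y (g n) + (if g (Suc n) = q then t else 0) = l * y (g (Suc n))" if "n < L" for n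
        using bspec[OF eq, of "g (Suc n)"] sumC[OF that] gSuc[OF that] by simp
      show "t = 0"
      proof (cases "q \<in> S")
        case True
        have ne: "g (Suc n) \<noteq> q" for n using True g(1)[of "Suc n"] by (auto simp: W_def)
        have "of_real \<alpha> * y (g n) = l * y (g (Suc n))" if "n < L" for n
          using eqC[OF that] ne[of n] by simp
        moreover have "norm l \<noteq> \<alpha>" using l by blast
        ultimately have "y c = 0" using cycle_zero'[of l y] by blast
        have "\<forall>j\<in>S. (\<Sum>i\<in>S. y i * of_real (a i j)) + (if j = q then t else 0) = l * y j"
        proof
          fix j assume "j \<in> S"
          then show "(\<Sum>i\<in>S. y i * of_real (a i j)) + (if j = q then t else 0) = l * y j"
            using bspec[OF eq, of j] sumS[of j y] \<open>y c = 0\<close> by (simp cong: if_cong)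
        qed
        then show ?thesis using visible[OF True, of l y t] l h by blast
      next
        case False
        have "\<forall>j\<in>S. (\<Sum>i\<in>S. y i * of_real (a i j)) + (if j = p then y c else 0) = l * y j"
        proof
          fix j assume "j \<in> S"
          then have "j \<noteq> q" using False by blast
          then show "(\<Sum>i\<in>S. y i * of_real (a i j)) + (if j = p then y c else 0) = l * y j"
            using bspec[OF eq, of j] sumS[of j y] \<open>j \<in> S\<close> by (simp only: Un_iff simp_thms if_False add_0_right)
        qed
        \<comment> \<open>Here the disturbance \<open>t\<close> sits on the cycle, so the equations
          of \<open>S\<close> contain \<open>y c\<close> as their only disturbance. Its vanishing
          supplies both boundary values of \<open>disturbed_cycle\<close>, as the turn starts and
          ends at \<open>c\<close>.\<close>
        then have "y c = 0" using visible[OF pc(2), of l y "y c"] l h by blast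
        obtain k where k: "k < L" "q = g (Suc k)" using C'[of q] False q by blast
        have uniq: "g (Suc n) = q \<longleftrightarrow> Suc n = Suc k" if "n < L" for n
        proof
          assume "g (Suc n) = q"
          then have "src (g n) = src (g k)" using g(2) k by simp
          then have "g n = g k" using inj g(1)[of n] g(1)[of k] by (auto simp: W_def inj_on_def)
          then show "Suc n = Suc k" using L(3) that k by (auto simp: g_def[symmetric] inj_on_def)
        qed (use k in auto)
        show ?thesis
        proof (rule disturbed_cycle[of "\<lambda>n. y (g n)" L "of_real \<alpha>" l "Suc k"])
          show "l * y (g (Suc n)) = of_real \<alpha> * y (g n) + (if Suc n = Suc k then t else 0)" if "n < L" for n
            using eqC[OF that] uniq[OF that] by simp
        qed (use \<open>y c = 0\<close> gL \<alpha> l R k in auto)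
      qed
    qed
  qed
  moreover have "S \<subset> S \<union> C" using C SC by blast
  ultimately show ?thesis by blast
qed

text \<open>Every cactus contains all heads, so \<open>h\<close> keeps the set nonempty, and an edge
  leaves it as long as states are missing. A cactus of greatest size is therefore complete. Without
  a head the empty set would be a cactus that no edge leaves.\<close>

lemma exists_Hautus_realization:
  assumes inj: "inj_on src {..<d}"
    and E: "\<And>i j. i < d \<Longrightarrow> src i = V1 j \<Longrightarrow> (j, i) \<in> E \<and> j < d"
    and head: "h < d" "src h \<notin> range V1"
    and connected: "\<And>S. h \<in> S \<Longrightarrow> S \<subset> {..<d} \<Longrightarrow> \<exists>p\<in>S. \<exists>c\<in>{..<d} - S. (p, c) \<in> E"
  shows "\<exists>a :: nat \<Rightarrow> nat \<Rightarrow> real. (\<forall>i j. a i j \<noteq> 0 \<longrightarrow> (j, i) \<in> E) \<and>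
    (\<forall>y (l :: complex). (\<forall>i<d. src i \<notin> range V1 \<longrightarrow> y i = 0) \<longrightarrow>
        (\<forall>j<d. (\<Sum>i<d. y i * of_real (a i j)) = l * y j) \<longrightarrow> (\<forall>i<d. y i = 0))"
proof -
  define good where "good S \<longleftrightarrow> (\<exists>a R. cactus d src E S a R)" for S
  have bound: "S \<subseteq> {..<d}" if "good S" for S using that by (auto simp: good_def cactus_def)
  obtain S0 where "good S0" using cactus_stems[OF inj] E unfolding good_def by blast
  moreover have "\<forall>S. good S \<longrightarrow> card S < Suc d"
    using card_mono[OF _ bound] by (auto simp: less_Suc_eq_le)
  ultimately obtain S where S: "good S" and max: "\<forall>S'. good S' \<longrightarrow> card S' \<le> card S"
    using ex_has_greatest_nat[of good S0 card "Suc d"] by blast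
  obtain a R where c: "cactus d src E S a R" using S by (auto simp: good_def)
  have "S = {..<d}"
  proof (rule ccontr)
    assume "S \<noteq> {..<d}"
    then have "S \<subset> {..<d}" using bound[OF S] by blast
    moreover have "h \<in> S" using c head by (auto simp: cactus_def)
    ultimately obtain p q where pq: "p \<in> S" "q \<in> {..<d} - S" "(p, q) \<in> E"
      using connected[of S] by blast
    then obtain S' where "good S'" "S \<subset> S'"
      using cactus_extend[OF inj E c, of p q] pq unfolding good_def by blast
    moreover have "finite S'" using bound[OF \<open>good S'\<close>] finite_subset by blast
    ultimately have "card S < card S'" by (intro psubset_card_mono)
    then show False using max \<open>good S'\<close> by force
  qed
  then show ?thesis using c unfolding cactus_def by (intro exI[of _ a]) auto
qed

section \<open>Program logic with operation counts\<close>

definition runs :: "com \<Rightarrow> state \<Rightarrow> nat \<Rightarrow> (state \<Rightarrow> bool) \<Rightarrow> bool" where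
  "runs c s T Q \<longleftrightarrow> (\<exists>t s'. exec c s t s' \<and> t \<le> T \<and> Q s')"

lemma runsI: "exec c s t s' \<Longrightarrow> t \<le> T \<Longrightarrow> Q s' \<Longrightarrow> runs c s T Q"
  unfolding runs_def by blast

lemma runsE:
  assumes "runs c s T Q"
  obtains t s' where "exec c s t s'" "t \<le> T" "Q s'"
  using assms unfolding runs_def by blast

lemma runs_mono: "runs c s T Q \<Longrightarrow> T \<le> T' \<Longrightarrow> (\<And>s'. Q s' \<Longrightarrow> Q' s') \<Longrightarrow> runs c s T' Q'"
  unfolding runs_def by (meson order_trans)

lemma runs_Seq:
  assumes "runs c1 s T1 R" "\<And>s'. R s' \<Longrightarrow> runs c2 s' T2 Q" "T1 + T2 \<le> T"
  shows "runs (c1 ;; c2) s T Q"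
proof -
  obtain t1 s1 where 1: "exec c1 s t1 s1" "t1 \<le> T1" "R s1" using assms(1) unfolding runs_def by blast
  obtain t2 s2 where 2: "exec c2 s1 t2 s2" "t2 \<le> T2" "Q s2" using assms(2)[OF 1(3)] unfolding runs_def by blast
  show ?thesis unfolding runs_def
    using exec.Seq[OF 1(1) 2(1)] 1 2 assms(3) by (intro exI[of _ "t1 + t2"] exI[of _ s2]) simp
qed

fun nmods :: "com \<Rightarrow> string set" where
  "nmods Skip = {}"
| "nmods (NAssign x a b e) = {x}"
| "nmods (RAssign x a b e) = {}"
| "nmods (c1 ;; c2) = nmods c1 \<union> nmods c2"
| "nmods (Cond b c1 c2) = nmods c1 \<union> nmods c2"
| "nmods (While b c) = nmods c"

fun rmods :: "com \<Rightarrow> string set" where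
  "rmods Skip = {}"
| "rmods (NAssign x a b e) = {}"
| "rmods (RAssign x a b e) = {x}"
| "rmods (c1 ;; c2) = rmods c1 \<union> rmods c2"
| "rmods (Cond b c1 c2) = rmods c1 \<union> rmods c2"
| "rmods (While b c) = rmods c"

text \<open>This is a frame condition at the level of whole arrays. It is read off the program text
  once and for all, so that loop invariants need only describe the arrays that the loop
  writes.\<close>

definition agree :: "com \<Rightarrow> state \<Rightarrow> state \<Rightarrow> bool" where
  "agree c s s' \<longleftrightarrow> (\<forall>y. y \<notin> nmods c \<longrightarrow> fst s' y = fst s y) \<and> (\<forall>y. y \<notin> rmods c \<longrightarrow> snd s' y = snd s y)"

lemma agree_trans: "agree c s s' \<Longrightarrow> agree c s' s'' \<Longrightarrow> agree c s s''" by (simp add: agree_def)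

lemma agree_mono: "agree c s s' \<Longrightarrow> nmods c \<subseteq> nmods c' \<Longrightarrow> rmods c \<subseteq> rmods c' \<Longrightarrow> agree c' s s'"
  unfolding agree_def by blast

lemma agreeN: "agree c s s' \<Longrightarrow> y \<notin> nmods c \<Longrightarrow> fst s' y = fst s y"
  and agreeR: "agree c s s' \<Longrightarrow> y \<notin> rmods c \<Longrightarrow> snd s' y = snd s y"
  by (simp_all add: agree_def)

lemma upd_cell_apply: "upd_cell f x i j v y k l = (if y = x \<and> k = i \<and> l = j then v else f y k l)"
  by (simp add: upd_cell_def)

lemma upd_cell_other: "y \<noteq> x \<Longrightarrow> upd_cell f x i j v y = f y"
  by (simp add: upd_cell_def)

lemma exec_agree: "exec c s t s' \<Longrightarrow> agree c s s'"
  by (induction rule: exec.induct) (auto simp: agree_def upd_cell_other)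

lemma runs_agree: "runs c s T Q \<Longrightarrow> runs c s T (\<lambda>s'. Q s' \<and> agree c s s')"
  unfolding runs_def using exec_agree by blast

section \<open>Loop-free code and loop rules\<close>

fun straight :: "com \<Rightarrow> bool" where
  "straight (c1 ;; c2) \<longleftrightarrow> straight c1 \<and> straight c2"
| "straight (Cond b c1 c2) \<longleftrightarrow> straight c1 \<and> straight c2"
| "straight (While b c) \<longleftrightarrow> False"
| "straight _ \<longleftrightarrow> True"

fun eff :: "com \<Rightarrow> state \<Rightarrow> state" where
  "eff Skip s = s"
| "eff (NAssign x a b e) s = (upd_cell (fst s) x (nval s a) (nval s b) (nval s e), snd s)"
| "eff (RAssign x a b e) s = (fst s, upd_cell (snd s) x (nval s a) (nval s b) (rval s e))"
| "eff (c1 ;; c2) s = eff c2 (eff c1 s)"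
| "eff (Cond b c1 c2) s = (if bval s b then eff c1 s else eff c2 s)"
| "eff (While b c) s = s"

text \<open>A conditional is charged for both branches. This upper bound does not depend on the
  state, and simplification evaluates it to a number for concrete code.\<close>

fun ccost :: "com \<Rightarrow> nat" where
  "ccost Skip = 1"
| "ccost (NAssign x a b e) = ncost a + ncost b + ncost e + 1"
| "ccost (RAssign x a b e) = ncost a + ncost b + rcost e + 1"
| "ccost (c1 ;; c2) = ccost c1 + ccost c2"
| "ccost (Cond b c1 c2) = bcost b + 1 + ccost c1 + ccost c2"
| "ccost (While b c) = 0"

lemma exec_straight: "straight c \<Longrightarrow> \<exists>t \<le> ccost c. exec c s t (eff c s)"
proof (induction c arbitrary: s)
  case (Seq c1 c2)
  then obtain t1 t2 where "t1 \<le> ccost c1" "exec c1 s t1 (eff c1 s)" "t2 \<le> ccost c2" "exec c2 (eff c1 s) t2 (eff c2 (eff c1 s))"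
    by (meson straight.simps(1))
  then show ?case by (intro exI[of _ "t1 + t2"]) (auto intro: exec.Seq)
next
  case (Cond b c1 c2)
  then obtain t1 t2 where 1: "t1 \<le> ccost c1" "exec c1 s t1 (eff c1 s)" and 2: "t2 \<le> ccost c2" "exec c2 s t2 (eff c2 s)"
    by (meson straight.simps(2))
  show ?case
  proof (cases "bval s b")
    case True
    then show ?thesis using exec.CondTrue[OF True 1(2), of c2] 1 by (intro exI[of _ "bcost b + 1 + t1"]) simp
  next
    case False
    then show ?thesis using exec.CondFalse[OF False 2(2), of c1] 2 by (intro exI[of _ "bcost b + 1 + t2"]) simp
  qed
next
  case Skip
  show ?case using exec.Skip by (intro exI[of _ 1]) simp
next
  case (NAssign x a b e)
  show ?case by (rule exI, rule conjI[rotated], unfold eff.simps, rule exec.NAssign) simp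
next
  case (RAssign x a b e)
  show ?case by (rule exI, rule conjI[rotated], unfold eff.simps, rule exec.RAssign) simp
qed simp

lemma runs_straight: "straight c \<Longrightarrow> ccost c \<le> T \<Longrightarrow> Q (eff c s) \<Longrightarrow> runs c s T Q"
  using exec_straight[of c s] by (auto intro: runsI)

text \<open>\<open>k\<close> bounds the number of remaining rounds. The loop may stop while
  \<open>k\<close> is still positive, so an invariant can carry an upper bound such as a rank
  instead of an exact count.\<close>

lemma runs_While:
  assumes init: "P s k"
    and step: "\<And>s k. P s k \<Longrightarrow> bval s b \<Longrightarrow> k > 0 \<and> runs c s K (\<lambda>s'. P s' (k - 1))"
    and final: "\<And>s k. P s k \<Longrightarrow> \<not> bval s b \<Longrightarrow> Q s"
    and time: "k * (bcost b + 1 + K) + bcost b + 1 \<le> T"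
  shows "runs (While b c) s T Q"
proof -
  have "runs (While b c) s (k * (bcost b + 1 + K) + bcost b + 1) Q" if "P s k" for s k
    using that
  proof (induction k arbitrary: s)
    case 0
    then have "\<not> bval s b" using step by blast
    then show ?case using final[OF 0] by (intro runsI[OF exec.WhileFalse]) auto
  next
    case (Suc k)
    show ?case
    proof (cases "bval s b")
      case False
      show ?thesis using final[OF Suc.prems False] by (intro runsI[OF exec.WhileFalse[OF False]]) auto
    next
      case True
      obtain t1 s1 where 1: "exec c s t1 s1" "t1 \<le> K" "P s1 k"
        using step[OF Suc.prems True] by (auto elim: runsE)
      obtain t2 s2 where 2: "exec (While b c) s1 t2 s2" "t2 \<le> k * (bcost b + 1 + K) + bcost b + 1" "Q s2"
        using Suc.IH[OF 1(3)] by (rule runsE)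
      show ?thesis using 1 2 by (intro runsI[OF exec.WhileTrue[OF True 1(1) 2(1)]]) auto
    qed
  qed
  from this[OF init] show ?thesis by (rule runs_mono) (use time in auto)
qed

definition set_index :: "string \<Rightarrow> nat \<Rightarrow> state \<Rightarrow> state" where
  "set_index x k s = (upd_cell (fst s) x 0 0 k, snd s)"

lemma set_index_simps [simp]:
  "fst (set_index x k s) y i j = (if y = x \<and> i = 0 \<and> j = 0 then k else fst s y i j)"
  "snd (set_index x k s) = snd s"
  by (simp_all add: set_index_def upd_cell_apply)

text \<open>The increment follows the body, so the invariant of the next round is demanded of the
  state with the counter already advanced. Agreement with the initial state shows that the limit
  \<open>b\<close> keeps its value. Of the 13 units per round, 8 pay for the increment and 5,
  besides \<open>ncost b\<close>, for the test.\<close>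

lemma runs_For:
  assumes lo: "nval s0 a = lo" and le: "lo \<le> hi"
    and init: "P lo (set_index x lo s0)"
    and bound: "\<And>s. agree (For x a b c) s0 s \<Longrightarrow> nval s b = hi"
    and step: "\<And>k s. lo \<le> k \<Longrightarrow> k < hi \<Longrightarrow> P k s \<Longrightarrow> fst s x 0 0 = k \<Longrightarrow> agree (For x a b c) s0 s \<Longrightarrow>
       runs c s K (\<lambda>s'. fst s' x 0 0 = k \<and> P (Suc k) (set_index x (Suc k) s'))"
    and final: "\<And>s. P hi s \<Longrightarrow> fst s x 0 0 = hi \<Longrightarrow> agree (For x a b c) s0 s \<Longrightarrow> Q s"
    and time: "ncost a + 8 + ncost b + (hi - lo) * (K + ncost b + 13) \<le> T"
  shows "runs (For x a b c) s0 T Q"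
  unfolding For_def
proof (rule runs_Seq)
  show "runs (set_nsc x a) s0 (ncost a + 3) (\<lambda>s. s = set_index x lo s0)"
    by (rule runs_straight) (simp_all add: set_index_def lo)
  let ?P = "\<lambda>s k. \<exists>i. k = hi - i \<and> lo \<le> i \<and> i \<le> hi \<and> P i s \<and> fst s x 0 0 = i \<and> agree (For x a b c) s0 s"
  fix s assume s: "s = set_index x lo s0"
  have setx: "agree (For x a b c) s (set_index x k s)" for s k
    by (auto simp: agree_def For_def set_index_def upd_cell_other)
  show "runs (While (NLess (nsc x) b) (c ;; set_nsc x (nsuc (nsc x)))) s
      ((hi - lo) * (K + ncost b + 13) + ncost b + 5) Q"
  proof (rule runs_While[where P = ?P and K = "K + 8"])
    show "?P s (hi - lo)" using init s le setx[of s0 lo] by (intro exI[of _ lo]) auto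
  next
    fix s k assume "?P s k" and b: "bval s (NLess (nsc x) b)"
    then obtain i where i: "k = hi - i" "lo \<le> i" "i \<le> hi" "P i s" "fst s x 0 0 = i" "agree (For x a b c) s0 s"
      by blast
    then have lt: "i < hi" using b bound[OF i(6)] by simp
    have "runs (c ;; set_nsc x (nsuc (nsc x))) s (K + 8) (\<lambda>s'. ?P s' (k - 1))"
    proof (rule runs_Seq)
      show "runs c s K (\<lambda>s'. (fst s' x 0 0 = i \<and> P (Suc i) (set_index x (Suc i) s')) \<and> agree c s s')"
        by (rule runs_agree[OF step[OF i(2) lt i(4-6)]])
      fix s' assume s': "(fst s' x 0 0 = i \<and> P (Suc i) (set_index x (Suc i) s')) \<and> agree c s s'"
      then have "agree (For x a b c) s s'" by (auto intro: agree_mono simp: For_def)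
      then have ag: "agree (For x a b c) s0 (set_index x (Suc i) s')"
        using i(6) setx agree_trans by blast
      show "runs (set_nsc x (nsuc (nsc x))) s' 8 (\<lambda>s'. ?P s' (k - 1))"
      proof (rule runs_straight)
        have "eff (set_nsc x (nsuc (nsc x))) s' = set_index x (Suc i) s'"
          using s' by (simp add: set_index_def)
        then show "?P (eff (set_nsc x (nsuc (nsc x))) s') (k - 1)"
          using i lt s' ag by (intro exI[of _ "Suc i"]) simp
      qed simp_all
    qed simp
    then show "k > 0 \<and> runs (c ;; set_nsc x (nsuc (nsc x))) s (K + 8) (\<lambda>s'. ?P s' (k - 1))"
      using i lt by simp
  next
    fix s k assume "?P s k" and b: "\<not> bval s (NLess (nsc x) b)"
    then obtain i where i: "i \<le> hi" "P i s" "fst s x 0 0 = i" "agree (For x a b c) s0 s" by blast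
    then have "i = hi" using b bound[OF i(4)] by simp
    then show "Q s" using final i by blast
  qed (simp add: algebra_simps)
qed (use time in simp)

section \<open>Alternating trees and potentials\<close>

text \<open>Dual feasibility and complementary slackness of the linear program that covers each row
  exactly once and each column at most once; the latter is why \<open>v\<close> is nonpositive, and
  zero at free columns. Slackness is claimed only on \<open>J\<close>, because an augmentation
  repairs one column at a time. Rows above \<open>i\<close> are not yet inserted.\<close>

definition potentials :: "nat \<Rightarrow> nat \<Rightarrow> (nat \<Rightarrow> nat \<Rightarrow> real) \<Rightarrow> nat \<Rightarrow> (nat \<Rightarrow> nat) \<Rightarrow> (nat \<Rightarrow> real) \<Rightarrow> (nat \<Rightarrow> real) \<Rightarrow> nat set \<Rightarrow> bool" where
  "potentials d n c i p u v J \<longleftrightarrow>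
     (\<forall>r\<in>{1..d}. \<forall>j\<in>{1..n}. u r + v j \<le> c r j) \<and>
     (\<forall>j\<in>{1..n}. v j \<le> 0) \<and>
     (\<forall>j\<in>{1..n} \<inter> J. if p j = 0 then v j = 0 else u (p j) + v j = c (p j) j) \<and>
     (\<forall>r. i < r \<longrightarrow> r \<le> d \<longrightarrow> u r = 0)"

text \<open>The value 0 marks a free column. \<open>J\<close> is \<open>{1..n}\<close> between
  insertions, \<open>{..n}\<close> while the artificial column holds the row being inserted, and
  \<open>{..n}\<close> without the column under repair during an augmentation.\<close>

definition assigns :: "nat \<Rightarrow> (nat \<Rightarrow> nat) \<Rightarrow> nat set \<Rightarrow> bool" where
  "assigns i p J \<longleftrightarrow> (\<forall>j\<in>J. p j \<le> i) \<and> (\<forall>j\<in>J. \<forall>k\<in>J. p j = p k \<longrightarrow> p j \<noteq> 0 \<longrightarrow> j = k) \<and> (\<forall>r\<in>{1..i}. \<exists>j\<in>J. p j = r)"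

lemma assigns_le: "assigns i p J \<Longrightarrow> j \<in> J \<Longrightarrow> p j \<le> i"
  and assigns_inj: "assigns i p J \<Longrightarrow> j \<in> J \<Longrightarrow> k \<in> J \<Longrightarrow> p j = p k \<Longrightarrow> p j \<noteq> 0 \<Longrightarrow> j = k"
  and assigns_surj: "assigns i p J \<Longrightarrow> r \<in> {1..i} \<Longrightarrow> \<exists>j\<in>J. p j = r"
  unfolding assigns_def by blast+

text \<open>
  \<open>X\<close> is the set of columns marked in \<open>used\<close>. The ranks \<open>rk\<close> record the order in which columns
  entered the tree, so that following \<open>way\<close> terminates.
\<close>

definition alternating_tree :: "nat \<Rightarrow> nat \<Rightarrow> (nat \<Rightarrow> nat \<Rightarrow> real) \<Rightarrow> nat \<Rightarrow> (nat \<Rightarrow> nat) \<Rightarrow> nat set \<Rightarrow> nat \<Rightarrow>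
    (nat \<Rightarrow> real) \<Rightarrow> (nat \<Rightarrow> real) \<Rightarrow> (nat \<Rightarrow> real) \<Rightarrow> (nat \<Rightarrow> nat) \<Rightarrow> (nat \<Rightarrow> nat) \<Rightarrow> bool" where
  "alternating_tree d n c i p X j0 u v minv way rk \<longleftrightarrow>
     X \<subseteq> {..n} \<and> j0 \<le> n \<and> j0 \<notin> X \<and> (X = {} \<longleftrightarrow> j0 = 0) \<and> (X \<noteq> {} \<longrightarrow> 0 \<in> X) \<and>
     (\<forall>j\<in>X. p j \<noteq> 0) \<and> potentials d n c i p u v UNIV \<and>
     (\<forall>j\<in>insert j0 X - {0}. way j \<in> X \<and> rk (way j) < rk j \<and> u (p (way j)) + v j = c (p (way j)) j) \<and>
     rk j0 = card X \<and> (\<forall>j\<in>X. rk j < card X) \<and>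
     (\<forall>j\<in>{1..n} - X. X \<noteq> {} \<longrightarrow> way j \<in> X \<and> minv j = c (p (way j)) j - u (p (way j)) - v j \<and>
        (\<forall>k\<in>X. minv j \<le> c (p k) j - u (p k) - v j))"

text \<open>One round of Dijkstra's algorithm on reduced costs, with the dual update made at once.
  Raising \<open>u\<close> on tree rows and lowering \<open>v\<close> on tree columns by
  \<open>nm j1\<close> keeps the tree edges tight. Slack from a tree row to a column outside drops
  by \<open>nm j1\<close>, the least such slack, so feasibility holds and the edge into
  \<open>j1\<close> becomes tight. The row being inserted takes part through column 0. Tree columns
  all carry rows, so \<open>v\<close> stays zero at free columns.\<close>

lemma tree_step:
  assumes p: "p 0 = i" "1 \<le> i" "i \<le> d" "assigns i p {..n}"
    and tree: "alternating_tree d n c i p X j0 u v minv way rk" and "p j0 \<noteq> 0"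
    and X': "X' = insert j0 X"
    and cur: "\<And>j. cur j = c (p j0) j - u (p j0) - v j"
    and nm: "\<And>j. nm j = (if j0 = 0 \<or> cur j < minv j then cur j else minv j)"
    and j1: "j1 \<in> {1..n} - X'" "\<And>j. j \<in> {1..n} - X' \<Longrightarrow> nm j1 \<le> nm j"
    and u': "\<And>r. u' r = u r + (if r \<in> p ` X' then nm j1 else 0)"
    and v': "\<And>j. j \<le> n \<Longrightarrow> v' j = v j - (if j \<in> X' then nm j1 else 0)"
    and minv': "\<And>j. j \<in> {1..n} - X' \<Longrightarrow> minv' j = nm j - nm j1"
    and way': "\<And>j. j \<in> {1..n} - X' \<Longrightarrow> way' j = (if j0 = 0 \<or> cur j < minv j then j0 else way j)"
    and way'X: "\<And>j. j \<in> X' \<Longrightarrow> way' j = way j"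
  shows "alternating_tree d n c i p X' j1 u' v' minv' way' (rk(j1 := card X'))"
proof -
  have t: "X \<subseteq> {..n}" "j0 \<le> n" "j0 \<notin> X" "X = {} \<longleftrightarrow> j0 = 0" "X \<noteq> {} \<longrightarrow> 0 \<in> X" "\<forall>j\<in>X. p j \<noteq> 0"
    and pot: "potentials d n c i p u v UNIV"
    and tr: "\<forall>j\<in>insert j0 X - {0}. way j \<in> X \<and> rk (way j) < rk j \<and> u (p (way j)) + v j = c (p (way j)) j"
    and rk: "rk j0 = card X" "\<forall>j\<in>X. rk j < card X"
    and mv: "\<forall>j\<in>{1..n} - X. X \<noteq> {} \<longrightarrow> way j \<in> X \<and> minv j = c (p (way j)) j - u (p (way j)) - v j \<and>
        (\<forall>k\<in>X. minv j \<le> c (p k) j - u (p k) - v j)"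
    using tree unfolding alternating_tree_def by - (elim conjE, assumption)+
  have finU: "finite X" using t(1) finite_subset by blast
  have X'n: "X' \<subseteq> {..n}" "finite X'" using t X' finU by auto
  have feas: "u r + v j \<le> c r j" if "1 \<le> r" "r \<le> d" "1 \<le> j" "j \<le> n" for r j
    using pot that by (auto simp: potentials_def)
  have pU': "1 \<le> p j" "p j \<le> i" "p j \<le> d" if "j \<in> X'" for j
  proof -
    have "p j \<noteq> 0" using that t \<open>p j0 \<noteq> 0\<close> X' by auto
    then show "1 \<le> p j" by simp
    show "p j \<le> i" using p(4) that X'n by (auto simp: assigns_def)
    then show "p j \<le> d" using p by simp
  qed
  have inj: "j = k" if "p j = p k" "j \<in> X'" "k \<le> n" for j k
    using p(4) pU'(1)[OF that(2)] that X'n by (auto simp: assigns_def)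
  have way_nm: "way' j \<in> X' \<and> nm j = c (p (way' j)) j - u (p (way' j)) - v j \<and>
      (\<forall>k\<in>X'. nm j \<le> c (p k) j - u (p k) - v j)" if j: "j \<in> {1..n} - X'" for j
  proof (cases "j0 = 0")
    case True
    then have "X = {}" using t by simp
    then show ?thesis using True way'[OF j] nm[of j] cur[of j] X' by simp
  next
    case False
    then have "X \<noteq> {}" using t by simp
    moreover have "j \<in> {1..n} - X" using j X' by simp
    ultimately have m: "way j \<in> X" "minv j = c (p (way j)) j - u (p (way j)) - v j"
      "\<forall>k\<in>X. minv j \<le> c (p k) j - u (p k) - v j" using mv by blast+
    show ?thesis
    proof (cases "cur j < minv j")
      case True
      then have "\<forall>k\<in>X. cur j \<le> c (p k) j - u (p k) - v j" using m(3) by force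
      then show ?thesis using True False way'[OF j] nm[of j] cur[of j] X' by simp
    next
      case cur': False
      then show ?thesis using False way'[OF j] nm[of j] cur[of j] X' m by simp
    qed
  qed
  have delta: "0 \<le> nm j1"
  proof -
    have "way' j1 \<in> X'" "nm j1 = c (p (way' j1)) j1 - u (p (way' j1)) - v j1" using way_nm[OF j1(1)] by auto
    then show ?thesis using feas[of "p (way' j1)" j1] pU'[of "way' j1"] j1(1) by auto
  qed
  have u'X: "u' (p k) = u (p k) + nm j1" if "k \<in> X'" for k using u' that by simp
  have pots': "potentials d n c i p u' v' UNIV"
    unfolding potentials_def
  proof (intro conjI ballI allI impI)
    fix r j assume r: "r \<in> {1..d}" and j: "j \<in> {1..n}"
    show "u' r + v' j \<le> c r j"
    proof (cases "j \<in> X'")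
      case True
      then show ?thesis using feas[of r j] r j v'[of j] u'[of r] delta by auto
    next
      case False
      show ?thesis
      proof (cases "r \<in> p ` X'")
        case True
        then obtain k where k: "k \<in> X'" "r = p k" by blast
        have "nm j1 \<le> c (p k) j - u (p k) - v j" using way_nm[of j] j1(2)[of j] j False k(1) by force
        then show ?thesis using False k j v'[of j] u'X[OF k(1)] by simp
      next
        case False': False
        then show ?thesis using False feas[of r j] r j v'[of j] u'[of r] by simp
      qed
    qed
  next
    fix j assume j: "j \<in> {1..n}"
    moreover have "v j \<le> 0" using j pot unfolding potentials_def by blast
    ultimately show "v' j \<le> 0" using v'[of j] delta by auto
  next
    fix j assume j: "j \<in> {1..n} \<inter> UNIV"
    then have old: "if p j = 0 then v j = 0 else u (p j) + v j = c (p j) j" using pot by (auto simp: potentials_def)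
    show "if p j = 0 then v' j = 0 else u' (p j) + v' j = c (p j) j"
    proof (cases "j \<in> X'")
      case True
      then show ?thesis using old pU'(1)[OF True] v'[of j] u'X[OF True] j by auto
    next
      case False
      \<comment> \<open>By injectivity, the row of a column outside the tree is not a tree row, so
        neither end of its tight edge is shifted.\<close>
      have "p j \<notin> p ` X'" if "p j \<noteq> 0" using inj[of _ j] False j by auto
      then show ?thesis using old False v'[of j] u'[of "p j"] j by auto
    qed
  next
    fix r assume r: "i < r" "r \<le> d"
    then have "r \<notin> p ` X'" using pU'(2) by fastforce
    then show "u' r = 0" using u'[of r] pot r by (auto simp: potentials_def)
  qed
  have minv'': "way' j \<in> X' \<and> minv' j = c (p (way' j)) j - u' (p (way' j)) - v' j \<and>
        (\<forall>k\<in>X'. minv' j \<le> c (p k) j - u' (p k) - v' j)" if j: "j \<in> {1..n} - X'" for j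
    using way_nm[OF j] minv'[OF j] v'[of j] u'X j by auto
  have card: "card X' = Suc (card X)" using X' t finU by simp
  have rk_lt: "rk j < card X'" if "j \<in> X'" for j using that rk X' card by force
  have alternating_tree': "way' j \<in> X' \<and> (rk(j1 := card X')) (way' j) < (rk(j1 := card X')) j \<and> u' (p (way' j)) + v' j = c (p (way' j)) j"
    if "j \<in> insert j1 X' - {0}" for j
  proof (cases "j = j1")
    case True
    then show ?thesis using minv''[OF j1(1)] minv'[OF j1(1)] rk_lt[of "way' j1"] j1(1) by auto
  next
    case False
    then have j: "j \<in> X'" "j \<noteq> 0" using that by auto
    then have "way j \<in> X" "rk (way j) < rk j" "u (p (way j)) + v j = c (p (way j)) j" using tr X' by auto
    then show ?thesis using way'X[OF j(1)] False j1(1) u'X[of "way j"] v'[of j] j X' X'n by auto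
  qed
  show ?thesis
    unfolding alternating_tree_def
  proof (intro conjI)
    show "X' \<noteq> {} \<longrightarrow> 0 \<in> X'" using t X' by auto
    show "\<forall>j\<in>X'. p j \<noteq> 0" using pU'(1) by force
    show "X' = {} \<longleftrightarrow> j1 = 0" using j1 X' by auto
    show "\<forall>j\<in>insert j1 X' - {0}. way' j \<in> X' \<and> (rk(j1 := card X')) (way' j) < (rk(j1 := card X')) j \<and> u' (p (way' j)) + v' j = c (p (way' j)) j"
      using alternating_tree' by blast
    show "\<forall>j\<in>X'. (rk(j1 := card X')) j < card X'" using rk_lt j1 by auto
    show "\<forall>j\<in>{1..n} - X'. X' \<noteq> {} \<longrightarrow> way' j \<in> X' \<and> minv' j = c (p (way' j)) j - u' (p (way' j)) - v' j \<and>
        (\<forall>k\<in>X'. minv' j \<le> c (p k) j - u' (p k) - v' j)" using minv'' by blast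
  qed (use X'n j1 pots' in auto)
qed

text \<open>Column 0 holds row \<open>i\<close>, so the other tree columns hold distinct rows below
  \<open>i\<close>. There are fewer than \<open>n\<close> of these, and the search always finds
  another column.\<close>

lemma tree_unused_column:
  assumes p: "p 0 = i" "1 \<le> i" "i \<le> n" "assigns i p {..n}"
    and X: "X \<subseteq> {..n}" "\<And>j. j \<in> X \<Longrightarrow> p j \<noteq> 0"
  shows "{1..n} - X \<noteq> {}"
proof
  assume "{1..n} - X = {}"
  then have sub: "{1..n} \<subseteq> X" by blast
  have "inj_on p {1..n}" using p(4) X(2) sub by (auto simp: assigns_def inj_on_def)
  moreover have "p ` {1..n} \<subseteq> {1..<i}"
  proof
    fix r assume "r \<in> p ` {1..n}"
    then obtain j where j: "1 \<le> j" "j \<le> n" "r = p j" by auto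
    then have "p j \<noteq> 0" using X(2) sub by auto
    moreover have "p j \<le> i" using p(4) j by (auto simp: assigns_def)
    moreover have "p j \<noteq> i" using assigns_inj[OF p(4), of j 0] p(1,2) j by auto
    ultimately show "r \<in> {1..<i}" using j by auto
  qed
  ultimately have "card {1..n} \<le> card {1..<i}" by (intro card_inj_on_le) auto
  then show False using p by simp
qed

text \<open>\<open>P\<close> is the assignment at the end of the search, to which tightness of the
  tree edges refers; \<open>p\<close> is the current one. The column \<open>j0\<close> is open, so
  slackness and assignment are claimed only elsewhere. Since \<open>way\<close> lowers the rank, the
  columns still to be visited have not been overwritten.\<close>

definition augmenting :: "nat \<Rightarrow> nat \<Rightarrow> (nat \<Rightarrow> nat \<Rightarrow> real) \<Rightarrow> nat \<Rightarrow> (nat \<Rightarrow> nat) \<Rightarrow> nat set \<Rightarrow> nat \<Rightarrow>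
    (nat \<Rightarrow> real) \<Rightarrow> (nat \<Rightarrow> real) \<Rightarrow> (nat \<Rightarrow> nat) \<Rightarrow> (nat \<Rightarrow> nat) \<Rightarrow> (nat \<Rightarrow> nat) \<Rightarrow> bool" where
  "augmenting d n c i P X j0 u v way rk p \<longleftrightarrow> X \<subseteq> {..n} \<and> 0 \<in> X \<and> j0 \<le> n \<and>
     (\<forall>j\<in>X. P j \<noteq> 0) \<and>
     (j0 \<noteq> 0 \<longrightarrow> way j0 \<in> X \<and> rk (way j0) < rk j0 \<and> u (P (way j0)) + v j0 = c (P (way j0)) j0) \<and>
     (\<forall>j\<in>X - {0}. way j \<in> X \<and> rk (way j) < rk j \<and> u (P (way j)) + v j = c (P (way j)) j) \<and>
     potentials d n c i p u v (- {j0}) \<and> assigns i p ({..n} - {j0}) \<and>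
     (\<forall>j\<in>X. rk j < rk j0 \<longrightarrow> p j = P j)"

lemma augmenting_init:
  assumes "alternating_tree d n c i p X j0 u v minv way rk" "assigns i p {..n}" "p j0 = 0" "p 0 = i" "1 \<le> i"
  shows "augmenting d n c i p X j0 u v way rk p"
proof -
  have "j0 \<noteq> 0" using assms(3-5) by (cases "j0 = 0") auto
  then have "X \<noteq> {}" using assms(1) by (simp add: alternating_tree_def)
  have "assigns i p ({..n} - {j0})" unfolding assigns_def
  proof (intro conjI ballI)
    fix r assume "r \<in> {1..i}"
    then obtain j where "j \<in> {..n}" "p j = r" using assigns_surj[OF assms(2)] by blast
    moreover have "j \<noteq> j0" using \<open>r \<in> {1..i}\<close> \<open>p j = r\<close> assms(3) by auto
    ultimately show "\<exists>j\<in>{..n} - {j0}. p j = r" by blast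
  qed (use assms(2) in \<open>auto simp: assigns_def\<close>)
  then show ?thesis
    using assms(1) \<open>j0 \<noteq> 0\<close> \<open>X \<noteq> {}\<close> unfolding augmenting_def alternating_tree_def by (auto simp: potentials_def)
qed

text \<open>The row of \<open>way j0\<close> moves to \<open>j0\<close> along a tight edge. This
  closes \<open>j0\<close> and opens \<open>way j0\<close>, which has smaller rank.\<close>

lemma augmenting_step:
  assumes aug: "augmenting d n c i P X j0 u v way rk p" and "j0 \<noteq> 0"
    and p': "\<And>j. p' j = (if j = j0 then p (way j0) else p j)"
  shows "augmenting d n c i P X (way j0) u v way rk p' \<and> rk (way j0) < rk j0"
proof -
  let ?k = "way j0"
  have X: "X \<subseteq> {..n}" "0 \<in> X" "j0 \<le> n" and PU: "\<forall>j\<in>X. P j \<noteq> 0"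
    and k: "?k \<in> X" "rk ?k < rk j0" "u (P ?k) + v j0 = c (P ?k) j0"
    and tr: "\<forall>j\<in>X - {0}. way j \<in> X \<and> rk (way j) < rk j \<and> u (P (way j)) + v j = c (P (way j)) j"
    and pot: "potentials d n c i p u v (- {j0})" and as: "assigns i p ({..n} - {j0})"
    and old: "\<forall>j\<in>X. rk j < rk j0 \<longrightarrow> p j = P j"
    using aug \<open>j0 \<noteq> 0\<close> unfolding augmenting_def by (elim conjE; blast)+
  have ne: "?k \<noteq> j0" using k(2) by auto
  have kn: "?k \<in> {..n} - {j0}" using X k ne by auto
  have pk: "p ?k = P ?k" "p ?k \<noteq> 0" using old k PU by auto
  have "assigns i p' ({..n} - {?k})"
    unfolding assigns_def
  proof (intro conjI ballI impI)
    fix j assume j: "j \<in> {..n} - {?k}"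
    then show "p' j \<le> i" using as kn p' by (auto simp: assigns_def)
    fix l assume l: "l \<in> {..n} - {?k}" and eq: "p' j = p' l" "p' j \<noteq> 0"
    have *: "a = b" if "a \<in> {..n} - {j0}" "b \<in> {..n} - {j0}" "p a = p b" "p a \<noteq> 0" for a b
      using as that unfolding assigns_def by blast
    show "j = l"
    proof (cases "j = j0"; cases "l = j0")
      assume "j = j0" "l \<noteq> j0"
      then show ?thesis using *[of ?k l] kn l eq p' by auto
    next
      assume "j \<noteq> j0" "l = j0"
      then show ?thesis using *[of j ?k] kn j eq p' by auto
    next
      assume "j \<noteq> j0" "l \<noteq> j0"
      then show ?thesis using *[of j l] j l eq p' by auto
    qed simp
  next
    fix r assume "r \<in> {1..i}"
    then obtain j where j: "j \<in> {..n} - {j0}" "p j = r" using assigns_surj[OF as] by blast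
    show "\<exists>j\<in>{..n} - {?k}. p' j = r"
    proof (cases "j = ?k")
      case True
      then show ?thesis using j p' X ne by (intro bexI[of _ j0]) auto
    next
      case False
      then show ?thesis using j p' by (intro bexI[of _ j]) auto
    qed
  qed
  moreover have "potentials d n c i p' u v (- {?k})"
    using pot pk k(3) unfolding potentials_def p' by auto
  moreover have "\<forall>j\<in>X. rk j < rk ?k \<longrightarrow> p' j = P j" using old k(2) p' by auto
  ultimately show ?thesis using X PU k tr unfolding augmenting_def by auto
qed

section \<open>Execution of the Hungarian algorithm\<close>

text \<open>Index 0 replaces infinite initial values: \<open>j0 = 0\<close> identifies the first
  round of an insertion, when \<open>minv\<close> holds no valid entries, and \<open>j1 = 0\<close>
  means that no candidate has been met. The assumption \<open>ex\<close> guarantees that the loop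
  ends with a genuine column in \<open>j1\<close>.\<close>

lemma runs_scan:
  fixes s :: state
  defines "used \<equiv> fst s ''used'' 0" and "j0 \<equiv> fst s ''j0'' 0 0"
    and "minv \<equiv> snd s ''minv'' 0" and "way \<equiv> fst s ''way'' 0"
  assumes n: "fst s ''n'' 0 0 = n" and j1: "fst s ''j1'' 0 0 = 0"
    and cur: "\<And>j. cur j = snd s ''c'' (fst s ''i0'' 0 0) j - snd s ''u'' 0 (fst s ''i0'' 0 0) - snd s ''v'' 0 j"
    and nm: "\<And>j. nm j = (if j0 = 0 \<or> cur j < minv j then cur j else minv j)"
    and nw: "\<And>j. nw j = (if j0 = 0 \<or> cur j < minv j then j0 else way j)"
    and ex: "\<exists>j\<in>{1..n}. used j = 0"
  shows "runs hungarian_scan s (200 * (n + 1)) (\<lambda>s'.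
     (\<forall>j. snd s' ''minv'' 0 j = (if used j = 0 \<and> 1 \<le> j \<and> j \<le> n then nm j else minv j)) \<and>
     (\<forall>j. fst s' ''way'' 0 j = (if used j = 0 \<and> 1 \<le> j \<and> j \<le> n then nw j else way j)) \<and>
     (let j1 = fst s' ''j1'' 0 0 in 1 \<le> j1 \<and> j1 \<le> n \<and> used j1 = 0 \<and> snd s' ''delta'' 0 0 = nm j1 \<and>
        (\<forall>j. 1 \<le> j \<and> j \<le> n \<and> used j = 0 \<longrightarrow> nm j1 \<le> nm j)))"
  (is "runs _ _ _ ?Q")
proof -
  let ?body = "Cond (NEq (nvec ''used'' (nsc ''j'')) (NConst 0))
        (set_rsc ''cur'' (RSub (RSub (RVar ''c'' (nsc ''i0'') (nsc ''j''))
                                     (rvec ''u'' (nsc ''i0''))) (rvec ''v'' (nsc ''j''))) ;;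
         Cond (Disj (NEq (nsc ''j0'') (NConst 0)) (RLess (rsc ''cur'') (rvec ''minv'' (nsc ''j''))))
           (set_rvec ''minv'' (nsc ''j'') (rsc ''cur'') ;;
            set_nvec ''way'' (nsc ''j'') (nsc ''j0''))
           Skip ;;
         Cond (Disj (NEq (nsc ''j1'') (NConst 0)) (RLess (rvec ''minv'' (nsc ''j'')) (rsc ''delta'')))
           (set_rsc ''delta'' (rvec ''minv'' (nsc ''j'')) ;;
            set_nsc ''j1'' (nsc ''j''))
           Skip)
        Skip"
  let ?P = "\<lambda>k s'.
     (\<forall>j. snd s' ''minv'' 0 j = (if used j = 0 \<and> 1 \<le> j \<and> j < k then nm j else minv j)) \<and>
     (\<forall>j. fst s' ''way'' 0 j = (if used j = 0 \<and> 1 \<le> j \<and> j < k then nw j else way j)) \<and>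
     (let j1 = fst s' ''j1'' 0 0 in
        if j1 = 0 then \<forall>j. 1 \<le> j \<and> j < k \<longrightarrow> used j \<noteq> 0
        else j1 < k \<and> used j1 = 0 \<and> snd s' ''delta'' 0 0 = nm j1 \<and> (\<forall>j. 1 \<le> j \<and> j < k \<and> used j = 0 \<longrightarrow> nm j1 \<le> nm j))"
  show ?thesis
    unfolding hungarian_scan_def
  proof (rule runs_For[where lo = 1 and hi = "Suc n" and P = ?P and K = 150])
    show "?P 1 (set_index ''j'' 1 s)" using j1 by (simp add: minv_def way_def)
  next
    fix k and s' :: state
    assume k: "1 \<le> k" "k < Suc n" and P: "?P k s'" and j: "fst s' ''j'' 0 0 = k"
      and ag: "agree (For ''j'' (NConst 1) (nsuc (nsc ''n'')) ?body) s s'"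
    have same: "fst s' ''used'' = fst s ''used''" "fst s' ''j0'' = fst s ''j0''" "fst s' ''i0'' = fst s ''i0''"
      "snd s' ''c'' = snd s ''c''" "snd s' ''u'' = snd s ''u''" "snd s' ''v'' = snd s ''v''"
      by (auto intro!: agreeN[OF ag] agreeR[OF ag] simp: For_def)
    have u: "fst s' ''used'' 0 k = used k" and jj: "fst s' ''j0'' 0 0 = j0" by (simp_all add: same used_def j0_def)
    have c: "snd s' ''c'' (fst s' ''i0'' 0 0) k - snd s' ''u'' 0 (fst s' ''i0'' 0 0) - snd s' ''v'' 0 k = cur k"
      by (simp add: same cur)
    have m: "snd s' ''minv'' 0 k = minv k" "fst s' ''way'' 0 k = way k" using P by simp_all
    show "runs ?body s' 150 (\<lambda>s'. fst s' ''j'' 0 0 = k \<and> ?P (Suc k) (set_index ''j'' (Suc k) s'))"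
    proof (rule runs_straight)
      show "fst (eff ?body s') ''j'' 0 0 = k \<and> ?P (Suc k) (set_index ''j'' (Suc k) (eff ?body s'))"
      proof (cases "used k = 0")
        case False
        then have "eff ?body s' = s'" by (simp add: j u)
        then show ?thesis using P j False by (auto simp: less_Suc_eq Let_def)
      next
        case True
        define b where "b \<longleftrightarrow> j0 = 0 \<or> cur k < minv k"
        define b' where "b' \<longleftrightarrow> fst s' ''j1'' 0 0 = 0 \<or> nm k < snd s' ''delta'' 0 0"
        have e: "fst (eff ?body s') ''j'' 0 0 = k \<and>
           snd (eff ?body s') ''minv'' 0 l = (if l = k then nm k else snd s' ''minv'' 0 l) \<and>
           fst (eff ?body s') ''way'' 0 l = (if l = k then nw k else fst s' ''way'' 0 l) \<and>
           fst (eff ?body s') ''j1'' 0 0 = (if b' then k else fst s' ''j1'' 0 0) \<and>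
           snd (eff ?body s') ''delta'' 0 0 = (if b' then nm k else snd s' ''delta'' 0 0)" for l
          using True by (simp add: j u jj c m upd_cell_apply b'_def nm[of k] nw[of k])
        have P1: "snd s' ''minv'' 0 j = (if used j = 0 \<and> 1 \<le> j \<and> j < k then nm j else minv j)"
          "fst s' ''way'' 0 j = (if used j = 0 \<and> 1 \<le> j \<and> j < k then nw j else way j)" for j
          using P by blast+
        have P2: "if fst s' ''j1'' 0 0 = 0 then \<forall>j. 1 \<le> j \<and> j < k \<longrightarrow> used j \<noteq> 0
          else fst s' ''j1'' 0 0 < k \<and> used (fst s' ''j1'' 0 0) = 0 \<and> snd s' ''delta'' 0 0 = nm (fst s' ''j1'' 0 0) \<and>
            (\<forall>j. 1 \<le> j \<and> j < k \<and> used j = 0 \<longrightarrow> nm (fst s' ''j1'' 0 0) \<le> nm j)"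
          using P unfolding Let_def by blast
        have "snd (eff ?body s') ''minv'' 0 j = (if used j = 0 \<and> 1 \<le> j \<and> j < Suc k then nm j else minv j)"
          "fst (eff ?body s') ''way'' 0 j = (if used j = 0 \<and> 1 \<le> j \<and> j < Suc k then nw j else way j)" for j
          using e[of j] P1[of j] True k(1) by (auto simp: less_Suc_eq simp del: eff.simps)
        moreover have "if fst (eff ?body s') ''j1'' 0 0 = 0 then \<forall>j. 1 \<le> j \<and> j < Suc k \<longrightarrow> used j \<noteq> 0
          else fst (eff ?body s') ''j1'' 0 0 < Suc k \<and> used (fst (eff ?body s') ''j1'' 0 0) = 0 \<and>
            snd (eff ?body s') ''delta'' 0 0 = nm (fst (eff ?body s') ''j1'' 0 0) \<and>
            (\<forall>j. 1 \<le> j \<and> j < Suc k \<and> used j = 0 \<longrightarrow> nm (fst (eff ?body s') ''j1'' 0 0) \<le> nm j)"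
        proof (cases b')
          case True': True
          then have j1': "fst (eff ?body s') ''j1'' 0 0 = k" and delta': "snd (eff ?body s') ''delta'' 0 0 = nm k"
            using e by (simp_all del: eff.simps)
          have "nm k \<le> nm j" if "1 \<le> j" "j < Suc k" "used j = 0" for j
          proof (cases "j = k")
            case False
            then have j: "j < k" using that by simp
            then have "fst s' ''j1'' 0 0 \<noteq> 0" using P2 that by (auto split: if_splits)
            then have "nm k < nm (fst s' ''j1'' 0 0)" "nm (fst s' ''j1'' 0 0) \<le> nm j"
              using P2 True' j that by (auto simp: b'_def)
            then show ?thesis by simp
          qed simp
          then show ?thesis unfolding j1' delta' using k(1) True by simp
        next
          case False
          then have j1': "fst (eff ?body s') ''j1'' 0 0 = fst s' ''j1'' 0 0" "snd (eff ?body s') ''delta'' 0 0 = snd s' ''delta'' 0 0"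
            using e by (simp_all del: eff.simps)
          have nz: "fst s' ''j1'' 0 0 \<noteq> 0" "nm (fst s' ''j1'' 0 0) \<le> nm k" using False P2 by (auto simp: b'_def)
          then show ?thesis unfolding j1' using P2 by (auto simp: less_Suc_eq)
        qed
        moreover have "fst (set_index ''j'' (Suc k) x) ''way'' = fst x ''way''"
          "fst (set_index ''j'' (Suc k) x) ''j1'' = fst x ''j1''" for x by (auto intro!: ext)
        ultimately show ?thesis using e unfolding Let_def set_index_simps(2) by (simp only: simp_thms)
      qed
    qed simp_all
  next
    fix s' :: state assume P: "?P (Suc n) s'"
    then have "fst s' ''j1'' 0 0 \<noteq> 0" using ex by (auto simp: Let_def less_Suc_eq_le split: if_splits)
    then show "?Q s'" using P by (auto simp: Let_def less_Suc_eq_le)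
  next
    fix s' :: state assume "agree (For ''j'' (NConst 1) (nsuc (nsc ''n'')) ?body) s s'"
    from agreeN[OF this, of "''n''"] show "nval s' (nsuc (nsc ''n'')) = Suc n" by (simp add: For_def n)
  qed (use n in simp_all)
qed

text \<open>The loop runs over columns but changes \<open>u\<close> at the rows they carry.
  Injectivity of \<open>p\<close> on the marked columns ensures that each tree row is raised exactly
  once.\<close>

lemma runs_update:
  fixes s :: state
  defines "used \<equiv> fst s ''used'' 0" and "p \<equiv> fst s ''p'' 0" and "delta \<equiv> snd s ''delta'' 0 0"
  assumes n: "fst s ''n'' 0 0 = n"
    and inj: "\<And>j k. j \<le> n \<Longrightarrow> k \<le> n \<Longrightarrow> used j = 1 \<Longrightarrow> used k = 1 \<Longrightarrow> p j = p k \<Longrightarrow> j = k"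
  shows "runs hungarian_update s (150 * (n + 1)) (\<lambda>s'.
     (\<forall>r. snd s' ''u'' 0 r = snd s ''u'' 0 r + (if r \<in> p ` {j. used j = 1 \<and> j \<le> n} then delta else 0)) \<and>
     (\<forall>j. snd s' ''v'' 0 j = snd s ''v'' 0 j - (if used j = 1 \<and> j \<le> n then delta else 0)) \<and>
     (\<forall>j. snd s' ''minv'' 0 j = snd s ''minv'' 0 j - (if used j \<noteq> 1 \<and> j \<le> n then delta else 0)))"
  (is "runs _ _ _ ?Q")
proof -
  let ?P = "\<lambda>k s'.
     (\<forall>r. snd s' ''u'' 0 r = snd s ''u'' 0 r + (if r \<in> p ` {j. used j = 1 \<and> j < k} then delta else 0)) \<and>
     (\<forall>j. snd s' ''v'' 0 j = snd s ''v'' 0 j - (if used j = 1 \<and> j < k then delta else 0)) \<and>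
     (\<forall>j. snd s' ''minv'' 0 j = snd s ''minv'' 0 j - (if used j \<noteq> 1 \<and> j < k then delta else 0))"
  let ?body = "Cond (NEq (nvec ''used'' (nsc ''j'')) (NConst 1))
      (set_rvec ''u'' (nvec ''p'' (nsc ''j''))
      (RAdd (rvec ''u'' (nvec ''p'' (nsc ''j''))) (rsc ''delta'')) ;;
      set_rvec ''v'' (nsc ''j'') (RSub (rvec ''v'' (nsc ''j'')) (rsc ''delta'')))
      (set_rvec ''minv'' (nsc ''j'') (RSub (rvec ''minv'' (nsc ''j'')) (rsc ''delta'')))"
  show ?thesis
    unfolding hungarian_update_def
  proof (rule runs_For[where lo = 0 and hi = "Suc n" and P = ?P and K = 100], goal_cases)
    case (4 s')
    from agreeN[OF this, of "''n''"] show ?case by (simp add: For_def n)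
  next
    case (5 k s')
    note ag = 5(5)
    have same: "fst s' ''used'' = fst s ''used''" "fst s' ''p'' = fst s ''p''" "snd s' ''delta'' = snd s ''delta''"
      by (auto intro!: agreeN[OF ag] agreeR[OF ag] simp: For_def)
    have f: "fst s' ''used'' 0 k = used k" "fst s' ''p'' 0 k = p k" "snd s' ''delta'' 0 0 = delta" "fst s' ''j'' 0 0 = k"
      using 5(4) by (simp_all add: same used_def p_def delta_def)
    have P: "?P k s'" by (rule 5(3))
    show ?case
    proof (rule runs_straight)
      show "fst (eff ?body s') ''j'' 0 0 = k \<and>
        ?P (Suc k) (set_index ''j'' (Suc k) (eff ?body s'))"
      proof (cases "used k = 1")
        case True
        have "p k \<notin> p ` {j. used j = 1 \<and> j < k}"
        proof
          assume "p k \<in> p ` {j. used j = 1 \<and> j < k}"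
          then obtain l where "used l = 1" "l < k" "p l = p k" by auto
          then show False using inj[of l k] True 5(2) by simp
        qed
        moreover have "r \<in> p ` {j. used j = 1 \<and> j < Suc k} \<longleftrightarrow> r = p k \<or> r \<in> p ` {j. used j = 1 \<and> j < k}" for r
          using True by (auto simp: less_Suc_eq)
        ultimately show ?thesis using P True by (simp add: f upd_cell_apply less_Suc_eq)
      next
        case False
        have "p ` {j. used j = 1 \<and> j < Suc k} = p ` {j. used j = 1 \<and> j < k}"
          using False by (auto simp: less_Suc_eq)
        moreover have "used j = 1 \<and> j < Suc k \<longleftrightarrow> used j = 1 \<and> j < k"
          "used j \<noteq> 1 \<and> j < Suc k \<longleftrightarrow> j = k \<or> used j \<noteq> 1 \<and> j < k" for j
          using False by (auto simp: less_Suc_eq)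
        ultimately show ?thesis using P False by (simp add: f upd_cell_apply)
      qed
    qed simp_all
  next
    case (6 s')
    show ?case using 6(1) unfolding less_Suc_eq_le .
  qed (use n in simp_all)
qed

lemma runs_straight_Seq:
  "straight c1 \<Longrightarrow> runs c2 (eff c1 s) T Q \<Longrightarrow> runs (c1 ;; c2) s (ccost c1 + T) Q"
  by (rule runs_Seq[where R = "\<lambda>s'. s' = eff c1 s" and ?T1.0 = "ccost c1"]) (auto intro: runs_straight)

section \<open>Search for an augmenting path and augmentation\<close>

definition used_columns :: "nat \<Rightarrow> state \<Rightarrow> nat set" where
  "used_columns n s = {j. fst s ''used'' 0 j = 1 \<and> j \<le> n}"

text \<open>The ranks belong to the proof and not to the program state, hence the existential
  quantifier.\<close>

definition search_invariant :: "nat \<Rightarrow> nat \<Rightarrow> (nat \<Rightarrow> nat \<Rightarrow> real) \<Rightarrow> nat \<Rightarrow> (nat \<Rightarrow> nat) \<Rightarrow> state \<Rightarrow> bool" where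
  "search_invariant d n c i p s \<longleftrightarrow> fst s ''p'' 0 = p \<and> fst s ''n'' 0 0 = n \<and> snd s ''c'' = c \<and>
     (\<forall>j\<le>n. fst s ''used'' 0 j = 0 \<or> fst s ''used'' 0 j = 1) \<and>
     (\<exists>rk. alternating_tree d n c i p (used_columns n s) (fst s ''j0'' 0 0)
        (snd s ''u'' 0) (snd s ''v'' 0) (snd s ''minv'' 0) (fst s ''way'' 0) rk)"

definition search_step :: com where
  "search_step =
    (set_nvec ''used'' (nsc ''j0'') (NConst 1) ;;
     set_nsc ''i0'' (nvec ''p'' (nsc ''j0'')) ;;
     set_nsc ''j1'' (NConst 0) ;;
     hungarian_scan ;;
     hungarian_update ;;
     set_nsc ''j0'' (nsc ''j1''))"

lemma hungarian_mods:
  "nmods hungarian_scan = {''j'', ''way'', ''j1''}" "rmods hungarian_scan = {''cur'', ''minv'', ''delta''}"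
  "nmods hungarian_update = {''j''}" "rmods hungarian_update = {''u'', ''v'', ''minv''}"
  by (auto simp: hungarian_scan_def hungarian_update_def For_def)

lemma runs_search_step:
  assumes p: "p 0 = i" "1 \<le> i" "i \<le> d" "d \<le> n" "assigns i p {..n}"
    and inv: "search_invariant d n c i p s" and nz: "p (fst s ''j0'' 0 0) \<noteq> 0"
  shows "runs search_step s (400 * (n + 1)) (\<lambda>s'. search_invariant d n c i p s' \<and>
     card (used_columns n s') = Suc (card (used_columns n s)))"
proof -
  let ?Q = "\<lambda>s'. search_invariant d n c i p s' \<and> card (used_columns n s') = Suc (card (used_columns n s))"
  define j0 where "j0 = fst s ''j0'' 0 0"
  define u where "u = snd s ''u'' 0"
  define v where "v = snd s ''v'' 0"
  define minv where "minv = snd s ''minv'' 0"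
  define way where "way = fst s ''way'' 0"
  define X where "X = used_columns n s"
  define X' where "X' = insert j0 X"
  define cur where "cur j = c (p j0) j - u (p j0) - v j" for j
  define nm where "nm j = (if j0 = 0 \<or> cur j < minv j then cur j else minv j)" for j
  define nw where "nw j = (if j0 = 0 \<or> cur j < minv j then j0 else way j)" for j
  obtain rk where tree: "alternating_tree d n c i p X j0 u v minv way rk"
    using inv by (auto simp: search_invariant_def j0_def u_def v_def minv_def way_def X_def)
  have s: "fst s ''p'' 0 = p" "fst s ''n'' 0 0 = n" "snd s ''c'' = c"
    and used01: "\<And>j. j \<le> n \<Longrightarrow> fst s ''used'' 0 j = 0 \<or> fst s ''used'' 0 j = 1"
    using inv by (auto simp: search_invariant_def)
  have t: "X \<subseteq> {..n}" "j0 \<le> n" "j0 \<notin> X" "\<forall>j\<in>X. p j \<noteq> 0"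
    using tree unfolding alternating_tree_def by - (elim conjE, assumption)+
  have pX': "p j \<noteq> 0" if "j \<in> X'" for j
    using t nz that by (auto simp: X'_def j0_def)
  have X'n: "X' \<subseteq> {..n}" using t by (auto simp: X'_def)
  define s1 where "s1 = eff (set_nsc ''j1'' (NConst 0)) (eff (set_nsc ''i0'' (nvec ''p'' (nsc ''j0'')))
    (eff (set_nvec ''used'' (nsc ''j0'') (NConst 1)) s))"
  have s1: "fst s1 ''p'' 0 = p" "fst s1 ''n'' 0 0 = n" "snd s1 ''c'' = c" "snd s1 ''u'' 0 = u" "snd s1 ''v'' 0 = v"
    "snd s1 ''minv'' 0 = minv" "fst s1 ''way'' 0 = way" "fst s1 ''j0'' 0 0 = j0" "fst s1 ''i0'' 0 0 = p j0" "fst s1 ''j1'' 0 0 = 0"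
    "\<And>j. fst s1 ''used'' 0 j = (if j = j0 then 1 else fst s ''used'' 0 j)"
    by (auto simp: s1_def s u_def v_def minv_def way_def j0_def upd_cell_apply intro!: ext)
  have usedX': "fst s1 ''used'' 0 j = 1 \<longleftrightarrow> j \<in> X'" "fst s1 ''used'' 0 j = 0 \<longleftrightarrow> j \<notin> X'" if "j \<le> n" for j
    using that used01[OF that] by (auto simp: s1 X'_def X_def used_columns_def)
  then have X'eq: "{j. fst s1 ''used'' 0 j = 1 \<and> j \<le> n} = X'" using X'n by auto
  have "{1..n} - X' \<noteq> {}"
    by (rule tree_unused_column[of p i]) (use p X'n pX' in auto)
  then have ex: "\<exists>j\<in>{1..n}. fst s1 ''used'' 0 j = 0" using usedX' by auto
  let ?scanned = "\<lambda>s2 :: state.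
     ((\<forall>j. snd s2 ''minv'' 0 j = (if fst s1 ''used'' 0 j = 0 \<and> 1 \<le> j \<and> j \<le> n then nm j else snd s1 ''minv'' 0 j)) \<and>
     (\<forall>j. fst s2 ''way'' 0 j = (if fst s1 ''used'' 0 j = 0 \<and> 1 \<le> j \<and> j \<le> n then nw j else fst s1 ''way'' 0 j)) \<and>
     (let j1 = fst s2 ''j1'' 0 0 in 1 \<le> j1 \<and> j1 \<le> n \<and> fst s1 ''used'' 0 j1 = 0 \<and> snd s2 ''delta'' 0 0 = nm j1 \<and>
     (\<forall>j. 1 \<le> j \<and> j \<le> n \<and> fst s1 ''used'' 0 j = 0 \<longrightarrow> nm j1 \<le> nm j))) \<and> agree hungarian_scan s1 s2"
  let ?updated = "\<lambda>(s2 :: state) (s3 :: state).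
     ((\<forall>r. snd s3 ''u'' 0 r = snd s2 ''u'' 0 r + (if r \<in> fst s2 ''p'' 0 ` {j. fst s2 ''used'' 0 j = 1 \<and> j \<le> n} then snd s2 ''delta'' 0 0 else 0)) \<and>
     (\<forall>j. snd s3 ''v'' 0 j = snd s2 ''v'' 0 j - (if fst s2 ''used'' 0 j = 1 \<and> j \<le> n then snd s2 ''delta'' 0 0 else 0)) \<and>
     (\<forall>j. snd s3 ''minv'' 0 j = snd s2 ''minv'' 0 j - (if fst s2 ''used'' 0 j \<noteq> 1 \<and> j \<le> n then snd s2 ''delta'' 0 0 else 0))) \<and>
     agree hungarian_update s2 s3"
  have main: "runs (hungarian_scan ;; hungarian_update ;; set_nsc ''j0'' (nsc ''j1'')) s1 (200 * (n + 1) + (150 * (n + 1) + 6)) ?Q"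
  proof (rule runs_Seq)
    show "runs hungarian_scan s1 (200 * (n + 1)) ?scanned"
      by (rule runs_agree[OF runs_scan[where cur = cur, OF _ _ _ _ _ ex]]) (simp_all only: s1(1-10) cur_def nm_def nw_def)
    fix s2 :: state
    assume "?scanned s2"
    then have mw: "\<And>j. snd s2 ''minv'' 0 j = (if fst s1 ''used'' 0 j = 0 \<and> 1 \<le> j \<and> j \<le> n then nm j else snd s1 ''minv'' 0 j)"
      "\<And>j. fst s2 ''way'' 0 j = (if fst s1 ''used'' 0 j = 0 \<and> 1 \<le> j \<and> j \<le> n then nw j else fst s1 ''way'' 0 j)"
      and j1': "1 \<le> fst s2 ''j1'' 0 0" "fst s2 ''j1'' 0 0 \<le> n" "fst s1 ''used'' 0 (fst s2 ''j1'' 0 0) = 0"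
        "snd s2 ''delta'' 0 0 = nm (fst s2 ''j1'' 0 0)"
        "\<And>j. 1 \<le> j \<Longrightarrow> j \<le> n \<Longrightarrow> fst s1 ''used'' 0 j = 0 \<Longrightarrow> nm (fst s2 ''j1'' 0 0) \<le> nm j"
      and ag2: "agree hungarian_scan s1 s2"
      unfolding Let_def by blast+
    define j1 where "j1 = fst s2 ''j1'' 0 0"
    have j1: "j1 \<in> {1..n} - X'" "\<And>j. j \<in> {1..n} - X' \<Longrightarrow> nm j1 \<le> nm j"
      using j1' usedX' by (auto simp: j1_def)
    have s2: "fst s2 ''used'' = fst s1 ''used''" "fst s2 ''p'' = fst s1 ''p''" "fst s2 ''n'' = fst s1 ''n''"
      "snd s2 ''c'' = snd s1 ''c''" "snd s2 ''u'' = snd s1 ''u''" "snd s2 ''v'' = snd s1 ''v''"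
      by (auto intro!: agreeN[OF ag2] agreeR[OF ag2] simp: hungarian_mods)
    show "runs (hungarian_update ;; set_nsc ''j0'' (nsc ''j1'')) s2 (150 * (n + 1) + 6) ?Q"
    proof (rule runs_Seq)
      show "runs hungarian_update s2 (150 * (n + 1)) (?updated s2)"
      proof (rule runs_agree[OF runs_update])
        show "fst s2 ''n'' 0 0 = n" by (simp add: s2 s1)
        fix j k assume jk: "j \<le> n" "k \<le> n" "fst s2 ''used'' 0 j = 1" "fst s2 ''used'' 0 k = 1" "fst s2 ''p'' 0 j = fst s2 ''p'' 0 k"
        then have "p j = p k" "j \<in> X'" using usedX' by (simp_all add: s2 s1(1))
        then show "j = k" using assigns_inj[OF p(5), of j k] jk(1,2) pX'[of j] by simp
      qed
      fix s3 :: state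
      assume s3': "?updated s2 s3"
      then have ag3: "agree hungarian_update s2 s3" by blast
      have s3: "fst s3 ''used'' = fst s1 ''used''" "fst s3 ''p'' 0 = p" "fst s3 ''n'' 0 0 = n" "snd s3 ''c'' = c"
        "fst s3 ''way'' = fst s2 ''way''" "fst s3 ''j1'' 0 0 = j1"
        using agreeN[OF ag3, of "''used''"] agreeN[OF ag3, of "''p''"] agreeN[OF ag3, of "''n''"]
          agreeR[OF ag3, of "''c''"] agreeN[OF ag3, of "''way''"] agreeN[OF ag3, of "''j1''"]
        by (auto simp: hungarian_mods s2 s1 j1_def)
      have "alternating_tree d n c i p X' j1 (snd s3 ''u'' 0) (snd s3 ''v'' 0) (snd s3 ''minv'' 0) (fst s3 ''way'' 0) (rk(j1 := card X'))"
      proof (rule tree_step[OF p(1-3) p(5) tree _ X'_def cur_def nm_def j1])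
        show "p j0 \<noteq> 0" using nz by (simp add: j0_def)
        have delta: "snd s2 ''delta'' 0 0 = nm j1" using j1' by (simp add: j1_def)
        show "snd s3 ''u'' 0 r = u r + (if r \<in> p ` X' then nm j1 else 0)" for r
          using s3' X'eq delta by (simp add: s2 s1(1,4))
        show "snd s3 ''v'' 0 j = v j - (if j \<in> X' then nm j1 else 0)" if "j \<le> n" for j
          using s3' usedX'[OF that] delta that by (simp add: s2 s1(5))
        show "snd s3 ''minv'' 0 j = nm j - nm j1" if "j \<in> {1..n} - X'" for j
          using s3' usedX'[of j] delta that mw(1)[of j] by (simp add: s2)
        show "fst s3 ''way'' 0 j = (if j0 = 0 \<or> cur j < minv j then j0 else way j)" if "j \<in> {1..n} - X'" for j
          using usedX'[of j] that mw(2)[of j] by (simp add: s3 nw_def)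
        show "fst s3 ''way'' 0 j = way j" if "j \<in> X'" for j
          using usedX'[of j] that mw(2)[of j] X'n by (auto simp: s3 s1(7))
      qed
      moreover have "used_columns n (eff (set_nsc ''j0'' (nsc ''j1'')) s3) = X'"
        unfolding X'eq[symmetric] by (simp add: used_columns_def s3 upd_cell_other)
      moreover have "card X' = Suc (card X)"
        using t finite_subset[OF t(1)] by (simp add: X'_def)
      moreover have "\<forall>j\<le>n. fst s1 ''used'' 0 j = 0 \<or> fst s1 ''used'' 0 j = 1" using usedX' by blast
      ultimately have "search_invariant d n c i p (eff (set_nsc ''j0'' (nsc ''j1'')) s3) \<and>
          card (used_columns n (eff (set_nsc ''j0'' (nsc ''j1'')) s3)) = Suc (card (used_columns n s))"
        unfolding search_invariant_def by (auto simp: s3 upd_cell_apply upd_cell_other X_def)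
      then show "runs (set_nsc ''j0'' (nsc ''j1'')) s3 6 ?Q"
        by (intro runs_straight) simp_all
    qed simp
  qed simp
  show ?thesis
    unfolding search_step_def
    by (rule runs_mono[OF runs_straight_Seq[OF _ runs_straight_Seq[OF _ runs_straight_Seq[OF _ main[unfolded s1_def]]]]]) simp_all
qed

text \<open>Every round marks one more of the \<open>n + 1\<close> columns. The current
  \<open>j0\<close> is never marked, so the number of marked columns stays below
  \<open>n + 1\<close> and at most that many rounds of linear cost occur.\<close>

lemma runs_search:
  assumes p: "p 0 = i" "1 \<le> i" "i \<le> d" "d \<le> n" "assigns i p {..n}"
    and inv: "search_invariant d n c i p s"
  shows "runs (While (BNot (NEq (nvec ''p'' (nsc ''j0'')) (NConst 0))) search_step) s (500 * (n + 1) ^ 2)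
     (\<lambda>s'. search_invariant d n c i p s' \<and> p (fst s' ''j0'' 0 0) = 0)"
proof (rule runs_While[where P = "\<lambda>s k. search_invariant d n c i p s \<and> k + card (used_columns n s) = n + 1"
      and K = "400 * (n + 1)" and k = "n + 1 - card (used_columns n s)"])
  have card: "card (used_columns n s) < n + 1" if s: "search_invariant d n c i p s" for s
  proof -
    obtain rk where "alternating_tree d n c i p (used_columns n s) (fst s ''j0'' 0 0)
        (snd s ''u'' 0) (snd s ''v'' 0) (snd s ''minv'' 0) (fst s ''way'' 0) rk"
      using s by (auto simp: search_invariant_def)
    then have "used_columns n s \<subset> {..n}" unfolding alternating_tree_def by blast
    then show ?thesis using psubset_card_mono[of "{..n}" "used_columns n s"] by simp
  qed
  show "search_invariant d n c i p s \<and> n + 1 - card (used_columns n s) + card (used_columns n s) = n + 1"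
    using inv card[OF inv] by simp
  fix s k assume P: "search_invariant d n c i p s \<and> k + card (used_columns n s) = n + 1"
  then have pj: "fst s ''p'' 0 = p" by (simp add: search_invariant_def)
  {
    assume "bval s (BNot (NEq (nvec ''p'' (nsc ''j0'')) (NConst 0)))"
    then have nz: "p (fst s ''j0'' 0 0) \<noteq> 0" by (simp add: pj)
    have "k > 0" using P card[of s] by simp
    moreover have "runs search_step s (400 * (n + 1)) (\<lambda>s'. search_invariant d n c i p s' \<and> k - 1 + card (used_columns n s') = n + 1)"
      by (rule runs_mono[OF runs_search_step[OF p conjunct1[OF P] nz]]) (use P \<open>k > 0\<close> in auto)
    ultimately show "k > 0 \<and> runs search_step s (400 * (n + 1)) (\<lambda>s'. search_invariant d n c i p s' \<and> k - 1 + card (used_columns n s') = n + 1)"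
      by blast
  }
  show "search_invariant d n c i p s \<and> p (fst s ''j0'' 0 0) = 0"
    if "\<not> bval s (BNot (NEq (nvec ''p'' (nsc ''j0'')) (NConst 0)))"
    using that P by (simp add: pj)
next
  have "(n + 1 - card (used_columns n s)) * (9 + 400 * (n + 1)) \<le> (n + 1) * (9 + 400 * (n + 1))"
    by (rule mult_right_mono) simp_all
  then show "(n + 1 - card (used_columns n s)) * (bcost (BNot (NEq (nvec ''p'' (nsc ''j0'')) (NConst 0))) + 1 + 400 * (n + 1)) +
      bcost (BNot (NEq (nvec ''p'' (nsc ''j0'')) (NConst 0))) + 1 \<le> 500 * (n + 1) ^ 2"
    by (simp add: power2_eq_square algebra_simps)
qed

lemma runs_augment:
  assumes "augmenting d n c i P X (fst s ''j0'' 0 0) (snd s ''u'' 0) (snd s ''v'' 0) (fst s ''way'' 0) rk (fst s ''p'' 0)"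
    and "rk (fst s ''j0'' 0 0) \<le> n + 1"
  shows "runs (While (BNot (NEq (nsc ''j0'') (NConst 0)))
       (set_nsc ''j1'' (nvec ''way'' (nsc ''j0'')) ;;
        set_nvec ''p'' (nsc ''j0'') (nvec ''p'' (nsc ''j1'')) ;;
        set_nsc ''j0'' (nsc ''j1''))) s (100 * (n + 2))
     (\<lambda>s'. potentials d n c i (fst s' ''p'' 0) (snd s' ''u'' 0) (snd s' ''v'' 0) UNIV \<and> assigns i (fst s' ''p'' 0) {1..n})"
proof (rule runs_While[where P = "\<lambda>s k. k \<ge> rk (fst s ''j0'' 0 0) \<and>
    augmenting d n c i P X (fst s ''j0'' 0 0) (snd s ''u'' 0) (snd s ''v'' 0) (fst s ''way'' 0) rk (fst s ''p'' 0)"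
    and K = 40 and k = "n + 1"], goal_cases)
  case 1 show ?case using assms by simp
next
  case (2 s k)
  let ?c = "set_nsc ''j1'' (nvec ''way'' (nsc ''j0'')) ;;
        set_nvec ''p'' (nsc ''j0'') (nvec ''p'' (nsc ''j1'')) ;; set_nsc ''j0'' (nsc ''j1'')"
  have "fst s ''j0'' 0 0 \<noteq> 0" using 2(2) by simp
  from augmenting_step[OF conjunct2[OF 2(1)] this refl]
  have step: "augmenting d n c i P X (fst s ''way'' 0 (fst s ''j0'' 0 0)) (snd s ''u'' 0) (snd s ''v'' 0) (fst s ''way'' 0) rk
      (\<lambda>j. if j = fst s ''j0'' 0 0 then fst s ''p'' 0 (fst s ''way'' 0 (fst s ''j0'' 0 0)) else fst s ''p'' 0 j)"
    "rk (fst s ''way'' 0 (fst s ''j0'' 0 0)) < rk (fst s ''j0'' 0 0)" by blast+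
  have e: "fst (eff ?c s) ''j0'' 0 0 = fst s ''way'' 0 (fst s ''j0'' 0 0)" "snd (eff ?c s) = snd s"
    "fst (eff ?c s) ''way'' 0 = fst s ''way'' 0"
    "fst (eff ?c s) ''p'' 0 = (\<lambda>j. if j = fst s ''j0'' 0 0 then fst s ''p'' 0 (fst s ''way'' 0 (fst s ''j0'' 0 0)) else fst s ''p'' 0 j)"
    by (auto simp: upd_cell_apply intro!: ext)
  have "k > 0" using 2(1) step(2) by simp
  moreover have "runs ?c s 40 (\<lambda>s'. k - 1 \<ge> rk (fst s' ''j0'' 0 0) \<and>
    augmenting d n c i P X (fst s' ''j0'' 0 0) (snd s' ''u'' 0) (snd s' ''v'' 0) (fst s' ''way'' 0) rk (fst s' ''p'' 0))"
  proof (rule runs_straight)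
    show "k - 1 \<ge> rk (fst (eff ?c s) ''j0'' 0 0) \<and>
      augmenting d n c i P X (fst (eff ?c s) ''j0'' 0 0) (snd (eff ?c s) ''u'' 0) (snd (eff ?c s) ''v'' 0) (fst (eff ?c s) ''way'' 0) rk (fst (eff ?c s) ''p'' 0)"
      unfolding e using step 2(1) by auto
  qed simp_all
  ultimately show ?case by blast
next
  case (3 s k)
  then have j0: "fst s ''j0'' 0 0 = 0" by simp
  \<comment> \<open>The open column is now the artificial one, so claims about all columns except
    \<open>j0\<close> cover every genuine column.\<close>
  have "{..n} - {0} = {1..n}" by auto
  moreover have "{1..n} \<inter> - {0} = {1..n}" by auto
  ultimately show ?case using 3(1) unfolding j0 augmenting_def potentials_def by simp
qed simp

text \<open>With row \<open>Suc i\<close> in column 0, the columns \<open>0..n\<close> carry all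
  rows up to \<open>Suc i\<close>. The search ends at a free column, and shifting rows along the
  tree path lets the columns \<open>1..n\<close> carry them alone.\<close>

lemma runs_insert:
  assumes pot: "potentials d n (snd s ''c'') i (fst s ''p'' 0) (snd s ''u'' 0) (snd s ''v'' 0) UNIV"
    and as: "assigns i (fst s ''p'' 0) {1..n}"
    and i: "i < d" "d \<le> n" and s: "fst s ''i'' 0 0 = Suc i" "fst s ''n'' 0 0 = n"
  shows "runs hungarian_insert s (1000 * (n + 1) ^ 2) (\<lambda>s'.
    potentials d n (snd s ''c'') (Suc i) (fst s' ''p'' 0) (snd s' ''u'' 0) (snd s' ''v'' 0) UNIV \<and>
    assigns (Suc i) (fst s' ''p'' 0) {1..n})"
proof -
  define p where "p j = (if j = 0 then Suc i else fst s ''p'' 0 j)" for j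
  define s1 where "s1 = eff (set_nsc ''j0'' (NConst 0)) (eff (set_nvec ''p'' (NConst 0) (nsc ''i'')) s)"
  have s1: "fst s1 ''p'' 0 = p" "fst s1 ''j0'' 0 0 = 0" "snd s1 = snd s" "fst s1 ''n'' 0 0 = n"
    by (auto simp: s1_def s p_def upd_cell_apply intro!: ext)
  have p0: "p 0 = Suc i" by (simp add: p_def)
  have pj: "p j = fst s ''p'' 0 j" if "j \<in> {1..n}" for j using that by (simp add: p_def)
  have as': "assigns (Suc i) p {..n}"
    unfolding assigns_def
  proof (intro conjI ballI impI)
    fix j assume j: "j \<in> {..n}"
    then show "p j \<le> Suc i" using assigns_le[OF as, of j] by (auto simp: p_def)
    fix k assume k: "k \<in> {..n}" and eq: "p j = p k" "p j \<noteq> 0"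
    show "j = k"
    proof (cases "j = 0"; cases "k = 0")
      assume "j \<noteq> 0" "k \<noteq> 0"
      then show ?thesis using assigns_inj[OF as, of j k] j k eq by (auto simp: p_def)
    next
      assume "j = 0" "k \<noteq> 0"
      then show ?thesis using assigns_le[OF as, of k] k eq by (auto simp: p_def)
    next
      assume "j \<noteq> 0" "k = 0"
      then show ?thesis using assigns_le[OF as, of j] j eq by (auto simp: p_def)
    qed simp
  next
    fix r assume r: "r \<in> {1..Suc i}"
    show "\<exists>j\<in>{..n}. p j = r"
    proof (cases "r = Suc i")
      case True then show ?thesis using p0 by auto
    next
      case False
      then obtain j where "j \<in> {1..n}" "fst s ''p'' 0 j = r" using assigns_surj[OF as, of r] r by auto
      then show ?thesis using pj by (intro bexI[of _ j]) auto
    qed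
  qed
  have pot': "potentials d n (snd s ''c'') (Suc i) p (snd s ''u'' 0) (snd s ''v'' 0) UNIV"
    using pot pj unfolding potentials_def by simp
  let ?clear = "For ''j'' (NConst 0) (nsuc (nsc ''n'')) (set_nvec ''used'' (nsc ''j'') (NConst 0))"
  let ?aug = "While (BNot (NEq (nsc ''j0'') (NConst 0)))
       (set_nsc ''j1'' (nvec ''way'' (nsc ''j0'')) ;;
        set_nvec ''p'' (nsc ''j0'') (nvec ''p'' (nsc ''j1'')) ;;
        set_nsc ''j0'' (nsc ''j1''))"
  let ?search = "While (BNot (NEq (nvec ''p'' (nsc ''j0'')) (NConst 0))) search_step"
  let ?Q = "\<lambda>s'. potentials d n (snd s ''c'') (Suc i) (fst s' ''p'' 0) (snd s' ''u'' 0) (snd s' ''v'' 0) UNIV \<and>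
    assigns (Suc i) (fst s' ''p'' 0) {1..n}"
  have main: "runs (?clear ;; ?search ;; ?aug) s1 (12 + 40 * (n + 1) + (500 * (n + 1) ^ 2 + 100 * (n + 2))) ?Q"
  proof (rule runs_Seq)
    show "runs ?clear s1 (12 + 40 * (n + 1)) (\<lambda>s2. (\<forall>j\<le>n. fst s2 ''used'' 0 j = 0) \<and> agree ?clear s1 s2)"
    proof (rule runs_For[where lo = 0 and hi = "Suc n" and K = 10 and
          P = "\<lambda>k s2. \<forall>j<k. fst s2 ''used'' 0 j = 0"], goal_cases)
      case (4 s2)
      from agreeN[OF this, of "''n''"] show ?case by (simp add: For_def s1)
    next
      case (5 k s2)
      then show ?case by (intro runs_straight) (auto simp: upd_cell_apply less_Suc_eq)
    next
      case (6 s2)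
      then show ?case by (simp add: less_Suc_eq_le)
    qed (simp_all add: s1)
    fix s2 :: state assume "(\<forall>j\<le>n. fst s2 ''used'' 0 j = 0) \<and> agree ?clear s1 s2"
    then have used: "\<forall>j\<le>n. fst s2 ''used'' 0 j = 0" and ag: "agree ?clear s1 s2" by blast+
    have s2: "fst s2 ''p'' 0 = p" "fst s2 ''j0'' 0 0 = 0" "snd s2 y = snd s y" "fst s2 ''n'' 0 0 = n" for y
      using agreeN[OF ag, of "''p''"] agreeN[OF ag, of "''j0''"] agreeN[OF ag, of "''n''"] agreeR[OF ag, of y]
      by (auto simp: For_def s1)
    have "used_columns n s2 = {}" using used by (auto simp: used_columns_def)
    then have inv: "search_invariant d n (snd s ''c'') (Suc i) p s2"
      using used pot' unfolding search_invariant_def alternating_tree_def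
      by (auto simp: s2 intro!: exI[of _ "\<lambda>_. 0"])
    show "runs (?search ;; ?aug) s2 (500 * (n + 1) ^ 2 + 100 * (n + 2)) ?Q"
    proof (rule runs_Seq)
      show "runs ?search s2 (500 * (n + 1) ^ 2) (\<lambda>s3. search_invariant d n (snd s ''c'') (Suc i) p s3 \<and> p (fst s3 ''j0'' 0 0) = 0)"
        by (rule runs_search[OF p0 _ _ i(2) as' inv]) (use i in simp_all)
      fix s3 :: state assume s3: "search_invariant d n (snd s ''c'') (Suc i) p s3 \<and> p (fst s3 ''j0'' 0 0) = 0"
      then obtain rk where tree: "alternating_tree d n (snd s ''c'') (Suc i) p (used_columns n s3) (fst s3 ''j0'' 0 0)
        (snd s3 ''u'' 0) (snd s3 ''v'' 0) (snd s3 ''minv'' 0) (fst s3 ''way'' 0) rk" and pp: "fst s3 ''p'' 0 = p"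
        unfolding search_invariant_def by blast
      have aug: "augmenting d n (snd s ''c'') (Suc i) p (used_columns n s3) (fst s3 ''j0'' 0 0) (snd s3 ''u'' 0) (snd s3 ''v'' 0)
          (fst s3 ''way'' 0) rk (fst s3 ''p'' 0)"
        unfolding pp by (rule augmenting_init[OF tree as' _ p0]) (use s3 in simp_all)
      have "used_columns n s3 \<subseteq> {..n}" "rk (fst s3 ''j0'' 0 0) = card (used_columns n s3)"
        using tree unfolding alternating_tree_def by blast+
      then have "rk (fst s3 ''j0'' 0 0) \<le> n + 1" using card_mono[of "{..n}" "used_columns n s3"] by simp
      from runs_augment[OF aug this]
      show "runs ?aug s3 (100 * (n + 2)) ?Q" .
    qed simp
  qed simp
  show ?thesis
    unfolding hungarian_insert_def search_step_def[symmetric]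
    by (rule runs_mono[OF runs_straight_Seq[OF _ runs_straight_Seq[OF _ main[unfolded s1_def]]]])
      (simp_all add: power2_eq_square algebra_simps)
qed

lemma runs_hungarian:
  assumes c: "\<And>r j. r \<in> {1..d} \<Longrightarrow> j \<in> {1..n} \<Longrightarrow> 0 \<le> snd s ''c'' r j"
    and s: "fst s ''d'' 0 0 = d" "fst s ''m'' 0 0 = m" and n: "n = d + m"
  shows "runs hungarian s (2000 * (n + 1) ^ 3) (\<lambda>s'.
    potentials d n (snd s ''c'') d (fst s' ''p'' 0) (snd s' ''u'' 0) (snd s' ''v'' 0) UNIV \<and>
    assigns d (fst s' ''p'' 0) {1..n})"
proof -
  let ?init = "set_nsc ''n'' (NAdd (nsc ''d'') (nsc ''m''))"
  let ?f1 = "For ''j'' (NConst 0) (nsuc (nsc ''n'')) (set_nvec ''p'' (nsc ''j'') (NConst 0) ;; set_rvec ''v'' (nsc ''j'') (RConst 0))"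
  let ?f2 = "For ''i'' (NConst 0) (nsuc (nsc ''d'')) (set_rvec ''u'' (nsc ''i'') (RConst 0))"
  let ?f3 = "For ''i'' (NConst 1) (nsuc (nsc ''d'')) hungarian_insert"
  let ?H = "\<lambda>k s'. potentials d n (snd s ''c'') k (fst s' ''p'' 0) (snd s' ''u'' 0) (snd s' ''v'' 0) UNIV \<and>
    assigns k (fst s' ''p'' 0) {1..n}"
  define s1 where "s1 = eff ?init s"
  have s1: "fst s1 ''n'' 0 0 = n" "fst s1 ''d'' 0 0 = d" "snd s1 = snd s"
    by (auto simp: s1_def s n upd_cell_apply)
  have main: "runs (?f1 ;; ?f2 ;; ?f3) s1 (12 + 50 * (n + 1) + (12 + 40 * (n + 1) + (20 + d * (1000 * (n + 1) ^ 2 + 20)))) (?H d)"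
  proof (rule runs_Seq)
    show "runs ?f1 s1 (12 + 50 * (n + 1)) (\<lambda>s2. (\<forall>j\<le>n. fst s2 ''p'' 0 j = 0 \<and> snd s2 ''v'' 0 j = 0) \<and> agree ?f1 s1 s2)"
    proof (rule runs_For[where lo = 0 and hi = "Suc n" and K = 20 and
          P = "\<lambda>k s2. \<forall>j<k. fst s2 ''p'' 0 j = 0 \<and> snd s2 ''v'' 0 j = 0"], goal_cases)
      case (4 s2)
      from agreeN[OF this, of "''n''"] show ?case by (simp add: For_def s1)
    next
      case (5 k s2)
      then show ?case by (intro runs_straight) (auto simp: upd_cell_apply less_Suc_eq)
    next
      case (6 s2)
      then show ?case by (simp add: less_Suc_eq_le)
    qed (simp_all add: s1)
    fix s2 :: state assume "(\<forall>j\<le>n. fst s2 ''p'' 0 j = 0 \<and> snd s2 ''v'' 0 j = 0) \<and> agree ?f1 s1 s2"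
    then have pv: "\<forall>j\<le>n. fst s2 ''p'' 0 j = 0 \<and> snd s2 ''v'' 0 j = 0" and ag: "agree ?f1 s1 s2" by blast+
    have s2: "fst s2 ''n'' 0 0 = n" "fst s2 ''d'' 0 0 = d" "snd s2 ''c'' = snd s ''c''"
      using agreeN[OF ag, of "''n''"] agreeN[OF ag, of "''d''"] agreeR[OF ag, of "''c''"] by (auto simp: For_def s1)
    show "runs (?f2 ;; ?f3) s2 (12 + 40 * (n + 1) + (20 + d * (1000 * (n + 1) ^ 2 + 20))) (?H d)"
    proof (rule runs_Seq)
      show "runs ?f2 s2 (12 + 40 * (n + 1)) (\<lambda>s3. (\<forall>r\<le>d. snd s3 ''u'' 0 r = 0) \<and> agree ?f2 s2 s3)"
      proof (rule runs_For[where lo = 0 and hi = "Suc d" and K = 10 and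
            P = "\<lambda>k s3. \<forall>r<k. snd s3 ''u'' 0 r = 0"], goal_cases)
        case (4 s3)
        from agreeN[OF this, of "''d''"] show ?case by (simp add: For_def s2)
      next
        case (5 k s3)
        then show ?case by (intro runs_straight) (auto simp: upd_cell_apply less_Suc_eq)
      next
        case (6 s3)
        then show ?case by (simp add: less_Suc_eq_le)
      qed (simp_all add: s2 n)
      fix s3 :: state assume "(\<forall>r\<le>d. snd s3 ''u'' 0 r = 0) \<and> agree ?f2 s2 s3"
      then have u: "\<forall>r\<le>d. snd s3 ''u'' 0 r = 0" and ag: "agree ?f2 s2 s3" by blast+
      have s3: "fst s3 ''n'' 0 0 = n" "fst s3 ''d'' 0 0 = d" "snd s3 ''c'' = snd s ''c''"
        "fst s3 ''p'' = fst s2 ''p''" "snd s3 ''v'' = snd s2 ''v''"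
        using agreeN[OF ag, of "''n''"] agreeN[OF ag, of "''d''"] agreeR[OF ag, of "''c''"]
          agreeN[OF ag, of "''p''"] agreeR[OF ag, of "''v''"] by (auto simp: For_def s2)
      \<comment> \<open>Zero potentials are feasible because the costs are nonnegative, and with all
        columns free slackness only asks for \<open>v = 0\<close>.\<close>
      have H0: "?H 0 s3" using pv u c unfolding potentials_def assigns_def by (auto simp: s3)
      show "runs ?f3 s3 (20 + d * (1000 * (n + 1) ^ 2 + 20)) (?H d)"
      proof (rule runs_For[where lo = 1 and hi = "Suc d" and K = "1000 * (n + 1) ^ 2" and P = "\<lambda>k. ?H (k - 1)"], goal_cases)
        case 3
        have "fst (set_index ''i'' 1 s3) ''p'' 0 = fst s3 ''p'' 0" by (auto intro!: ext)
        then show ?case using H0 by simp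
      next
        case (4 s4)
        from agreeN[OF this, of "''d''"] show ?case
          by (simp add: For_def hungarian_insert_def hungarian_mods s3)
      next
        case (5 k s4)
        then obtain i where k: "k = Suc i" by (cases k) auto
        have c4: "snd s4 ''c'' = snd s ''c''" "fst s4 ''n'' 0 0 = n"
          using agreeR[OF 5(5), of "''c''"] agreeN[OF 5(5), of "''n''"]
          by (simp_all add: For_def hungarian_insert_def hungarian_mods s3)
        have "runs hungarian_insert s4 (1000 * (n + 1) ^ 2) (\<lambda>s'. ?H (Suc i) s' \<and> agree hungarian_insert s4 s')"
          unfolding c4(1)[symmetric]
          by (rule runs_agree[OF runs_insert]) (use 5 k n c4 in auto)
        then show ?case
        proof (rule runs_mono)
          fix s' assume "?H (Suc i) s' \<and> agree hungarian_insert s4 s'"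
          then have H: "?H (Suc i) s'" and "agree hungarian_insert s4 s'" by blast+
          from agreeN[OF this(2), of "''i''"] have "fst s' ''i'' 0 0 = k"
            using 5(4) by (simp add: hungarian_insert_def hungarian_mods For_def)
          moreover have "fst (set_index ''i'' (Suc k) s') ''p'' 0 = fst s' ''p'' 0" by (auto intro!: ext)
          ultimately show "fst s' ''i'' 0 0 = k \<and> ?H (Suc k - 1) (set_index ''i'' (Suc k) s')"
            using H k by simp
        qed simp
      next
        case (6 s4) then show ?case by simp
      qed (simp_all add: algebra_simps)
    qed simp
  qed simp
  have "d * (1000 * (n + 1) ^ 2 + 20) \<le> (n + 1) * (1000 * (n + 1) ^ 2 + 20)"
    using n by (intro mult_right_mono) auto
  also have "\<dots> = 1000 * (n + 1) ^ 3 + 20 * (n + 1)"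
    by (simp add: power3_eq_cube power2_eq_square algebra_simps)
  finally have "d * (1000 * (n + 1) ^ 2 + 20) \<le> 1000 * (n + 1) ^ 3 + 20 * (n + 1)" .
  moreover have "n + 1 \<le> (n + 1) ^ 3" by (rule self_le_power) auto
  moreover have "20 + (12 + 50 * N + (12 + 40 * N + (20 + y))) \<le> 2000 * x"
    if "y \<le> 1000 * x + 20 * N" "N \<le> x" "1 \<le> N" for x y N :: nat using that by linarith
  ultimately have time: "20 + (12 + 50 * (n + 1) + (12 + 40 * (n + 1) + (20 + d * (1000 * (n + 1) ^ 2 + 20)))) \<le> 2000 * (n + 1) ^ 3"
    by simp
  show ?thesis
    unfolding hungarian_def
    by (rule runs_mono[OF runs_straight_Seq[OF _ main[unfolded s1_def]]]) (use time in simp_all)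
qed

section \<open>Execution of the whole program\<close>

text \<open>The input arrays are fixed as whole functions, cells out of range included, so that the
  frame condition preserves this predicate directly.\<close>

definition loaded :: "nat \<Rightarrow> nat \<Rightarrow> (nat \<Rightarrow> nat \<Rightarrow> nat) \<Rightarrow> (nat \<Rightarrow> nat \<Rightarrow> nat) \<Rightarrow> (nat \<Rightarrow> nat \<Rightarrow> real) \<Rightarrow> state \<Rightarrow> bool" where
  "loaded d m A B w s \<longleftrightarrow> fst s ''d'' 0 0 = d \<and> fst s ''m'' 0 0 = m \<and> fst s ''A'' = A \<and> fst s ''B'' = B \<and> snd s ''w'' = w"

lemma loaded_agree:
  assumes "agree c s s'" "nmods c \<inter> {''d'', ''m'', ''A'', ''B''} = {}" "''w'' \<notin> rmods c" "loaded d m A B w s"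
  shows "loaded d m A B w s'"
proof -
  have "fst s' y = fst s y" if "y \<in> {''d'', ''m'', ''A'', ''B''}" for y
    using agreeN[OF assms(1), of y] assms(2) that by blast
  then show ?thesis using agreeR[OF assms(1,3)] assms(4) unfolding loaded_def by simp
qed

section \<open>Construction of the cost matrix\<close>

definition total_cost :: "nat \<Rightarrow> nat \<Rightarrow> (nat \<Rightarrow> nat \<Rightarrow> nat) \<Rightarrow> (nat \<Rightarrow> nat \<Rightarrow> real) \<Rightarrow> real" where
  "total_cost d m B w = (\<Sum>i<d. \<Sum>j<m. if B i j = 1 then w i j else 0)"

definition total_cost_loop :: com where
  "total_cost_loop =
    (For ''i'' (NConst 0) (nsc ''d'') (
       For ''j'' (NConst 0) (nsc ''m'') (
         Cond (NEq (NVar ''B'' (nsc ''i'') (nsc ''j'')) (NConst 1))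
           (set_rsc ''W'' (RAdd (rsc ''W'') (RVar ''w'' (nsc ''i'') (nsc ''j''))))
           Skip)))"

lemma runs_total_cost:
  assumes l: "loaded d m A B w s"
  shows "runs total_cost_loop s (12 + d * (40 + 60 * m))
     (\<lambda>s'. snd s' ''W'' 0 0 = snd s ''W'' 0 0 + total_cost d m B w)"
  unfolding total_cost_loop_def
proof (rule runs_For[where lo = 0 and hi = d and K = "20 + 60 * m" and
      P = "\<lambda>k s'. snd s' ''W'' 0 0 = snd s ''W'' 0 0 + (\<Sum>i<k. \<Sum>j<m. if B i j = 1 then w i j else 0)"], goal_cases)
  case (4 s')
  from loaded_agree[OF this _ _ l] show ?case by (simp add: For_def loaded_def)
next
  case (5 k s1)
  have l1: "loaded d m A B w s1" using loaded_agree[OF 5(5) _ _ l] by (simp add: For_def)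
  show ?case
  proof (rule runs_For[where lo = 0 and hi = m and K = 40 and
      P = "\<lambda>k' s'. snd s' ''W'' 0 0 = snd s1 ''W'' 0 0 + (\<Sum>j<k'. if B k j = 1 then w k j else 0)"], goal_cases)
    case (4 s')
    from loaded_agree[OF this _ _ l1] show ?case by (simp add: For_def loaded_def)
  next
    case (5 k' s2)
    have l2: "loaded d m A B w s2" using loaded_agree[OF 5(5) _ _ l1] by (simp add: For_def)
    have i: "fst s2 ''i'' 0 0 = k" using agreeN[OF 5(5), of "''i''"] \<open>fst s1 ''i'' 0 0 = k\<close> by (simp add: For_def)
    show ?case
      by (rule runs_straight) (use l2 i 5 in \<open>auto simp: loaded_def upd_cell_apply\<close>)
  next
    case (6 s')
    then show ?case using 5 agreeN[OF 6(3), of "''i''"] by (simp add: For_def)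
  qed (simp_all add: algebra_simps)
next
  case (6 s') then show ?case by (simp add: total_cost_def)
qed (simp_all add: algebra_simps)

text \<open>\<open>k\<close> rows are filled. Indices are shifted by one since row and column 0 are
  reserved for the meanings "free" and "artificial".\<close>

definition graph_costs :: "nat \<Rightarrow> nat \<Rightarrow> (nat \<Rightarrow> nat \<Rightarrow> nat) \<Rightarrow> (nat \<Rightarrow> nat \<Rightarrow> nat) \<Rightarrow> (nat \<Rightarrow> nat \<Rightarrow> real) \<Rightarrow> real \<Rightarrow>
    nat \<Rightarrow> (nat \<Rightarrow> nat \<Rightarrow> real) \<Rightarrow> bool" where
  "graph_costs d m A B w W k c \<longleftrightarrow>
     (\<forall>i<k. (\<forall>j<d. c (Suc i) (Suc j) = (if A i j = 1 then 0 else W)) \<and>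
            (\<forall>j<m. c (Suc i) (Suc (d + j)) = (if B i j = 1 then w i j else W)))"

definition fill_costs_loop :: com where
  "fill_costs_loop =
    (For ''i'' (NConst 0) (nsc ''d'') (
       For ''j'' (NConst 0) (nsc ''d'') (
         Cond (NEq (NVar ''A'' (nsc ''i'') (nsc ''j'')) (NConst 1))
           (RAssign ''c'' (nsuc (nsc ''i'')) (nsuc (nsc ''j'')) (RConst 0))
           (RAssign ''c'' (nsuc (nsc ''i'')) (nsuc (nsc ''j'')) (rsc ''W''))) ;;
       For ''j'' (NConst 0) (nsc ''m'') (
         Cond (NEq (NVar ''B'' (nsc ''i'') (nsc ''j'')) (NConst 1))
           (RAssign ''c'' (nsuc (nsc ''i'')) (nsuc (NAdd (nsc ''d'') (nsc ''j''))) (RVar ''w'' (nsc ''i'') (nsc ''j'')))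
           (RAssign ''c'' (nsuc (nsc ''i'')) (nsuc (NAdd (nsc ''d'') (nsc ''j''))) (rsc ''W'')))))"

lemma runs_fill_costs:
  assumes l: "loaded d m A B w s"
  shows "runs fill_costs_loop s
     (12 + d * (50 + 70 * (d + m)))
     (\<lambda>s'. graph_costs d m A B w (snd s ''W'' 0 0) d (snd s' ''c''))"
  unfolding fill_costs_loop_def
proof (rule runs_For[where lo = 0 and hi = d and K = "30 + 70 * (d + m)" and
      P = "\<lambda>k s'. graph_costs d m A B w (snd s ''W'' 0 0) k (snd s' ''c'')"], goal_cases)
  case (4 s')
  from loaded_agree[OF this _ _ l] show ?case by (simp add: For_def loaded_def)
next
  case (5 k s1)
  define W where "W = snd s ''W'' 0 0"
  have l1: "loaded d m A B w s1" using loaded_agree[OF 5(5) _ _ l] by (simp add: For_def)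
  have W1: "snd s1 ''W'' 0 0 = W" using agreeR[OF 5(5), of "''W''"] by (simp add: For_def W_def)
  have i1: "fst s1 ''i'' 0 0 = k" and g1: "graph_costs d m A B w W k (snd s1 ''c'')" using 5 by (simp_all add: W_def)
  show ?case
  proof (rule runs_Seq[where ?T1.0 = "12 + 70 * d" and ?T2.0 = "12 + 70 * m" and
        R = "\<lambda>s2. loaded d m A B w s2 \<and> snd s2 ''W'' 0 0 = W \<and> fst s2 ''i'' 0 0 = k \<and> graph_costs d m A B w W k (snd s2 ''c'') \<and>
          (\<forall>j<d. snd s2 ''c'' (Suc k) (Suc j) = (if A k j = 1 then 0 else W))"], goal_cases)
    case 1
    show ?case
    proof (rule runs_For[where lo = 0 and hi = d and K = 50 and
        P = "\<lambda>l s2. graph_costs d m A B w W k (snd s2 ''c'') \<and> (\<forall>j<l. snd s2 ''c'' (Suc k) (Suc j) = (if A k j = 1 then 0 else W))"], goal_cases)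
      case (4 s')
      from loaded_agree[OF this _ _ l1] show ?case by (simp add: For_def loaded_def)
    next
      case (5 l s2)
      have l2: "loaded d m A B w s2" using loaded_agree[OF 5(5) _ _ l1] by (simp add: For_def)
      have i: "fst s2 ''i'' 0 0 = k" and W: "snd s2 ''W'' 0 0 = W"
        using agreeN[OF 5(5), of "''i''"] agreeR[OF 5(5), of "''W''"] i1 W1 by (simp_all add: For_def)
      show ?case
        by (rule runs_straight) (use l2 i W 5 in \<open>auto simp: loaded_def upd_cell_apply graph_costs_def less_Suc_eq\<close>)
    next
      case (6 s2)
      have "loaded d m A B w s2" using loaded_agree[OF 6(3) _ _ l1] by (simp add: For_def)
      then show ?case using 6 agreeN[OF 6(3), of "''i''"] agreeR[OF 6(3), of "''W''"] i1 W1 by (simp add: For_def)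
    qed (use g1 in simp_all)
  next
    case (2 s2)
    then have l2: "loaded d m A B w s2" and W2: "snd s2 ''W'' 0 0 = W" and i2: "fst s2 ''i'' 0 0 = k"
      and g2: "graph_costs d m A B w W k (snd s2 ''c'')"
      and r2: "\<forall>j<d. snd s2 ''c'' (Suc k) (Suc j) = (if A k j = 1 then 0 else W)" by blast+
    show ?case
    proof (rule runs_For[where lo = 0 and hi = m and K = 50 and
        P = "\<lambda>l s3. graph_costs d m A B w W k (snd s3 ''c'') \<and>
          (\<forall>j<d. snd s3 ''c'' (Suc k) (Suc j) = (if A k j = 1 then 0 else W)) \<and>
          (\<forall>j<l. snd s3 ''c'' (Suc k) (Suc (d + j)) = (if B k j = 1 then w k j else W))"], goal_cases)
      case (4 s')
      from loaded_agree[OF this _ _ l2] show ?case by (simp add: For_def loaded_def)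
    next
      case (5 l s3)
      have l3: "loaded d m A B w s3" using loaded_agree[OF 5(5) _ _ l2] by (simp add: For_def)
      have i: "fst s3 ''i'' 0 0 = k" and W: "snd s3 ''W'' 0 0 = W"
        using agreeN[OF 5(5), of "''i''"] agreeR[OF 5(5), of "''W''"] i2 W2 by (simp_all add: For_def)
      show ?case
        by (rule runs_straight) (use l3 i W 5 in \<open>auto simp: loaded_def upd_cell_apply graph_costs_def less_Suc_eq\<close>)
    next
      case (6 s3)
      then show ?case using agreeN[OF 6(3), of "''i''"] i2 unfolding graph_costs_def W_def
        by (auto simp: For_def less_Suc_eq)
    qed (use g2 r2 in simp_all)
  qed simp
qed (simp_all add: graph_costs_def algebra_simps)

lemma runs_construct_graph:
  assumes l: "loaded d m A B w s"
  shows "runs construct_graph s (40 + 100 * d + 130 * (d * (d + m)))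
     (\<lambda>s'. loaded d m A B w s' \<and> graph_costs d m A B w (1 + total_cost d m B w) d (snd s' ''c''))"
proof -
  have l1: "loaded d m A B w (eff (set_rsc ''W'' (RConst 1)) s)"
    using l by (simp add: loaded_def upd_cell_other)
  have "runs (total_cost_loop ;; fill_costs_loop) (eff (set_rsc ''W'' (RConst 1)) s)
      (12 + d * (40 + 60 * m) + (12 + d * (50 + 70 * (d + m))))
     (\<lambda>s'. graph_costs d m A B w (1 + total_cost d m B w) d (snd s' ''c''))"
  proof (rule runs_Seq[OF runs_agree[OF runs_total_cost[OF l1]]])
    fix s2 :: state
    assume s2: "snd s2 ''W'' 0 0 = snd (eff (set_rsc ''W'' (RConst 1)) s) ''W'' 0 0 + total_cost d m B w \<and>
      agree total_cost_loop (eff (set_rsc ''W'' (RConst 1)) s) s2"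
    then have l2: "loaded d m A B w s2"
      using loaded_agree[OF conjunct2[OF s2] _ _ l1] by (simp add: For_def total_cost_loop_def)
    have W: "snd s2 ''W'' 0 0 = 1 + total_cost d m B w" using s2 by (simp add: upd_cell_apply)
    show "runs fill_costs_loop s2 (12 + d * (50 + 70 * (d + m)))
      (\<lambda>s'. graph_costs d m A B w (1 + total_cost d m B w) d (snd s' ''c''))"
      by (rule runs_fill_costs[OF l2, unfolded W])
  qed simp
  from runs_straight_Seq[OF _ this]
  have "runs construct_graph s (4 + (12 + d * (40 + 60 * m) + (12 + d * (50 + 70 * (d + m)))))
     (\<lambda>s'. graph_costs d m A B w (1 + total_cost d m B w) d (snd s' ''c''))"
    unfolding construct_graph_def total_cost_loop_def[symmetric] fill_costs_loop_def[symmetric] by simp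
  from runs_agree[OF this] show ?thesis
  proof (rule runs_mono)
    fix s' assume s': "graph_costs d m A B w (1 + total_cost d m B w) d (snd s' ''c'') \<and> agree construct_graph s s'"
    then have "loaded d m A B w s'"
      using loaded_agree[OF conjunct2[OF s'] _ _ l] by (simp add: construct_graph_def For_def)
    then show "loaded d m A B w s' \<and> graph_costs d m A B w (1 + total_cost d m B w) d (snd s' ''c'')" using s' by blast
  qed (simp add: algebra_simps)
qed

section \<open>Reading off the matching, and the whole program\<close>

definition collected :: "nat \<Rightarrow> nat \<Rightarrow> (nat \<Rightarrow> nat \<Rightarrow> nat) \<Rightarrow> (nat \<Rightarrow> nat \<Rightarrow> nat) \<Rightarrow> (nat \<Rightarrow> nat) \<Rightarrow> nat \<Rightarrow> state \<Rightarrow> bool" where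
  "collected d m A B p k s \<longleftrightarrow>
     (\<forall>i<k. (\<forall>j<d. fst s ''MA'' i j = (if A i j = 1 \<and> p (Suc j) = Suc i then 1 else 0)) \<and>
            (\<forall>j<m. fst s ''MB'' i j = (if B i j = 1 \<and> p (Suc (d + j)) = Suc i then 1 else 0)))"

lemma runs_collect_matching:
  assumes l: "loaded d m A B w s"
  shows "runs collect_matching s (12 + d * (50 + 70 * (d + m))) (collected d m A B (fst s ''p'' 0) d)"
  unfolding collect_matching_def
proof (rule runs_For[where lo = 0 and hi = d and K = "30 + 70 * (d + m)" and
      P = "collected d m A B (fst s ''p'' 0)"], goal_cases)
  case (4 s')
  from loaded_agree[OF this _ _ l] show ?case by (simp add: For_def loaded_def)
next
  case (5 k s1)
  define p where "p = fst s ''p'' 0"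
  have l1: "loaded d m A B w s1" using loaded_agree[OF 5(5) _ _ l] by (simp add: For_def)
  have p1: "fst s1 ''p'' 0 = p" using agreeN[OF 5(5), of "''p''"] by (simp add: For_def p_def)
  have i1: "fst s1 ''i'' 0 0 = k" and g1: "collected d m A B p k s1" using 5 by (simp_all add: p_def)
  show ?case
  proof (rule runs_Seq[where ?T1.0 = "12 + 70 * d" and ?T2.0 = "12 + 70 * m" and
        R = "\<lambda>s2. loaded d m A B w s2 \<and> fst s2 ''p'' 0 = p \<and> fst s2 ''i'' 0 0 = k \<and> collected d m A B p k s2 \<and>
          (\<forall>j<d. fst s2 ''MA'' k j = (if A k j = 1 \<and> p (Suc j) = Suc k then 1 else 0))"], goal_cases)
    case 1
    show ?case
    proof (rule runs_For[where lo = 0 and hi = d and K = 50 and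
        P = "\<lambda>l s2. collected d m A B p k s2 \<and> (\<forall>j<l. fst s2 ''MA'' k j = (if A k j = 1 \<and> p (Suc j) = Suc k then 1 else 0))"], goal_cases)
      case (4 s')
      from loaded_agree[OF this _ _ l1] show ?case by (simp add: For_def loaded_def)
    next
      case (5 l s2)
      have l2: "loaded d m A B w s2" using loaded_agree[OF 5(5) _ _ l1] by (simp add: For_def)
      have i: "fst s2 ''i'' 0 0 = k" and p: "fst s2 ''p'' 0 = p"
        using agreeN[OF 5(5), of "''i''"] agreeN[OF 5(5), of "''p''"] i1 p1 by (simp_all add: For_def)
      show ?case
        by (rule runs_straight) (use l2 i p 5 in \<open>auto simp: loaded_def upd_cell_apply collected_def less_Suc_eq\<close>)
    next
      case (6 s2)
      have "loaded d m A B w s2" using loaded_agree[OF 6(3) _ _ l1] by (simp add: For_def)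
      then show ?case using 6 agreeN[OF 6(3), of "''i''"] agreeN[OF 6(3), of "''p''"] i1 p1 by (simp add: For_def)
    qed (use g1 in \<open>simp_all add: collected_def\<close>)
  next
    case (2 s2)
    then have l2: "loaded d m A B w s2" and p2: "fst s2 ''p'' 0 = p" and i2: "fst s2 ''i'' 0 0 = k"
      and g2: "collected d m A B p k s2"
      and r2: "\<forall>j<d. fst s2 ''MA'' k j = (if A k j = 1 \<and> p (Suc j) = Suc k then 1 else 0)" by blast+
    show ?case
    proof (rule runs_For[where lo = 0 and hi = m and K = 50 and
        P = "\<lambda>l s3. collected d m A B p k s3 \<and>
          (\<forall>j<d. fst s3 ''MA'' k j = (if A k j = 1 \<and> p (Suc j) = Suc k then 1 else 0)) \<and>
          (\<forall>j<l. fst s3 ''MB'' k j = (if B k j = 1 \<and> p (Suc (d + j)) = Suc k then 1 else 0))"], goal_cases)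
      case (4 s')
      from loaded_agree[OF this _ _ l2] show ?case by (simp add: For_def loaded_def)
    next
      case (5 l s3)
      have l3: "loaded d m A B w s3" using loaded_agree[OF 5(5) _ _ l2] by (simp add: For_def)
      have i: "fst s3 ''i'' 0 0 = k" and p: "fst s3 ''p'' 0 = p"
        using agreeN[OF 5(5), of "''i''"] agreeN[OF 5(5), of "''p''"] i2 p2 by (simp_all add: For_def)
      show ?case
        by (rule runs_straight) (use l3 i p 5 in \<open>auto simp: loaded_def upd_cell_apply collected_def less_Suc_eq\<close>)
    next
      case (6 s3)
      then show ?case using agreeN[OF 6(3), of "''i''"] i2 unfolding collected_def p_def
        by (auto simp: For_def less_Suc_eq)
    qed (use g2 r2 in \<open>simp_all add: collected_def\<close>)
  qed simp
qed (simp_all add: collected_def algebra_simps)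

lemma runs_copy_output:
  assumes l: "loaded d m A B w s"
  shows "runs copy_output s (12 + d * (50 + 70 * m)) (\<lambda>s'. \<forall>i<d. \<forall>j<m. fst s' ''Bs'' i j = fst s ''MB'' i j)"
  unfolding copy_output_def
proof (rule runs_For[where lo = 0 and hi = d and K = "30 + 70 * m" and
      P = "\<lambda>k s'. \<forall>i<k. \<forall>j<m. fst s' ''Bs'' i j = fst s ''MB'' i j"], goal_cases)
  case (4 s')
  from loaded_agree[OF this _ _ l] show ?case by (simp add: For_def loaded_def)
next
  case (5 k s1)
  have l1: "loaded d m A B w s1" using loaded_agree[OF 5(5) _ _ l] by (simp add: For_def)
  have M1: "fst s1 ''MB'' = fst s ''MB''" using agreeN[OF 5(5), of "''MB''"] by (simp add: For_def)
  have i1: "fst s1 ''i'' 0 0 = k" and g1: "\<forall>i<k. \<forall>j<m. fst s1 ''Bs'' i j = fst s ''MB'' i j" using 5 by simp_all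
  show ?case
  proof (rule runs_For[where lo = 0 and hi = m and K = 50 and
      P = "\<lambda>l s2. (\<forall>i<k. \<forall>j<m. fst s2 ''Bs'' i j = fst s ''MB'' i j) \<and> (\<forall>j<l. fst s2 ''Bs'' k j = fst s ''MB'' k j)"], goal_cases)
    case (4 s')
    from loaded_agree[OF this _ _ l1] show ?case by (simp add: For_def loaded_def)
  next
    case (5 l s2)
    have i: "fst s2 ''i'' 0 0 = k" and M: "fst s2 ''MB'' = fst s ''MB''"
      using agreeN[OF 5(5), of "''i''"] agreeN[OF 5(5), of "''MB''"] i1 M1 by (simp_all add: For_def)
    show ?case
      by (rule runs_straight) (use i M 5 in \<open>auto simp: upd_cell_apply less_Suc_eq\<close>)
  next
    case (6 s2)
    then show ?case using agreeN[OF 6(3), of "''i''"] i1 by (auto simp: For_def less_Suc_eq)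
  qed (use g1 in simp_all)
qed (simp_all add: algebra_simps)

text \<open>The cost matrix, assignment and potentials come from intermediate states. They are
  passed on as existential certificates, which is all that the optimality proof needs.\<close>

lemma runs_matching_program:
  assumes l: "loaded d m A B w s" and w: "\<And>i j. i < d \<Longrightarrow> j < m \<Longrightarrow> B i j = 1 \<Longrightarrow> 0 \<le> w i j"
  shows "runs matching_program s (5000 * (d + m + 1) ^ 3) (\<lambda>s'. \<exists>c p u v.
     graph_costs d m A B w (1 + total_cost d m B w) d c \<and> potentials d (d + m) c d p u v UNIV \<and>
     assigns d p {1..d + m} \<and> collected d m A B p d s' \<and> (\<forall>i<d. \<forall>j<m. fst s' ''Bs'' i j = fst s' ''MB'' i j))"
  (is "runs _ _ _ ?Q")
proof -
  define n where "n = d + m"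
  define W where "W = 1 + total_cost d m B w"
  have W: "0 \<le> W" unfolding W_def total_cost_def using w by (intro add_nonneg_nonneg sum_nonneg) auto
  let ?T = "(12 + d * (50 + 70 * (d + m))) + (12 + d * (50 + 70 * m))"
  have "runs matching_program s ((40 + 100 * d + 130 * (d * (d + m))) + (2000 * (n + 1) ^ 3 + ?T)) ?Q"
    unfolding matching_program_def
  proof (rule runs_Seq[OF runs_construct_graph[OF l]])
    fix s1 :: state
    assume "loaded d m A B w s1 \<and> graph_costs d m A B w (1 + total_cost d m B w) d (snd s1 ''c'')"
    then have l1: "loaded d m A B w s1" and g1: "graph_costs d m A B w W d (snd s1 ''c'')" by (simp_all add: W_def)
    have c: "0 \<le> snd s1 ''c'' r j" if "r \<in> {1..d}" "j \<in> {1..n}" for r j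
    proof -
      obtain i where i: "r = Suc i" "i < d" using \<open>r \<in> {1..d}\<close> by (cases r) auto
      show ?thesis
      proof (cases "j \<le> d")
        case True
        then obtain k where "j = Suc k" "k < d" using \<open>j \<in> {1..n}\<close> by (cases j) auto
        then show ?thesis using g1 i W by (simp add: graph_costs_def)
      next
        case False
        then obtain k where "j = Suc (d + k)" "k < m" using \<open>j \<in> {1..n}\<close> less_imp_Suc_add[of d j] by (auto simp: n_def)
        then show ?thesis using g1 i W w by (simp add: graph_costs_def)
      qed
    qed
    show "runs (hungarian ;; collect_matching ;; copy_output) s1 (2000 * (n + 1) ^ 3 + ?T) ?Q"
    proof (rule runs_Seq[OF runs_agree[OF runs_hungarian[OF c _ _ n_def]]])
      show "fst s1 ''d'' 0 0 = d" "fst s1 ''m'' 0 0 = m" using l1 by (simp_all add: loaded_def)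
      fix s2 :: state
      assume s2: "(potentials d n (snd s1 ''c'') d (fst s2 ''p'' 0) (snd s2 ''u'' 0) (snd s2 ''v'' 0) UNIV \<and>
          assigns d (fst s2 ''p'' 0) {1..n}) \<and> agree hungarian s1 s2"
      have l2: "loaded d m A B w s2"
        using loaded_agree[OF conjunct2[OF s2] _ _ l1] by (simp add: hungarian_def hungarian_insert_def hungarian_mods For_def)
      show "runs (collect_matching ;; copy_output) s2 ?T ?Q"
      proof (rule runs_Seq[OF runs_agree[OF runs_collect_matching[OF l2]]])
        fix s3 :: state
        assume s3: "collected d m A B (fst s2 ''p'' 0) d s3 \<and> agree collect_matching s2 s3"
        have l3: "loaded d m A B w s3"
          using loaded_agree[OF conjunct2[OF s3] _ _ l2] by (simp add: collect_matching_def For_def)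
        from runs_agree[OF runs_copy_output[OF l3]]
        show "runs copy_output s3 (12 + d * (50 + 70 * m)) ?Q"
        proof (rule runs_mono)
          fix s4 :: state
          assume s4: "(\<forall>i<d. \<forall>j<m. fst s4 ''Bs'' i j = fst s3 ''MB'' i j) \<and> agree copy_output s3 s4"
          then have "fst s4 ''MA'' = fst s3 ''MA''" "fst s4 ''MB'' = fst s3 ''MB''"
            by (auto simp: agree_def copy_output_def For_def)
          then have "collected d m A B (fst s2 ''p'' 0) d s4" "\<forall>i<d. \<forall>j<m. fst s4 ''Bs'' i j = fst s4 ''MB'' i j"
            using s3 s4 by (simp_all add: collected_def)
          then show "?Q s4" using s2 g1 unfolding n_def W_def by blast
        qed simp
      qed simp
    qed simp_all
  qed simp
  then show ?thesis
  proof (rule runs_mono)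
    define N where "N = n + 1"
    have le: "d \<le> N" "d + m \<le> N" "m \<le> N" "1 \<le> N" by (simp_all add: N_def n_def)
    have sq: "d * (d + m) \<le> N * N" "d * m \<le> N * N" "N \<le> N * N" using le by (auto intro: mult_le_mono)
    have "N * N \<le> N * N * N" using le by simp
    moreover have "(n + 1) ^ 3 = N * N * N" by (simp add: N_def power3_eq_cube)
    moreover have "d * (50 + 70 * (d + m)) = 50 * d + 70 * (d * (d + m))" "d * (50 + 70 * m) = 50 * d + 70 * (d * m)"
      by (simp_all add: algebra_simps)
    ultimately have "(40 + 100 * d + 130 * (d * (d + m))) + (2000 * (n + 1) ^ 3 + ?T) \<le> 5000 * (n + 1) ^ 3"
      using le sq by linarith
    then show "(40 + 100 * d + 130 * (d * (d + m))) + (2000 * (n + 1) ^ 3 + ?T) \<le> 5000 * (d + m + 1) ^ 3"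
      by (simp add: n_def)
  qed
qed

section \<open>Optimal assignments and matchings\<close>

text \<open>A matching becomes an injective map \<open>src\<close> on the rows it covers. This form
  serves both the decomposition into stems and cycles and the comparison with assignments.\<close>

lemma matching_rows:
  assumes M: "matching E M" and E: "E \<subseteq> {(x, V2 i) | x i. i < d}"
  obtains R src where "R \<subseteq> {..<d}" "M = (\<lambda>i. (src i, V2 i)) ` R" "inj_on src R" "card M = card R"
proof -
  define R where "R = {i. \<exists>x. (x, V2 i) \<in> M}"
  have "\<forall>i. \<exists>x. i \<in> R \<longrightarrow> (x, V2 i) \<in> M" by (auto simp: R_def)
  then obtain src where src: "\<And>i. i \<in> R \<Longrightarrow> (src i, V2 i) \<in> M" by metis
  have ME: "M \<subseteq> E" using M by (simp add: matching_def)
  have disj: "e = f" if "e \<in> M" "f \<in> M" "endpoints e \<inter> endpoints f \<noteq> {}" for e f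
    using M that unfolding matching_def by blast
  have "M = (\<lambda>i. (src i, V2 i)) ` R"
  proof
    show "(\<lambda>i. (src i, V2 i)) ` R \<subseteq> M" using src by blast
    show "M \<subseteq> (\<lambda>i. (src i, V2 i)) ` R"
    proof
      fix e assume e: "e \<in> M"
      then obtain x i where xi: "e = (x, V2 i)" using ME E by blast
      then have "i \<in> R" using e by (auto simp: R_def)
      then have "e = (src i, V2 i)" using disj[OF e src] xi by (simp add: endpoints_def)
      then show "e \<in> (\<lambda>i. (src i, V2 i)) ` R" using \<open>i \<in> R\<close> by blast
    qed
  qed
  moreover have "R \<subseteq> {..<d}" using ME E by (force simp: R_def)
  moreover have "inj_on src R"
  proof (rule inj_onI)
    fix i k assume "i \<in> R" "k \<in> R" "src i = src k"
    then have "(src i, V2 i) = (src k, V2 k)" by (intro disj src) (auto simp: endpoints_def)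
    then show "i = k" by simp
  qed
  moreover have "card ((\<lambda>i. (src i, V2 i)) ` R) = card R" by (rule card_image) (simp add: inj_on_def)
  ultimately show ?thesis using that by metis
qed

text \<open>Weak duality: the dual objective is attained by the tight assignment and bounds every
  other assignment from below.\<close>

lemma optimal_assignment:
  assumes pot: "potentials d n c d p u v UNIV" and as: "assigns d p {1..n}"
    and \<sigma>: "\<And>i. i < d \<Longrightarrow> \<sigma> i \<in> {1..n} \<and> p (\<sigma> i) = Suc i"
    and q: "inj_on q {..<d}" "q ` {..<d} \<subseteq> {1..n}"
  shows "(\<Sum>i<d. c (Suc i) (\<sigma> i)) \<le> (\<Sum>i<d. c (Suc i) (q i))"
proof -
  have "inj_on \<sigma> {..<d}"
  proof (rule inj_onI)
    fix i k assume ik: "i \<in> {..<d}" "k \<in> {..<d}" "\<sigma> i = \<sigma> k"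
    then have "p (\<sigma> i) = Suc i" "p (\<sigma> k) = Suc k" using \<sigma> by blast+
    then have "Suc i = Suc k" using ik(3) by metis
    then show "i = k" by simp
  qed
  have v0: "v j \<le> 0" if "j \<in> {1..n}" for j using pot that by (simp add: potentials_def)
  have "(\<Sum>i<d. c (Suc i) (\<sigma> i)) = (\<Sum>i<d. u (Suc i) + v (\<sigma> i))"
  proof (rule sum.cong)
    fix i assume i: "i \<in> {..<d}"
    then have "p (\<sigma> i) = Suc i" "\<sigma> i \<in> {1..n}" using \<sigma> by auto
    moreover have "if p (\<sigma> i) = 0 then v (\<sigma> i) = 0 else u (p (\<sigma> i)) + v (\<sigma> i) = c (p (\<sigma> i)) (\<sigma> i)"
      using pot \<open>\<sigma> i \<in> {1..n}\<close> unfolding potentials_def by blast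
    ultimately show "c (Suc i) (\<sigma> i) = u (Suc i) + v (\<sigma> i)" by simp
  qed simp
  also have "\<dots> = (\<Sum>i<d. u (Suc i)) + (\<Sum>j\<in>\<sigma> ` {..<d}. v j)"
    by (simp add: sum.distrib sum.reindex[OF \<open>inj_on \<sigma> {..<d}\<close>])
  also have "(\<Sum>j\<in>\<sigma> ` {..<d}. v j) = (\<Sum>j\<in>{1..n}. v j)"
  proof (rule sum.mono_neutral_left)
    show "\<forall>j\<in>{1..n} - \<sigma> ` {..<d}. v j = 0"
    proof
      fix j assume j: "j \<in> {1..n} - \<sigma> ` {..<d}"
      have "p j = 0"
      proof (rule ccontr)
        assume "p j \<noteq> 0"
        moreover have "p j \<le> d" using assigns_le[OF as] j by blast
        ultimately obtain i where i: "i < d" "p j = Suc i" by (cases "p j") auto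
        then have "j = \<sigma> i" using assigns_inj[OF as, of j "\<sigma> i"] \<sigma>[of i] j by auto
        then show False using j i by blast
      qed
      then show "v j = 0" using pot j by (auto simp: potentials_def)
    qed
  qed (use \<sigma> in auto)
  \<comment> \<open>Columns missed by \<open>q\<close> contribute nonpositive terms, so dropping
    them can only increase the sum.\<close>
  also have "(\<Sum>j\<in>{1..n}. v j) \<le> (\<Sum>j\<in>q ` {..<d}. v j)"
    using sum_mono2[of "{1..n}" "q ` {..<d}" "\<lambda>j. - v j"] q(2) v0 by (simp add: sum_negf)
  also have "(\<Sum>i<d. u (Suc i)) + (\<Sum>j\<in>q ` {..<d}. v j) = (\<Sum>i<d. u (Suc i) + v (q i))"
    by (simp add: sum.distrib sum.reindex[OF q(1)])
  also have "\<dots> \<le> (\<Sum>i<d. c (Suc i) (q i))"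
    using pot q(2) by (intro sum_mono) (auto simp: potentials_def image_subset_iff)
  finally show ?thesis by simp
qed

text \<open>A full assignment costs as much as the matching formed by its genuine edges, plus
  \<open>W\<close> for each remaining row. All edges together cost less than \<open>W\<close>, so
  one more matched row outweighs any difference in cost; at equal cardinality the penalties
  cancel.\<close>

lemma assignment_min_cost_max_matching:
  fixes cost :: "edge \<Rightarrow> real"
  assumes pot: "potentials d n c d p u v UNIV" and as: "assigns d p {1..n}" and dn: "d \<le> n"
    and src: "inj_on src {1..n}" "\<And>j k. src j \<noteq> V2 k"
    and E: "E \<subseteq> {(src j, V2 i) | i j. i < d \<and> j \<in> {1..n}}"
    and nonneg: "\<And>e. e \<in> E \<Longrightarrow> 0 \<le> cost e" and W: "sum cost E < W"
    and c: "\<And>i j. i < d \<Longrightarrow> j \<in> {1..n} \<Longrightarrow> c (Suc i) j = (if (src j, V2 i) \<in> E then cost (src j, V2 i) else W)"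
    and M: "M = {(src j, V2 i) | i j. i < d \<and> j \<in> {1..n} \<and> (src j, V2 i) \<in> E \<and> p j = Suc i}"
  shows "min_cost_max_matching E cost M"
proof -
  have finE: "finite E"
  proof (rule finite_subset)
    show "E \<subseteq> (\<lambda>(i, j). (src j, V2 i)) ` ({..<d} \<times> {1..n})" using E by fastforce
  qed simp
  have cW: "c (Suc i) j \<le> W" if "i < d" "j \<in> {1..n}" for i j
    using c[OF that] W member_le_sum[of "(src j, V2 i)" E cost] nonneg finE by auto
  have "\<forall>i. \<exists>j. i < d \<longrightarrow> j \<in> {1..n} \<and> p j = Suc i"
  proof
    fix i
    show "\<exists>j. i < d \<longrightarrow> j \<in> {1..n} \<and> p j = Suc i"
    proof (cases "i < d")
      case True
      then have "Suc i \<in> {1..d}" by simp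
      then show ?thesis using assigns_surj[OF as] by blast
    qed simp
  qed
  then obtain \<sigma> where \<sigma>: "\<And>i. i < d \<Longrightarrow> \<sigma> i \<in> {1..n} \<and> p (\<sigma> i) = Suc i"
    using choice[of "\<lambda>i j. i < d \<longrightarrow> j \<in> {1..n} \<and> p j = Suc i"] by blast
  define R where "R = {i. i < d \<and> (src (\<sigma> i), V2 i) \<in> E}"
  have uniq: "j = \<sigma> i" if "j \<in> {1..n}" "p j = Suc i" "i < d" for i j
    using assigns_inj[OF as, of j "\<sigma> i"] \<sigma>[of i] that by auto
  have MR: "M = (\<lambda>i. (src (\<sigma> i), V2 i)) ` R"
  proof
    show "M \<subseteq> (\<lambda>i. (src (\<sigma> i), V2 i)) ` R"
    proof
      fix e assume "e \<in> M"
      then obtain i j where "e = (src j, V2 i)" "i < d" "j \<in> {1..n}" "(src j, V2 i) \<in> E" "p j = Suc i"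
        unfolding M by blast
      then show "e \<in> (\<lambda>i. (src (\<sigma> i), V2 i)) ` R" using uniq[of j i] by (auto simp: R_def)
    qed
    show "(\<lambda>i. (src (\<sigma> i), V2 i)) ` R \<subseteq> M" using \<sigma> unfolding M R_def by blast
  qed
  have finR: "finite R" "R \<subseteq> {..<d}" by (auto simp: R_def)
  have injM: "inj_on (\<lambda>i. (src (\<sigma> i), V2 i)) R" by (simp add: inj_on_def)
  have cardM: "card M = card R" unfolding MR by (rule card_image[OF injM])
  have costM: "sum cost M + (d - card R) * W = (\<Sum>i<d. c (Suc i) (\<sigma> i))"
  proof -
    have "(\<Sum>i<d. c (Suc i) (\<sigma> i)) = (\<Sum>i\<in>R. c (Suc i) (\<sigma> i)) + (\<Sum>i\<in>{..<d} - R. c (Suc i) (\<sigma> i))"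
      using finR by (subst sum.subset_diff[of R]) auto
    also have "(\<Sum>i\<in>R. c (Suc i) (\<sigma> i)) = sum cost M"
      unfolding MR sum.reindex[OF injM] using \<sigma> c by (auto simp: R_def intro!: sum.cong)
    also have "(\<Sum>i\<in>{..<d} - R. c (Suc i) (\<sigma> i)) = (\<Sum>i\<in>{..<d} - R. W)"
      using \<sigma> c by (auto simp: R_def intro!: sum.cong)
    also have "\<dots> = (d - card R) * W" using finR by (simp add: card_Diff_subset)
    finally show ?thesis by simp
  qed
  have "matching E M"
    unfolding matching_def
  proof (intro conjI ballI impI)
    show "M \<subseteq> E" unfolding M by blast
    fix e f assume "e \<in> M" "f \<in> M" "e \<noteq> f"
    then obtain i k where ik: "e = (src (\<sigma> i), V2 i)" "f = (src (\<sigma> k), V2 k)" "i \<in> R" "k \<in> R" "i \<noteq> k"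
      unfolding MR by auto
    then have "\<sigma> i \<noteq> \<sigma> k" using \<sigma>[of i] \<sigma>[of k] by (auto simp: R_def)
    then have "src (\<sigma> i) \<noteq> src (\<sigma> k)" using src(1) \<sigma> ik by (auto simp: R_def inj_on_def)
    then show "endpoints e \<inter> endpoints f = {}" using ik src(2) by (auto simp: endpoints_def dest: sym)
  qed
  have cost_le: "0 \<le> sum cost N \<and> sum cost N < W" if "matching E N" for N
  proof -
    have "N \<subseteq> E" using that by (simp add: matching_def)
    then have "sum cost N \<le> sum cost E" using nonneg finE by (intro sum_mono2) auto
    moreover have "0 \<le> sum cost N" using nonneg \<open>N \<subseteq> E\<close> by (intro sum_nonneg) auto
    ultimately show ?thesis using W by linarith
  qed
  have key: "sum cost M + (d - card R) * W \<le> sum cost N + (d - card N) * W" "card N \<le> d" if N: "matching E N" for N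
  proof -
    have "E \<subseteq> {(x, V2 i) | x i. i < d}" using E by blast
    from matching_rows[OF N this] obtain S x where S: "S \<subseteq> {..<d}" "N = (\<lambda>i. (x i, V2 i)) ` S" "inj_on x S" "card N = card S" .
    have finS: "finite S" using S(1) finite_subset by blast
    have NE: "N \<subseteq> E" using N unfolding matching_def by blast
    have "\<forall>i. \<exists>j. i \<in> S \<longrightarrow> j \<in> {1..n} \<and> x i = src j"
    proof
      fix i
      show "\<exists>j. i \<in> S \<longrightarrow> j \<in> {1..n} \<and> x i = src j"
      proof (cases "i \<in> S")
        case True
        then have "(x i, V2 i) \<in> E" using NE S(2) by blast
        then show ?thesis using E by blast
      qed simp
    qed
    then obtain f where f: "\<And>i. i \<in> S \<Longrightarrow> f i \<in> {1..n} \<and> x i = src (f i)"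
      using choice[of "\<lambda>i j. i \<in> S \<longrightarrow> j \<in> {1..n} \<and> x i = src j"] by blast
    have injf: "inj_on f S" using S(3) f by (auto simp: inj_on_def)
    have fS: "f ` S \<subseteq> {1..n}" using f by auto
    \<comment> \<open>As \<open>d \<le> n\<close>, there are enough spare columns to extend any
      matching to an assignment of all rows.\<close>
    have "card ({..<d} - S) \<le> card ({1..n} - f ` S)"
      using S(1) finS fS dn card_image[OF injf] by (simp add: card_Diff_subset)
    then obtain g where g: "g ` ({..<d} - S) \<subseteq> {1..n} - f ` S" "inj_on g ({..<d} - S)"
      using card_le_inj[of "{..<d} - S" "{1..n} - f ` S"] by auto
    define q where "q i = (if i \<in> S then f i else g i)" for i
    have q: "inj_on q {..<d}" "q ` {..<d} \<subseteq> {1..n}"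
    proof -
      show "q ` {..<d} \<subseteq> {1..n}" using fS g(1) by (auto simp: q_def)
      have "g i \<notin> f ` S" if "i < d" "i \<notin> S" for i using g(1) that by blast
      then have gf: "g k \<noteq> f i" if "i \<in> S" "k < d" "k \<notin> S" for i k using that by blast
      show "inj_on q {..<d}"
      proof (rule inj_onI)
        fix i k assume ik: "i \<in> {..<d}" "k \<in> {..<d}" "q i = q k"
        show "i = k"
        proof (cases "i \<in> S"; cases "k \<in> S")
          assume "i \<in> S" "k \<in> S"
          then show ?thesis using ik(3) inj_onD[OF injf, of i k] by (simp add: q_def)
        next
          assume "i \<in> S" "k \<notin> S"
          then show ?thesis using ik gf[of i k] by (simp add: q_def)
        next
          assume "i \<notin> S" "k \<in> S"
          then show ?thesis using ik gf[of k i] by (simp add: q_def)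
        next
          assume "i \<notin> S" "k \<notin> S"
          then show ?thesis using ik inj_onD[OF g(2), of i k] by (simp add: q_def)
        qed
      qed
    qed
    have "(\<Sum>i<d. c (Suc i) (q i)) = (\<Sum>i\<in>S. c (Suc i) (q i)) + (\<Sum>i\<in>{..<d} - S. c (Suc i) (q i))"
      using S(1) by (subst sum.subset_diff[of S]) auto
    also have "(\<Sum>i\<in>S. c (Suc i) (q i)) = sum cost N"
    proof -
      have "inj_on (\<lambda>i. (x i, V2 i)) S" by (simp add: inj_on_def)
      moreover have "c (Suc i) (q i) = cost (x i, V2 i)" if "i \<in> S" for i
      proof -
        have "(x i, V2 i) \<in> E" using that NE S(2) by blast
        then have "(src (f i), V2 i) \<in> E" using f[OF that] by simp
        then show ?thesis using that f[OF that] S(1) c[of i "f i"] by (auto simp: q_def)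
      qed
      ultimately show ?thesis unfolding S(2) by (simp add: sum.reindex)
    qed
    \<comment> \<open>Only an inequality holds, because a spare column may happen to form a genuine
      edge with the row it receives.\<close>
    also have "(\<Sum>i\<in>{..<d} - S. c (Suc i) (q i)) \<le> (\<Sum>i\<in>{..<d} - S. W)"
      using cW q(2) by (intro sum_mono) auto
    also have "\<dots> = (d - card N) * W" using S finS by (simp add: card_Diff_subset)
    finally have "(\<Sum>i<d. c (Suc i) (q i)) \<le> sum cost N + (d - card N) * W" by simp
    then show "sum cost M + (d - card R) * W \<le> sum cost N + (d - card N) * W"
      using optimal_assignment[OF pot as \<sigma> q] costM by linarith
    show "card N \<le> d" using card_mono[OF _ S(1)] S(4) by simp
  qed
  \<comment> \<open>A larger matching would save a penalty of at least \<open>W\<close>, whereas the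
    edge costs of two matchings differ by less than \<open>W\<close>.\<close>
  have "card N \<le> card M" if N: "matching E N" for N
  proof (rule ccontr)
    assume "\<not> ?thesis"
    then obtain e where e: "d - card R = (d - card N) + e" "1 \<le> e"
      using cardM key(2)[OF N] that[of "card N - card R"] by auto
    moreover have "W \<ge> 0" using cost_le[OF N] by linarith
    then have "W \<le> e * W" using mult_right_mono[of 1 "real e" W] e(2) by simp
    moreover have "(d - card R) * W = (d - card N) * W + e * W" unfolding e(1) of_nat_add by (rule distrib_right)
    ultimately have "(d - card N) * W + W \<le> (d - card R) * W" by linarith
    then show False using key(1)[OF N] cost_le[OF N] cost_le[OF \<open>matching E M\<close>] by linarith
  qed
  then have max: "max_matching E M" using \<open>matching E M\<close> by (simp add: max_matching_def)
  have "sum cost M \<le> sum cost N" if N: "max_matching E N" for N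
  proof -
    have "matching E N" "card N = card M" using N max by (auto simp: max_matching_def intro: antisym)
    then show ?thesis using key(1)[of N] cardM by simp
  qed
  then show ?thesis using max by (simp add: min_cost_max_matching_def)
qed

section \<open>Optimality of the matching algorithm\<close>

lemma structurally_controllable_imp_matching:
  assumes A: "A \<in> carrier_mat d d" and B: "B \<in> carrier_mat d m" and sc: "structurally_controllable A B"
  shows "\<exists>N. matching (edges_A A \<union> edges_B B) N \<and> card N = d"
proof -
  obtain A' B' where real: "realization A A'" "realization B B'" and ctrl: "controllable A' B'"
    using sc unfolding structurally_controllable_def by blast
  have A': "A' \<in> carrier_mat d d" "\<And>i j. i < d \<Longrightarrow> j < d \<Longrightarrow> A $$ (i, j) = Zero \<Longrightarrow> A' $$ (i, j) = 0"
    and B': "B' \<in> carrier_mat d m" "\<And>i j. i < d \<Longrightarrow> j < m \<Longrightarrow> B $$ (i, j) = Zero \<Longrightarrow> B' $$ (i, j) = 0"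
    using real A B unfolding realization_def by auto
  \<comment> \<open>The columns of \<open>[A' B']\<close> are indexed by graph vertices, so an
    injective choice of nonzero entries is already a choice of matching edges.\<close>
  define a where "a i x = (case x of V1 j \<Rightarrow> A' $$ (i, j) | V2 j \<Rightarrow> 0 | U k \<Rightarrow> B' $$ (i, k))" for i x
  have "\<exists>f. inj_on f {..<d} \<and> (\<forall>i\<in>{..<d}. f i \<in> V1 ` {..<d} \<union> U ` {..<m} \<and> a i (f i) \<noteq> 0)"
  proof (rule rows_independent_imp_matching)
    fix y assume y: "\<And>x. x \<in> V1 ` {..<d} \<union> U ` {..<m} \<Longrightarrow> (\<Sum>i\<in>{..<d}. y i * a i x) = 0"
    have "\<forall>i<d. y i = 0"
    proof (rule controllable_imp_rows_independent[OF A'(1) B'(1) ctrl])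
      show "(\<Sum>i<d. y i * A' $$ (i, j)) = 0" if "j < d" for j using y[of "V1 j"] that by (simp add: a_def)
      show "(\<Sum>i<d. y i * B' $$ (i, k)) = 0" if "k < m" for k using y[of "U k"] that by (simp add: a_def)
    qed
    then show "\<forall>i\<in>{..<d}. y i = 0" by blast
  qed auto
  then obtain f where inj: "inj_on f {..<d}"
    and f: "\<And>i. i < d \<Longrightarrow> f i \<in> V1 ` {..<d} \<union> U ` {..<m}" "\<And>i. i < d \<Longrightarrow> a i (f i) \<noteq> 0" by blast
  have E: "(f i, V2 i) \<in> edges_A A \<union> edges_B B" if i: "i < d" for i
  proof -
    consider j where "f i = V1 j" "j < d" | k where "f i = U k" "k < m" using f(1)[OF i] by blast
    then show ?thesis
    proof cases
      case 1
      then have "A $$ (i, j) \<noteq> Zero" using f(2)[OF i] A'(2)[OF i] by (auto simp: a_def)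
      then show ?thesis using 1 i A by (auto simp: edges_A_def)
    next
      case 2
      then have "B $$ (i, k) \<noteq> Zero" using f(2)[OF i] B'(2)[OF i] by (auto simp: a_def)
      then show ?thesis using 2 i B by (auto simp: edges_B_def)
    qed
  qed
  define N where "N = (\<lambda>i. (f i, V2 i)) ` {..<d}"
  have "endpoints (f i, V2 i) \<inter> endpoints (f k, V2 k) = {}" if "i < d" "k < d" "i \<noteq> k" for i k
  proof -
    have "f i \<noteq> f k" using inj_onD[OF inj, of i k] that by auto
    then show ?thesis using f(1)[OF that(1)] f(1)[OF that(2)] that(3) by (auto simp: endpoints_def)
  qed
  then have "matching (edges_A A \<union> edges_B B) N"
    using E unfolding matching_def N_def by (auto simp del: Un_iff)
  moreover have "card N = d" unfolding N_def by (subst card_image) (auto simp: inj_on_def)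
  ultimately show ?thesis by blast
qed

lemma rtrancl_on_leaves:
  assumes "(a, b) \<in> rtrancl_on F r" "a \<in> S" "b \<notin> S"
  shows "\<exists>p\<in>S. \<exists>c. c \<notin> S \<and> c \<in> F \<and> (p, c) \<in> r"
  using assms
proof (induction rule: rtrancl_on.induct)
  case rtrancl_on_into_rtrancl_on
  then show ?case by metis
qed simp

lemma saturating_matching_imp_structurally_controllable:
  assumes A: "A \<in> carrier_mat d d" and B: "B \<in> carrier_mat d m"
    and sc: "strongly_connected (state_digraph A)"
    and M: "M = (\<lambda>i. (src i, V2 i)) ` {..<d}" "M \<subseteq> edges_A A \<union> edges_B B" "inj_on src {..<d}"
    and h: "h < d" "src h \<notin> range V1"
  shows "structurally_controllable A (pattern_of_matching d m M)"
proof -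
  define E where "E = {(j, i). i < d \<and> j < d \<and> A $$ (i, j) \<noteq> Zero}"
  have srcE: "(src i, V2 i) \<in> edges_A A \<union> edges_B B" if "i < d" for i using M that by blast
  have V1: "(j, i) \<in> E \<and> j < d" if "i < d" "src i = V1 j" for i j
    using srcE[OF that(1)] that A by (auto simp: edges_A_def edges_B_def E_def)
  have U: "\<exists>k<m. src i = U k" if "i < d" "src i \<notin> range V1" for i
    using srcE[OF that(1)] that B by (auto simp: edges_A_def edges_B_def)
  have conn: "\<exists>p\<in>S. \<exists>c\<in>{..<d} - S. (p, c) \<in> E" if S: "h \<in> S" "S \<subset> {..<d}" for S
  proof -
    obtain b where b: "b < d" "b \<notin> S" using S by blast
    have verts: "verts (state_digraph A) = {..<d}" using A by (simp add: state_digraph_def)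
    have ends: "arcs_ends (state_digraph A) = E"
      using A by (force simp: state_digraph_def arcs_ends_def arc_to_ends_def E_def)
    have "h \<rightarrow>\<^sup>*\<^bsub>state_digraph A\<^esub> b" using sc h(1) b verts unfolding strongly_connected_def by blast
    then have "(h, b) \<in> rtrancl_on {..<d} E" unfolding reachable_def verts ends .
    from rtrancl_on_leaves[OF this S(1) b(2)] show ?thesis by blast
  qed
  obtain a :: "nat \<Rightarrow> nat \<Rightarrow> real" where a: "\<And>i j. a i j \<noteq> 0 \<Longrightarrow> (j, i) \<in> E"
    and hautus: "\<And>y (l :: complex). (\<forall>i<d. src i \<notin> range V1 \<longrightarrow> y i = 0) \<Longrightarrow>
        (\<forall>j<d. (\<Sum>i<d. y i * of_real (a i j)) = l * y j) \<Longrightarrow> (\<forall>i<d. y i = 0)"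
    using exists_Hautus_realization[OF M(3) V1 h conn] by blast
  define A' where "A' = mat d d (\<lambda>(i, j). a i j)"
  define B' :: "real mat" where "B' = mat d m (\<lambda>(i, k). if src i = U k then 1 else 0)"
  have "controllable A' B'"
  proof (rule Hautus_imp_controllable)
    show "A' \<in> carrier_mat d d" "B' \<in> carrier_mat d m" by (simp_all add: A'_def B'_def)
    fix y and l :: complex
    assume yA: "\<And>j. j < d \<Longrightarrow> (\<Sum>i<d. y i * of_real (A' $$ (i, j))) = l * y j"
      and yB: "\<And>k. k < m \<Longrightarrow> (\<Sum>i<d. y i * of_real (B' $$ (i, k))) = 0"
    show "\<forall>i<d. y i = 0"
    proof (rule hautus)
      show "\<forall>i<d. src i \<notin> range V1 \<longrightarrow> y i = 0"
      proof (intro allI impI)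
        fix i assume i: "i < d" "src i \<notin> range V1"
        then obtain k where k: "k < m" "src i = U k" using U by blast
        \<comment> \<open>By injectivity of \<open>src\<close>, input \<open>k\<close> drives
          exactly one state, so its column isolates \<open>y i\<close>.\<close>
        have "(\<Sum>l<d. y l * of_real (B' $$ (l, k))) = (\<Sum>l<d. if l = i then y i else 0)"
        proof (rule sum.cong)
          fix l assume l: "l \<in> {..<d}"
          have "src l = U k \<longleftrightarrow> l = i" using M(3) l i k by (auto simp: inj_on_def)
          then show "y l * of_real (B' $$ (l, k)) = (if l = i then y i else 0)" using l k by (simp add: B'_def)
        qed simp
        then show "y i = 0" using yB[OF k(1)] i by simp
      qed
      show "\<forall>j<d. (\<Sum>i<d. y i * of_real (a i j)) = l * y j"
      proof (intro allI impI)
        fix j assume j: "j < d"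
        then have "(\<Sum>i<d. y i * of_real (a i j)) = (\<Sum>i<d. y i * of_real (A' $$ (i, j)))"
          by (intro sum.cong) (simp_all add: A'_def)
        then show "(\<Sum>i<d. y i * of_real (a i j)) = l * y j" using yA[OF j] by simp
      qed
    qed
  qed
  moreover have "realization A A'" using A a by (fastforce simp: realization_def A'_def E_def)
  moreover have "(U k, V2 i) \<in> M" if "i < d" "src i = U k" for i k
    unfolding M(1) by (rule image_eqI[of _ _ i]) (use that in simp_all)
  then have "realization (pattern_of_matching d m M) B'"
    unfolding realization_def pattern_of_matching_def B'_def by (auto split: if_splits)
  ultimately show ?thesis unfolding structurally_controllable_def by blast
qed

lemma weight_pattern_of_matching:
  assumes M: "M \<subseteq> edges_A A \<union> edges_B B" "finite M" and B: "B \<in> carrier_mat d m"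
  shows "weight w (pattern_of_matching d m M) = sum (edge_cost w) M"
proof -
  let ?I = "{(i, j). i < d \<and> j < m \<and> (U j, V2 i) \<in> M}"
  have "weight w (pattern_of_matching d m M) = (\<Sum>(i, j)\<in>?I. w $$ (i, j))"
    unfolding weight_def by (rule sum.cong) (auto simp: pattern_of_matching_def split: if_splits)
  also have "\<dots> = sum (edge_cost w) ((\<lambda>(i, j). (U j, V2 i)) ` ?I)"
    by (subst sum.reindex) (auto simp: inj_on_def intro!: sum.cong)
  also have "\<dots> = sum (edge_cost w) M"
  proof (rule sum.mono_neutral_left[OF M(2)])
    show "\<forall>e\<in>M - (\<lambda>(i, j). (U j, V2 i)) ` ?I. edge_cost w e = 0"
    proof
      fix e assume e: "e \<in> M - (\<lambda>(i, j). (U j, V2 i)) ` ?I"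
      have "e \<notin> edges_B B"
      proof
        assume "e \<in> edges_B B"
        then obtain i j where "e = (U j, V2 i)" "i < d" "j < m" using B by (auto simp: edges_B_def)
        then show False using e by (auto simp: image_iff)
      qed
      then have "e \<in> edges_A A" using e M(1) by blast
      then show "edge_cost w e = 0" by (auto simp: edges_A_def)
    qed
  qed auto
  finally show ?thesis .
qed

text \<open>State edges are free and the input edges kept by \<open>N\<close> are among those of
  \<open>B\<close>. Applied to a matching, this bounds the weight of a competing pattern from below;
  applied to the whole edge set, it shows that the penalty exceeds the total edge cost.\<close>

lemma matching_cost_le_weight:
  assumes N: "N \<subseteq> edges_A A \<union> edges_B B" "finite N"
    and w: "\<And>i j. i < dim_row B \<Longrightarrow> j < dim_col B \<Longrightarrow> B $$ (i, j) \<noteq> Zero \<Longrightarrow> 0 \<le> w $$ (i, j)"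
  shows "sum (edge_cost w) N \<le> weight w B"
proof -
  let ?I = "{(i, j). i < dim_row B \<and> j < dim_col B \<and> B $$ (i, j) \<noteq> Zero}"
  have fin: "finite ?I" by (rule finite_subset[of _ "{..<dim_row B} \<times> {..<dim_col B}"]) auto
  have img: "edges_B B = (\<lambda>(i, j). (U j, V2 i)) ` ?I" by (auto simp: edges_B_def)
  have "sum (edge_cost w) N = sum (edge_cost w) (N \<inter> edges_B B)"
    by (rule sum.mono_neutral_right) (use N in \<open>auto simp: edges_A_def\<close>)
  also have "\<dots> \<le> sum (edge_cost w) (edges_B B)"
    by (rule sum_mono2) (use fin w in \<open>auto simp: img\<close>)
  also have "\<dots> = weight w B"
    unfolding img weight_def by (subst sum.reindex) (auto simp: inj_on_def intro!: sum.cong)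
  finally show ?thesis .
qed

lemma edges_rows: "edges_A A \<union> edges_B B \<subseteq> {(x, V2 i) | x i. i < d}" if "dim_row A = d" "dim_row B = d"
  using that by (auto simp: edges_A_def edges_B_def)

lemma weight_eq_sum:
  assumes "B \<in> carrier_mat d m"
  shows "weight w B = (\<Sum>i<d. \<Sum>j<m. if B $$ (i, j) \<noteq> Zero then w $$ (i, j) else 0)"
proof -
  have "weight w B = (\<Sum>(i, j)\<in>{..<d} \<times> {..<m}. if B $$ (i, j) \<noteq> Zero then w $$ (i, j) else 0)"
    unfolding weight_def by (rule sum.mono_neutral_cong_left) (use assms in auto)
  then show ?thesis by (simp add: sum.cartesian_product)
qed

lemma output_matching_min_cost:
  assumes AB: "A \<in> carrier_mat d d" "B \<in> carrier_mat d m"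
    and w: "\<forall>i<d. \<forall>j<m. B $$ (i, j) \<noteq> Zero \<longrightarrow> 0 \<le> w $$ (i, j)"
    and A0: "\<And>i j. i < d \<Longrightarrow> j < d \<Longrightarrow> A0 i j = (if A $$ (i, j) = Zero then 0 else 1)"
    and B0: "\<And>i j. i < d \<Longrightarrow> j < m \<Longrightarrow> B0 i j = (if B $$ (i, j) = Zero then 0 else 1)"
    and w0: "\<And>i j. i < d \<Longrightarrow> j < m \<Longrightarrow> w0 i j = w $$ (i, j)"
    and g: "graph_costs d m A0 B0 w0 (1 + total_cost d m B0 w0) d c"
    and pot: "potentials d (d + m) c d p u v UNIV" and as: "assigns d p {1..d + m}"
    and col: "collected d m A0 B0 p d s"
  shows "min_cost_max_matching (edges_A A \<union> edges_B B) (edge_cost w) (output_matching d m s)"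
proof -
  define n where "n = d + m"
  \<comment> \<open>Translation of program columns into vertices: columns \<open>1..d\<close> are
    states and the following \<open>m\<close> are inputs, hence the offsets by one.\<close>
  define src where "src j = (if j \<le> d then V1 (j - 1) else U (j - d - 1))" for j
  define E where "E = edges_A A \<union> edges_B B"
  have srcS: "src (Suc k) = V1 k" if "k < d" for k using that by (simp add: src_def)
  have srcU: "src (Suc (d + k)) = U k" for k by (simp add: src_def)
  have column: "(\<exists>k<d. j = Suc k) \<or> (\<exists>k<m. j = Suc (d + k))" if "j \<in> {1..n}" for j
  proof (cases "j \<le> d")
    case True
    then show ?thesis using that by (intro disjI1 exI[of _ "j - 1"]) auto
  next
    case False
    then show ?thesis using that by (intro disjI2 exI[of _ "j - d - 1"]) (auto simp: n_def)
  qed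
  have EA: "(V1 k, V2 i) \<in> E \<longleftrightarrow> A0 i k = 1" if "i < d" "k < d" for i k
    using that AB A0[OF that] by (auto simp: E_def edges_A_def edges_B_def)
  have EB: "(U k, V2 i) \<in> E \<longleftrightarrow> B0 i k = 1" if "i < d" "k < m" for i k
    using that AB B0[OF that] by (auto simp: E_def edges_A_def edges_B_def)
  have Ecases: "(\<exists>i<d. \<exists>k<d. e = (V1 k, V2 i)) \<or> (\<exists>i<d. \<exists>k<m. e = (U k, V2 i))" if "e \<in> E" for e
    using that AB by (auto simp: E_def edges_A_def edges_B_def)
  have "finite E"
  proof (rule finite_subset)
    show "E \<subseteq> (V1 ` {..<d} \<union> U ` {..<m}) \<times> V2 ` {..<d}" using Ecases by fastforce
  qed simp
  have total: "total_cost d m B0 w0 = weight w B"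
    unfolding weight_eq_sum[OF AB(2)] total_cost_def
    by (intro sum.cong refl) (use B0 w0 in auto)
  have "sum (edge_cost w) E \<le> weight w B"
    by (rule matching_cost_le_weight[of E A B]) (use \<open>finite E\<close> w AB in \<open>auto simp: E_def\<close>)
  then have W: "sum (edge_cost w) E < 1 + total_cost d m B0 w0" using total by simp
  have "min_cost_max_matching E (edge_cost w) (output_matching d m s)"
  proof (rule assignment_min_cost_max_matching[where src = src, OF pot[folded n_def] as[folded n_def] _ _ _ _ _ W])
    show "d \<le> n" by (simp add: n_def)
    show "inj_on src {1..n}" by (auto simp: inj_on_def src_def split: if_splits)
    show "src j \<noteq> V2 k" for j k by (simp add: src_def)
    show "E \<subseteq> {(src j, V2 i) |i j. i < d \<and> j \<in> {1..n}}"
    proof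
      fix e assume "e \<in> E"
      from Ecases[OF this] show "e \<in> {(src j, V2 i) |i j. i < d \<and> j \<in> {1..n}}"
      proof (elim disjE exE conjE)
        fix i k assume "i < d" "k < d" "e = (V1 k, V2 i)"
        then have "e = (src (Suc k), V2 i) \<and> i < d \<and> Suc k \<in> {1..n}" by (simp add: srcS n_def)
        then show ?thesis by blast
      next
        fix i k assume "i < d" "k < m" "e = (U k, V2 i)"
        then have "e = (src (Suc (d + k)), V2 i) \<and> i < d \<and> Suc (d + k) \<in> {1..n}" by (simp add: srcU n_def)
        then show ?thesis by blast
      qed
    qed
    show "0 \<le> edge_cost w e" if "e \<in> E" for e
      using that w AB by (auto simp: E_def edges_A_def edges_B_def)
    show "c (Suc i) j = (if (src j, V2 i) \<in> E then edge_cost w (src j, V2 i) else 1 + total_cost d m B0 w0)"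
      if ij: "i < d" "j \<in> {1..n}" for i j
      using column[OF ij(2)]
    proof (elim disjE exE conjE)
      fix k assume k: "k < d" "j = Suc k"
      have "c (Suc i) (Suc k) = (if A0 i k = 1 then 0 else 1 + total_cost d m B0 w0)"
        using g ij(1) k(1) unfolding graph_costs_def by blast
      then show ?thesis by (simp add: k(2) srcS[OF k(1)] EA[OF ij(1) k(1)])
    next
      fix k assume k: "k < m" "j = Suc (d + k)"
      have "c (Suc i) (Suc (d + k)) = (if B0 i k = 1 then w0 i k else 1 + total_cost d m B0 w0)"
        using g ij(1) k(1) unfolding graph_costs_def by blast
      then show ?thesis by (simp add: k(2) srcU EB[OF ij(1) k(1)] w0[OF ij(1) k(1)])
    qed
    have MA: "fst s ''MA'' i k = 1 \<longleftrightarrow> (V1 k, V2 i) \<in> E \<and> p (Suc k) = Suc i" if "i < d" "k < d" for i k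
      using col that EA[OF that] unfolding collected_def by simp
    have MB: "fst s ''MB'' i k = 1 \<longleftrightarrow> (U k, V2 i) \<in> E \<and> p (Suc (d + k)) = Suc i" if "i < d" "k < m" for i k
      using col that EB[OF that] unfolding collected_def by simp
    show "output_matching d m s = {(src j, V2 i) |i j. i < d \<and> j \<in> {1..n} \<and> (src j, V2 i) \<in> E \<and> p j = Suc i}"
      (is "_ = ?R")
    proof (intro equalityI subsetI)
      fix e assume "e \<in> output_matching d m s"
      then consider i k where "e = (V1 k, V2 i)" "i < d" "k < d" "fst s ''MA'' i k = 1"
        | i k where "e = (U k, V2 i)" "i < d" "k < m" "fst s ''MB'' i k = 1"
        unfolding output_matching_def by blast
      then show "e \<in> ?R"
      proof cases
        case 1
        then have "e = (src (Suc k), V2 i) \<and> i < d \<and> Suc k \<in> {1..n} \<and> (src (Suc k), V2 i) \<in> E \<and> p (Suc k) = Suc i"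
          using MA[of i k] by (simp add: srcS n_def)
        then show ?thesis by blast
      next
        case 2
        then have "e = (src (Suc (d + k)), V2 i) \<and> i < d \<and> Suc (d + k) \<in> {1..n} \<and> (src (Suc (d + k)), V2 i) \<in> E \<and> p (Suc (d + k)) = Suc i"
          using MB[of i k] by (simp add: srcU n_def)
        then show ?thesis by blast
      qed
    next
      fix e assume "e \<in> ?R"
      then obtain i j where e: "e = (src j, V2 i)" "i < d" "j \<in> {1..n}" "(src j, V2 i) \<in> E" "p j = Suc i" by blast
      from column[OF e(3)] show "e \<in> output_matching d m s"
      proof (elim disjE exE conjE)
        fix k assume k: "k < d" "j = Suc k"
        then show ?thesis using e MA[OF e(2) k(1)] by (simp add: output_matching_def srcS)
      next
        fix k assume k: "k < m" "j = Suc (d + k)"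
        then show ?thesis using e MB[OF e(2) k(1)] by (simp add: output_matching_def srcU)
      qed
    qed
  qed
  then show ?thesis by (simp add: E_def)
qed

lemma matching_program_correct:
  assumes d: "0 < d" and AB: "A \<in> carrier_mat d d" "B \<in> carrier_mat d m"
    and w: "\<forall>i<d. \<forall>j<m. B $$ (i, j) \<noteq> Zero \<longrightarrow> 0 \<le> w $$ (i, j)"
    and s: "input_state d m A B w s"
  shows "\<exists>t s'. exec matching_program s t s' \<and> t \<le> 40000 * (d + m) ^ 3 \<and>
    matching_algorithm d m A B w (output_matching d m s') (output_matrix d m s')"
proof -
  define A0 where "A0 = fst s ''A''"
  define B0 where "B0 = fst s ''B''"
  define w0 where "w0 = snd s ''w''"
  have A0: "A0 i j = (if A $$ (i, j) = Zero then 0 else 1)" if "i < d" "j < d" for i j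
    using s that by (simp add: input_state_def A0_def)
  have B0: "B0 i j = (if B $$ (i, j) = Zero then 0 else 1)" if "i < d" "j < m" for i j
    using s that by (simp add: input_state_def B0_def)
  have w0: "w0 i j = w $$ (i, j)" if "i < d" "j < m" for i j
    using s that by (simp add: input_state_def w0_def)
  have loaded: "loaded d m A0 B0 w0 s" using s by (simp add: loaded_def input_state_def A0_def B0_def w0_def)
  have "0 \<le> w0 i j" if "i < d" "j < m" "B0 i j = 1" for i j
  proof -
    have "B $$ (i, j) \<noteq> Zero" using that(3) B0[OF that(1,2)] by (cases "B $$ (i, j) = Zero") simp_all
    then show ?thesis using w that(1,2) w0[OF that(1,2)] by simp
  qed
  from runs_matching_program[OF loaded this]
  obtain t s' c p u v where run: "exec matching_program s t s'" "t \<le> 5000 * (d + m + 1) ^ 3"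
    and out: "graph_costs d m A0 B0 w0 (1 + total_cost d m B0 w0) d c" "potentials d (d + m) c d p u v UNIV"
     "assigns d p {1..d + m}" "collected d m A0 B0 p d s'" "\<forall>i<d. \<forall>j<m. fst s' ''Bs'' i j = fst s' ''MB'' i j"
    unfolding runs_def by blast
  \<comment> \<open>As \<open>0 < d\<close>, the summand 1 is absorbed by doubling
    \<open>d + m\<close>; the cube gives a factor 8, whence 40000 from 5000.\<close>
  have "(d + m + 1) ^ 3 \<le> (2 * (d + m)) ^ 3" by (rule power_mono) (use d in auto)
  also have "\<dots> = 8 * (d + m) ^ 3" unfolding power_mult_distrib by simp
  finally have "t \<le> 40000 * (d + m) ^ 3" using run(2) by linarith
  moreover have "output_matrix d m s' = pattern_of_matching d m (output_matching d m s')"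
    unfolding output_matrix_def pattern_of_matching_def
    by (rule cong_mat) (use out(5) in \<open>auto simp: output_matching_def\<close>)
  moreover have "min_cost_max_matching (edges_A A \<union> edges_B B) (edge_cost w) (output_matching d m s')"
    by (rule output_matching_min_cost[OF AB w A0 B0 w0 out(1-4)])
  ultimately show ?thesis using run(1) unfolding matching_algorithm_def by blast
qed

lemma matching_algorithm_optimal:
  assumes A: "A \<in> carrier_mat d d" and B: "B \<in> carrier_mat d m"
    and sc: "structurally_controllable A B"
    and w: "\<forall>i<d. \<forall>j<m. B $$ (i, j) \<noteq> Zero \<longrightarrow> 0 \<le> w $$ (i, j)"
    and conn: "strongly_connected (state_digraph A)"
    and no_perfect: "\<not> (\<exists>M. perfect_matching (vertices_A A) (edges_A A) M)"
    and alg: "matching_algorithm d m A B w M Bs"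
  shows "structurally_controllable A Bs \<and> is_arg_min (weight w) (\<lambda>B'. B' \<in> feasible A B) Bs"
proof -
  let ?E = "edges_A A \<union> edges_B B"
  have max: "matching ?E M" "\<And>N. matching ?E N \<Longrightarrow> card N \<le> card M"
    and min: "\<And>N. max_matching ?E N \<Longrightarrow> sum (edge_cost w) M \<le> sum (edge_cost w) N"
    and Bs: "Bs = pattern_of_matching d m M"
    using alg by (auto simp: matching_algorithm_def min_cost_max_matching_def max_matching_def)
  have dims: "dim_row A = d" "dim_col A = d" "dim_row B = d" "dim_col B = m" using A B by auto
  from matching_rows[OF max(1) edges_rows[OF dims(1,3)]]
  obtain R src where R: "R \<subseteq> {..<d}" "M = (\<lambda>i. (src i, V2 i)) ` R" "inj_on src R" "card M = card R" .
  obtain N where "matching ?E N" "card N = d" using structurally_controllable_imp_matching[OF A B sc] by blast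
  then have "d \<le> card R" using max(2) R(4) by force
  then have Rd: "R = {..<d}" using R(1) by (intro card_subset_eq) (auto intro: antisym card_mono[of "{..<d}" R, simplified])
  have cardM: "card M = d" and finM: "finite M" using R Rd by auto
  have ME: "M \<subseteq> ?E" using max(1) by (simp add: matching_def)
  have srcM: "(src i, V2 i) \<in> M" if "i < d" for i using R(2) Rd that by blast
  \<comment> \<open>If every state were matched from a state, \<open>src\<close> would map
    \<open>d\<close> states injectively into \<open>d\<close> vertices, hence onto them, and
    \<open>M\<close> would be perfect in the state graph.\<close>
  have "\<exists>h<d. src h \<notin> range V1"
  proof (rule ccontr)
    assume "\<not> ?thesis"
    then have V1: "\<exists>j. src i = V1 j" if "i < d" for i using that by blast
    have edge: "(src i, V2 i) \<in> edges_A A" if "i < d" for i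
      using srcM[OF that] ME V1[OF that] by (auto simp: edges_B_def)
    then have sub: "src ` {..<d} \<subseteq> V1 ` {..<d}" by (fastforce simp: edges_A_def dims)
    have "card (src ` {..<d}) = card (V1 ` {..<d})"
      using R(3) Rd by (simp add: card_image inj_on_def)
    then have onto: "src ` {..<d} = V1 ` {..<d}" using sub by (intro card_subset_eq) auto
    have "perfect_matching (vertices_A A) (edges_A A) M"
      unfolding perfect_matching_def
    proof
      show "matching (edges_A A) M" using max(1) edge R(2) Rd by (auto simp: matching_def)
      show "vertices_A A \<subseteq> (\<Union>e\<in>M. endpoints e)"
      proof
        fix x assume "x \<in> vertices_A A"
        then consider "x \<in> src ` {..<d}" | i where "i < d" "x = V2 i" unfolding vertices_A_def onto dims by blast
        then obtain i where "i < d" "x = src i \<or> x = V2 i" by cases auto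
        then show "x \<in> (\<Union>e\<in>M. endpoints e)" using srcM[of i] by (intro UN_I) (auto simp: endpoints_def)
      qed
    qed
    then show False using no_perfect by blast
  qed
  then obtain h where h: "h < d" "src h \<notin> range V1" by blast
  have scBs: "structurally_controllable A Bs"
    unfolding Bs by (rule saturating_matching_imp_structurally_controllable
      [OF A B conn R(2)[unfolded Rd] ME R(3)[unfolded Rd] h])
  have "zero_pattern B \<subseteq> zero_pattern Bs"
    using ME by (auto simp: zero_pattern_def Bs pattern_of_matching_def dims edges_A_def edges_B_def)
  then have feas: "Bs \<in> feasible A B" using scBs by (simp add: feasible_def dims Bs pattern_of_matching_def)
  have "weight w Bs \<le> weight w B'" if B': "B' \<in> feasible A B" for B'
  proof -
    have c: "B' \<in> carrier_mat d m" "zero_pattern B \<subseteq> zero_pattern B'" "structurally_controllable A B'"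
      using B' by (auto simp: feasible_def dims)
    then have nz: "B $$ (i, j) \<noteq> Zero" if "i < d" "j < m" "B' $$ (i, j) \<noteq> Zero" for i j
      using that by (auto simp: zero_pattern_def dims)
    obtain N where N: "matching (edges_A A \<union> edges_B B') N" "card N = d"
      using structurally_controllable_imp_matching[OF A c(1,3)] by blast
    have NE: "N \<subseteq> edges_A A \<union> edges_B B'" using N by (simp add: matching_def)
    have "edges_B B' \<subseteq> edges_B B" using c(1) nz by (auto simp: edges_B_def dims)
    \<comment> \<open>A feasible pattern only removes input edges, so its saturating matching
      competes in the original graph and has the maximum cardinality \<open>d\<close>.\<close>
    then have "matching ?E N" using N(1) unfolding matching_def by blast
    then have "max_matching ?E N" using max(2) N(2) cardM by (simp add: max_matching_def)
    then have "sum (edge_cost w) M \<le> sum (edge_cost w) N" by (rule min)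
    also have "\<dots> \<le> weight w B'"
    proof (rule matching_cost_le_weight[OF NE])
      show "finite N" using N(2) h(1) card.infinite by fastforce
    qed (use c(1) nz w in auto)
    finally show ?thesis unfolding Bs weight_pattern_of_matching[OF ME finM B] .
  qed
  then show ?thesis using scBs feas by (auto simp: is_arg_min_def not_less)
qed

theorem theorem4p7:
  fixes d m :: nat and A B :: "entry mat" and w :: "real mat"
  assumes "A \<in> carrier_mat d d" and "B \<in> carrier_mat d m" and "w \<in> carrier_mat d m"
    and "structurally_controllable A B"
    and "\<forall>i < d. \<forall>j < m. B $$ (i, j) \<noteq> Zero \<longrightarrow> 0 \<le> w $$ (i, j)"
    and "strongly_connected (state_digraph A)"
    and "\<not> (\<exists>M. perfect_matching (vertices_A A) (edges_A A) M)"
  shows "(\<forall>M Bs. matching_algorithm d m A B w M Bs \<longrightarrow>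
            structurally_controllable A Bs \<and>
            is_arg_min (weight w) (\<lambda>B'. B' \<in> feasible A B) Bs) \<and>
         (\<exists>C :: nat. \<forall>(d' :: nat) (m' :: nat) A' B' w' s.
            0 < d' \<longrightarrow> A' \<in> carrier_mat d' d' \<longrightarrow> B' \<in> carrier_mat d' m' \<longrightarrow> w' \<in> carrier_mat d' m' \<longrightarrow>
            (\<forall>i < d'. \<forall>j < m'. B' $$ (i, j) \<noteq> Zero \<longrightarrow> 0 \<le> w' $$ (i, j)) \<longrightarrow>
            input_state d' m' A' B' w' s \<longrightarrow>
            (\<exists>t s'. exec matching_program s t s' \<and> t \<le> C * (d' + m') ^ 3 \<and>
               matching_algorithm d' m' A' B' w' (output_matching d' m' s') (output_matrix d' m' s')))"
proof
  show "\<forall>M Bs. matching_algorithm d m A B w M Bs \<longrightarrow>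
      structurally_controllable A Bs \<and> is_arg_min (weight w) (\<lambda>B'. B' \<in> feasible A B) Bs"
    using matching_algorithm_optimal[OF assms(1,2,4-7)] by blast
qed (rule exI[of _ 40000], intro allI impI, rule matching_program_correct)

end
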